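(* Let $0<p<1$. (a) Let $\alpha\ge0$. There exists a constant $c_p$, depending only on $p$ (for the fixed $\alpha$ and the fixed Vilenkin group $G_m$), such that for every $f\in H_p^{\square}(G_m^2)$ $$\sum_{\{(k,l)\,:\,k,l\ge 1,\ 2^{-\alpha}\le k/l\le 2^{\alpha}\}}\frac{\Vert S_{k,l}f\Vert_p^p}{(kl)^{2-p}}\le c_p\Vert f\Vert_{H_p^{\square}(G_m^2)}^p .$$ (b) Let $\alpha>0$ and let $\Phi:\mathbb N^2\to[1,\infty)$ be a function that is non-decreasing (in each variable) and satisfies $$\limsup_{m,n\to\infty}\Phi(m,n)=+\infty .$$ Then there exists a martingale $f\in H_p^{\square}(G_m^2)$ such that $$\sum_{\{(k,l)\,:\,k,l\ge 1,\ 2^{-\alpha}\le k/l\le 2^{\alpha}\}}\frac{\Vert S_{k,l}f\Vert_p^p\,\Phi(k,l)}{(kl)^{2-p}}=\infty .$$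
   Context: $\mathbb N=\{0,1,2,\dots\}$. Let $(m_k)_{k\in\mathbb N}$ be a bounded sequence of integers $m_k\ge 2$, fixed throughout. $G_m=\prod_{k=0}^\infty Z_{m_k}$ is the corresponding (bounded) Vilenkin group, where $Z_{m_k}=\{0,\dots,m_k-1\}$ is the additive group of integers modulo $m_k$, with the product of the discrete topologies; $\mu$ is its normalized Haar measure (the product of the uniform measures on the $Z_{m_k}$). The subscript in $G_m$ only refers to this sequence. Put $M_0=1$, $M_{k+1}=m_kM_k$. For $x=(x_0,x_1,\dots)\in G_m$ put $I_0(x)=G_m$ and $I_n(x)=\{y\in G_m: y_0=x_0,\dots,y_{n-1}=x_{n-1}\}$. Every $n\in\mathbb N$ is uniquely $n=\sum_{j\ge 0} n_jM_j$ with $n_j\in Z_{m_j}$. With $r_k(x)=\exp(2\pi i x_k/m_k)$, the Vilenkin functions are $\psi_n(x)=\prod_{k\ge0} r_k^{n_k}(x)$. Let $\mathcal F_{n,n}$ be the $\sigma$-algebra on $G_m^2$ generated by the squares $I_n(x)\times I_n(y)$, $x,y\in G_m$. Martingales $f=(f_{n,n})_{n\in\mathbb N}$ are with respect to $(\mathcal F_{n,n})_{n\in\mathbb N}$. Let $f^*=\sup_n|f_{n,n}|$. For $0<p<\infty$, $H_p^{\square}(G_m^2)$ is the space of all martingales with $\Vert f\Vert_{H_p^\square(G_m^2)}:=\Vert f^*\Vert_p<\infty$, where $\Vert g\Vert_p=(\int_{G_m^2}|g|^p\,d(\mu\times\mu))^{1/p}$. For a martingale $f$, its Vilenkin-Fourier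 coefficients are $\widehat f(i,j)=\lim_{k\to\infty}\int_{G_m^2} f_{k,k}(x,y)\overline{\psi_i(x)}\,\overline{\psi_j(y)}\,d\mu(x)d\mu(y)$, and the rectangular partial sums are $S_{k,l}f(x,y)=\sum_{i=0}^{k-1}\sum_{j=0}^{l-1}\widehat f(i,j)\psi_i(x)\psi_j(y)$. *)

theory Defs
  imports "HOL-Probability.Probability"
begin

definition vil_seq :: "(nat \<Rightarrow> nat) \<Rightarrow> bool" where
  "vil_seq m \<longleftrightarrow> (\<forall>k. 2 \<le> m k) \<and> (\<exists>B. \<forall>k. m k \<le> B)"

text \<open>
  The group elements are the sequences \<open>x\<close> with \<open>x k \<in> {0..<m k}\<close>.  The group law and the topology
  enter the statement only through the Haar measure and the cylinder sets, so they are not made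
  explicit: the Haar measure is the product of the uniform measures on the factors.
\<close>

definition vil_measure :: "(nat \<Rightarrow> nat) \<Rightarrow> (nat \<Rightarrow> nat) measure" where
  "vil_measure m = (\<Pi>\<^sub>M k\<in>UNIV. uniform_count_measure {0..<m k})"

abbreviation vil_group :: "(nat \<Rightarrow> nat) \<Rightarrow> (nat \<Rightarrow> nat) set" where
  "vil_group m \<equiv> space (vil_measure m)"

definition vil_measure2 :: "(nat \<Rightarrow> nat) \<Rightarrow> ((nat \<Rightarrow> nat) \<times> (nat \<Rightarrow> nat)) measure" where
  "vil_measure2 m = vil_measure m \<Otimes>\<^sub>M vil_measure m"

definition vil_M :: "(nat \<Rightarrow> nat) \<Rightarrow> nat \<Rightarrow> nat" where
  "vil_M m n = (\<Prod>k<n. m k)"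

definition vil_I :: "(nat \<Rightarrow> nat) \<Rightarrow> nat \<Rightarrow> (nat \<Rightarrow> nat) \<Rightarrow> (nat \<Rightarrow> nat) set" where
  "vil_I m n x = {y \<in> vil_group m. \<forall>i<n. y i = x i}"

text \<open>
  The digits of \<open>n\<close> in the mixed radix system \<open>(M\<^sub>k)\<close>; see \<open>vil_digit_less\<close>, \<open>vil_digit_expansion\<close> and
  \<open>vil_digit_unique\<close> below.
\<close>

definition vil_digit :: "(nat \<Rightarrow> nat) \<Rightarrow> nat \<Rightarrow> nat \<Rightarrow> nat" where
  "vil_digit m n j = n div vil_M m j mod m j"

definition vil_r :: "(nat \<Rightarrow> nat) \<Rightarrow> nat \<Rightarrow> (nat \<Rightarrow> nat) \<Rightarrow> complex" where
  "vil_r m k x = exp (2 * of_real pi * \<i> * of_nat (x k) / of_nat (m k))"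

text \<open>The infinite product has only finitely many factors different from 1; see \<open>vil_psi_eq\<close>.\<close>

definition vil_psi :: "(nat \<Rightarrow> nat) \<Rightarrow> nat \<Rightarrow> (nat \<Rightarrow> nat) \<Rightarrow> complex" where
  "vil_psi m n x = (\<Prod>k. vil_r m k x ^ vil_digit m n k)"


definition complex_cond_exp :: "'a measure \<Rightarrow> 'a measure \<Rightarrow> ('a \<Rightarrow> complex) \<Rightarrow> 'a \<Rightarrow> complex" where
  "complex_cond_exp M F f x =
     Complex (real_cond_exp M F (\<lambda>z. Re (f z)) x) (real_cond_exp M F (\<lambda>z. Im (f z)) x)"

definition complex_martingale :: "'a measure \<Rightarrow> (nat \<Rightarrow> 'a measure) \<Rightarrow> (nat \<Rightarrow> 'a \<Rightarrow> complex) \<Rightarrow> bool" where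
  "complex_martingale M F f \<longleftrightarrow>
     (\<forall>n. f n \<in> borel_measurable (F n) \<and> integrable M (f n)) \<and>
     (\<forall>k n. k \<le> n \<longrightarrow> (AE x in M. complex_cond_exp M (F k) (f n) x = f k x))"

definition vil_F :: "(nat \<Rightarrow> nat) \<Rightarrow> nat \<Rightarrow> ((nat \<Rightarrow> nat) \<times> (nat \<Rightarrow> nat)) measure" where
  "vil_F m n = sigma (vil_group m \<times> vil_group m)
     {vil_I m n x \<times> vil_I m n y |x y. x \<in> vil_group m \<and> y \<in> vil_group m}"

text \<open>
  The power \<open>a\<^sup>p\<close> with values in \<open>[0,\<infinity>]\<close>, for exponents \<open>p > 0\<close> only.  It is needed because the
  maximal function may take the value \<open>\<infinity>\<close>.
\<close>

definition epowr :: "ennreal \<Rightarrow> real \<Rightarrow> ennreal" where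
  "epowr a p = (if a = \<infinity> then \<infinity> else ennreal (enn2real a powr p))"

definition Lp_norm :: "'a measure \<Rightarrow> real \<Rightarrow> ('a \<Rightarrow> ennreal) \<Rightarrow> ennreal" where
  "Lp_norm M p g = epowr (\<integral>\<^sup>+ x. epowr (g x) p \<partial>M) (1 / p)"

definition maximal_fun :: "(nat \<Rightarrow> 'a \<Rightarrow> complex) \<Rightarrow> 'a \<Rightarrow> ennreal" where
  "maximal_fun f z = (SUP n. ennreal (cmod (f n z)))"

definition H_norm :: "(nat \<Rightarrow> nat) \<Rightarrow> real \<Rightarrow> (nat \<Rightarrow> (nat \<Rightarrow> nat) \<times> (nat \<Rightarrow> nat) \<Rightarrow> complex) \<Rightarrow> ennreal" where
  "H_norm m p f = Lp_norm (vil_measure2 m) p (maximal_fun f)"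

definition H_square :: "(nat \<Rightarrow> nat) \<Rightarrow> real \<Rightarrow> (nat \<Rightarrow> (nat \<Rightarrow> nat) \<times> (nat \<Rightarrow> nat) \<Rightarrow> complex) set" where
  "H_square m p = {f. complex_martingale (vil_measure2 m) (vil_F m) f \<and> H_norm m p f < \<infinity>}"


definition vil_coeff :: "(nat \<Rightarrow> nat) \<Rightarrow> (nat \<Rightarrow> (nat \<Rightarrow> nat) \<times> (nat \<Rightarrow> nat) \<Rightarrow> complex) \<Rightarrow> nat \<Rightarrow> nat \<Rightarrow> complex" where
  "vil_coeff m f i j =
     lim (\<lambda>k. \<integral>z. f k z * cnj (vil_psi m i (fst z)) * cnj (vil_psi m j (snd z)) \<partial>vil_measure2 m)"

definition vil_S :: "(nat \<Rightarrow> nat) \<Rightarrow> (nat \<Rightarrow> (nat \<Rightarrow> nat) \<times> (nat \<Rightarrow> nat) \<Rightarrow> complex) \<Rightarrow> nat \<Rightarrow> nat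
    \<Rightarrow> (nat \<Rightarrow> nat) \<times> (nat \<Rightarrow> nat) \<Rightarrow> complex" where
  "vil_S m f k l z = (\<Sum>i<k. \<Sum>j<l. vil_coeff m f i j * vil_psi m i (fst z) * vil_psi m j (snd z))"

definition ratio_cone :: "real \<Rightarrow> (nat \<times> nat) set" where
  "ratio_cone \<alpha> = {(k, l). 1 \<le> k \<and> 1 \<le> l \<and> 2 powr (- \<alpha>) \<le> real k / real l \<and> real k / real l \<le> 2 powr \<alpha>}"


lemma vil_M_Suc: "vil_M m (Suc n) = m n * vil_M m n"
  by (simp add: vil_M_def mult.commute)

lemma vil_M_0: "vil_M m 0 = 1"
  by (simp add: vil_M_def)

lemma vil_M_ge: "vil_seq m \<Longrightarrow> 2 ^ n \<le> vil_M m n"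
  by (induction n) (auto simp: vil_M_Suc vil_M_0 vil_seq_def intro: mult_mono)

lemma vil_digit_less: "vil_seq m \<Longrightarrow> vil_digit m n j < m j"
  unfolding vil_digit_def vil_seq_def by (meson mod_less_divisor less_le_trans pos2)

lemma vil_digit_eq_0:
  assumes "vil_seq m" "n \<le> j"
  shows "vil_digit m n j = 0"
proof -
  have "n \<le> j" "j < 2 ^ j" "2 ^ j \<le> vil_M m j"
    using assms vil_M_ge by auto
  then have "n < vil_M m j" by linarith
  then show ?thesis by (simp add: vil_digit_def)
qed

lemma vil_digit_mod: "(\<Sum>j<N. vil_digit m n j * vil_M m j) = n mod vil_M m N"
proof (induction N)
  case (Suc N)
  have "n mod vil_M m (Suc N) = vil_M m N * (n div vil_M m N mod m N) + n mod vil_M m N"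
    unfolding vil_M_Suc mult.commute[of "m N"] by (rule mod_mult2_eq)
  with Suc show ?case
    by (simp add: vil_digit_def)
qed (simp add: vil_M_0)

lemma vil_digit_expansion:
  assumes "vil_seq m"
  shows "n = (\<Sum>j<n. vil_digit m n j * vil_M m j)"
proof -
  have "n < vil_M m n"
    using vil_M_ge[OF assms, of n] less_exp[of n] by linarith
  then show ?thesis by (simp add: vil_digit_mod)
qed

lemma vil_digit_unique:
  assumes "vil_seq m" "\<And>j. d j < m j" "j < N"
  shows "vil_digit m (\<Sum>j<N. d j * vil_M m j) j = d j"
  using assms(3)
proof (induction N)
  case (Suc N)
  have pos: "0 < vil_M m i" for i
    using vil_M_ge[OF assms(1), of i] by (metis less_le_trans zero_less_numeral zero_less_power)
  have bound: "(\<Sum>j<K. d j * vil_M m j) < vil_M m K" for K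
  proof (induction K)
    case (Suc K)
    have "Suc (d K) * vil_M m K \<le> m K * vil_M m K"
      using assms(2)[of K] by (intro mult_right_mono) auto
    with Suc show ?case by (simp add: vil_M_Suc)
  qed (simp add: vil_M_0)
  show ?case
  proof (cases "j = N")
    case True
    have "(\<Sum>j<N. d j * vil_M m j) div vil_M m N = 0"
      using bound[of N] by (rule div_less)
    then have "(\<Sum>j<Suc N. d j * vil_M m j) div vil_M m N = d N"
      using pos[of N] by (simp only: sum.lessThan_Suc) (simp only: div_mult_self1[OF less_imp_neq[THEN not_sym]] add_0_right)
    then show ?thesis
      using True assms(2)[of N] by (simp only: vil_digit_def mod_less)
  next
    case False
    with Suc.prems have "j < N" by simp
    then have "vil_M m (Suc j) dvd vil_M m N"
      unfolding vil_M_def by (intro prod_dvd_prod_subset) auto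
    then obtain c where "vil_M m N = vil_M m (Suc j) * c"
      by (rule dvdE)
    then have c: "vil_M m N = vil_M m j * (m j * c)"
      by (simp add: vil_M_Suc mult_ac)
    have "(\<Sum>i<Suc N. d i * vil_M m i) = (\<Sum>i<N. d i * vil_M m i) + (m j * (c * d N)) * vil_M m j"
      by (simp add: c mult_ac)
    then have "(\<Sum>i<Suc N. d i * vil_M m i) div vil_M m j
        = m j * (c * d N) + (\<Sum>i<N. d i * vil_M m i) div vil_M m j"
      using pos[of j] by (simp only: div_mult_self1[OF less_imp_neq[THEN not_sym]])
    then have "vil_digit m (\<Sum>i<Suc N. d i * vil_M m i) j = vil_digit m (\<Sum>i<N. d i * vil_M m i) j"
      unfolding vil_digit_def by (simp only: mod_mult_self4)
    then show ?thesis
      using Suc.IH[OF \<open>j < N\<close>] by (rule trans)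
  qed
qed simp

lemma vil_psi_eq:
  assumes "vil_seq m"
  shows "vil_psi m n x = (\<Prod>k<n. vil_r m k x ^ vil_digit m n k)"
  unfolding vil_psi_def
  by (rule prodinf_finite) (auto simp: vil_digit_eq_0[OF assms])

lemma vil_group_eq: "vil_group m = (\<Pi>\<^sub>E k\<in>UNIV. {0..<m k})"
  by (simp add: vil_measure_def space_PiM space_uniform_count_measure)

lemma vil_measure_prob:
  assumes "vil_seq m"
  shows "prob_space (vil_measure m)"
  unfolding vil_measure_def
proof (rule prob_space_PiM)
  fix k
  have "0 < m k" using assms unfolding vil_seq_def by (meson less_le_trans pos2)
  then show "prob_space (uniform_count_measure {0..<m k})"
    by (intro prob_space_uniform_count_measure) auto
qed

lemma vil_measure2_prob:
  assumes "vil_seq m"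
  shows "prob_space (vil_measure2 m)"
  unfolding vil_measure2_def
  using vil_measure_prob[OF assms] by (simp add: prob_space_pair)

lemma vil_I_sets: "vil_I m n x \<in> sets (vil_measure m)"
proof -
  have [measurable]: "(\<lambda>y. y i) \<in> vil_measure m \<rightarrow>\<^sub>M count_space UNIV" for i
  proof -
    have "(\<lambda>y. y i) \<in> vil_measure m \<rightarrow>\<^sub>M uniform_count_measure {0..<m i}"
      unfolding vil_measure_def by (rule measurable_component_singleton) simp
    then show ?thesis
      by (rule measurable_compose) (simp add: measurable_cong_sets[OF sets_uniform_count_measure_count_space refl])
  qed
  show ?thesis unfolding vil_I_def by measurable
qed

lemma vil_F_subalgebra: "subalgebra (vil_measure2 m) (vil_F m n)"
proof -
  let ?A = "{vil_I m n x \<times> vil_I m n y |x y. x \<in> vil_group m \<and> y \<in> vil_group m}"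
  have sp: "space (vil_measure2 m) = vil_group m \<times> vil_group m"
    by (simp add: vil_measure2_def space_pair_measure)
  have A: "?A \<subseteq> sets (vil_measure2 m)"
    unfolding vil_measure2_def using vil_I_sets by auto
  have "?A \<subseteq> Pow (vil_group m \<times> vil_group m)"
    by (auto simp: vil_I_def)
  then have "sets (vil_F m n) = sigma_sets (vil_group m \<times> vil_group m) ?A"
    and "space (vil_F m n) = vil_group m \<times> vil_group m"
    unfolding vil_F_def by (rule sets_measure_of, rule space_measure_of)
  then show ?thesis
    using sets.sigma_sets_subset[OF A] unfolding subalgebra_def sp by (intro conjI) (simp_all only:)
qed

end

theory Submission
  imports Defs
begin

text \<open>
  Both parts become statements about finite sums. A member \<open>f n\<close> of a martingale is constant on the
  squares of level \<open>n\<close>, and a partial sum of order \<open>k, l \<le> M n\<close> depends on \<open>f n\<close> only. Numbering the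
  cells of level \<open>n\<close> by \<open>a < M n\<close>, the digits of \<open>a\<close> being the common coordinates, turns integrals into
  averages over \<open>{..<M n} \<times> {..<M n}\<close>.

  Part (a). The kernel of order \<open>k\<close> is bounded by \<open>M t\<close> at two points that differ in one of the first
  \<open>t\<close> coordinates, because complete blocks of \<open>M t\<close> characters cancel (\<open>norm_ker_le\<close>). Together with
  Bessel's inequality this controls the partial sums of an atom on a square \<open>Q\<close> of level \<open>N\<close>: for
  \<open>p < 1\<close> the contributions of the annuli around \<open>Q\<close> form geometric series, and if the atom is bounded
  by \<open>A\<close>, the \<open>p\<close>-th moment of its partial sums is at most of order \<open>A powr p * M N powr (2 - 2 * p)\<close>
  times the measure of \<open>Q\<close> (\<open>Lp_sum_proj2_atom\<close>). For an atom with mean zero the partial sums of orders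
  \<open>k, l \<le> M N\<close> vanish, so in the cone only \<open>k\<close> and \<open>l\<close> of order at least \<open>M N\<close> occur, and the sum of
  \<open>(k * l) powr (p - 2)\<close> over these is of order \<open>M N powr (2 * p - 2)\<close>. Hence the strong sum of such an
  atom is at most a constant times \<open>A powr p\<close> times the measure of \<open>Q\<close> (\<open>strong_sum_atom\<close>). The general case follows by
  stopping the martingale at the levels \<open>t0 * 2 ^ k\<close>: the differences of consecutive stopped
  martingales split into atoms, and the total measure of the squares of one generation is controlled
  by the measure of the set where the maximal function exceeds the level (\<open>strong_sum_le_maxF\<close>). The
  bound does not depend on \<open>n\<close>, so it passes to the infinite sum (\<open>strong_sum_le_H_norm\<close>).

  Part (b). Take a martingale whose Fourier coefficients are \<open>c j\<close> on \<open>{M (N j)..<2 * M (N j)}\<close> in both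
  variables and zero elsewhere. Each block of characters is an atom, with \<open>p\<close>-th moment of order
  \<open>M (N j) powr (2 * p - 2)\<close>, so \<open>c j powr p = M (N j) powr (2 - 2 * p) / 2 ^ j\<close> puts the martingale
  into the Hardy space (\<open>lac_in_H_square\<close>). At points with nonzero first coordinates all complete
  blocks vanish, and for \<open>k\<close> and \<open>l\<close> just above \<open>M (N j)\<close> and congruent to \<open>1\<close> modulo \<open>m 0\<close> exactly one
  term of the \<open>j\<close>-th block survives, so that the partial sum has modulus \<open>c j\<close> there
  (\<open>Lp_norm_vil_S_lac_ge\<close>). There are of order \<open>M (N j) ^ 2\<close> such pairs in the cone; they contribute a
  multiple of \<open>\<Phi> (M (N j)) (M (N j)) / 2 ^ j\<close>, which is unbounded if \<open>N j\<close> is chosen large enough.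
\<close>

section \<open>Vilenkin functions and their Dirichlet kernels\<close>

lemma sum_lessThan_add:
  fixes f :: "nat \<Rightarrow> 'a::comm_monoid_add"
  shows "sum f {..<a + b} = sum f {..<a} + (\<Sum>i<b. f (a + i))"
  by (induction b) (simp_all add: add.assoc)

lemma sum_over_blocks:
  fixes f :: "nat \<Rightarrow> 'a::comm_monoid_add"
  shows "sum f {..<q * K} = (\<Sum>c<q. \<Sum>i<K. f (c * K + i))"
  by (induction q) (simp_all add: sum_lessThan_add add.commute[of K])

locale vilenkin =
  fixes m :: "nat \<Rightarrow> nat" and B :: nat
  assumes m_ge2: "2 \<le> m k" and m_le: "m k \<le> B"
begin

abbreviation "M \<equiv> vil_M m"
abbreviation "\<psi> \<equiv> vil_psi m"
abbreviation "dig \<equiv> vil_digit m"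

lemma seq: "vil_seq m"
  using m_ge2 m_le by (auto simp: vil_seq_def)

lemma m_pos [simp]: "0 < m k"
  using m_ge2[of k] by linarith

lemma M_pos [simp]: "0 < M n"
  unfolding vil_M_def by (simp add: prod_pos)

lemma M_dvd: "s \<le> n \<Longrightarrow> M s dvd M n"
  unfolding vil_M_def by (intro prod_dvd_prod_subset) auto

lemma M_mono: "s \<le> n \<Longrightarrow> M s \<le> M n"
  using M_dvd M_pos by (simp add: dvd_imp_le)

lemma less_M: "n < M n"
  using vil_M_ge[OF seq, of n] less_exp[of n] by linarith

lemma M_Suc_le: "M (Suc n) \<le> B * M n"
  using m_le by (simp add: vil_M_Suc)

lemma mod_M_mod_M: "s \<le> n \<Longrightarrow> a mod M n mod M s = a mod M s"
  by (simp add: M_dvd mod_mod_cancel)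

lemma mod_M_eq_mono: "s \<le> n \<Longrightarrow> a mod M n = b mod M n \<Longrightarrow> a mod M s = b mod M s"
  by (metis mod_M_mod_M)

lemma dig_less: "dig a k < m k"
  by (rule vil_digit_less[OF seq])

lemma dig_eq_0: "a < M n \<Longrightarrow> n \<le> k \<Longrightarrow> dig a k = 0"
  using M_mono[of n k] by (simp add: vil_digit_def)

lemma M_factor:
  assumes "k < s"
  obtains d where "M s = m k * d * M k"
proof -
  obtain d where "M s = M (Suc k) * d"
    using M_dvd[of "Suc k" s] assms by (auto elim: dvdE)
  then show ?thesis using that[of d] by (simp add: vil_M_Suc mult_ac)
qed

lemma dig_add_mult:
  assumes "k < s"
  shows "dig (c * M s + i) k = dig i k"
proof -
  obtain d where "M s = m k * d * M k" using M_factor[OF assms] .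
  then have "c * M s + i = i + (m k * (c * d)) * M k"
    by (simp add: mult_ac)
  moreover have "(i + (m k * (c * d)) * M k) div M k = m k * (c * d) + i div M k"
    by (rule div_mult_self1) (simp add: M_pos[THEN less_imp_neq, THEN not_sym])
  ultimately have "(c * M s + i) div M k = m k * (c * d) + i div M k"
    by (rule trans[OF arg_cong])
  then show ?thesis unfolding vil_digit_def by (simp only: mod_mult_self4)
qed

text \<open>
  Adding \<open>i < M s\<close> to a multiple of \<open>M s\<close> causes no carry; this is what makes blocks of characters
  factor in \<open>psi_block\<close>.
\<close>

lemma dig_block:
  assumes "i < M s"
  shows "dig (c * M s + i) k = dig (c * M s) k + dig i k"
proof (cases "k < s")
  case True
  show ?thesis
    using dig_add_mult[OF True, of c i] dig_add_mult[OF True, of c 0]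
    by (simp add: vil_digit_def)
next
  case False
  then obtain d where d: "M k = M s * d"
    using M_dvd[of s k] by (auto elim: dvdE)
  have "(c * M s + i) div M k = c div d" "c * M s div M k = c div d"
    using assms by (simp_all add: d div_mult2_eq)
  moreover have "dig i k = 0"
    using dig_eq_0[OF assms] False by simp
  ultimately show ?thesis
    by (simp add: vil_digit_def)
qed

lemma dig_mult_M:
  assumes "c < m s"
  shows "dig (c * M s) k = (if k = s then c else 0)"
proof -
  consider "k < s" | "k = s" | "s < k" by linarith
  then show ?thesis
  proof cases
    case 1
    then show ?thesis using dig_add_mult[of k s c 0] by (simp add: vil_digit_def)
  next
    case 3
    have "c * M s < M (Suc s)" using assms by (simp add: vil_M_Suc)
    then show ?thesis using dig_eq_0[of _ "Suc s" k] 3 by simp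
  qed (use assms in \<open>simp add: vil_digit_def\<close>)
qed

lemma dig_mod_eq_iff: "a mod M n = b mod M n \<longleftrightarrow> (\<forall>k<n. dig a k = dig b k)"
proof
  assume *: "a mod M n = b mod M n"
  have "dig a k = dig (a mod M n) k" if "k < n" for a k
    using dig_add_mult[OF that, of "a div M n" "a mod M n"] by (simp only: div_mult_mod_eq)
  with * show "\<forall>k<n. dig a k = dig b k" by metis
next
  assume "\<forall>k<n. dig a k = dig b k"
  then have "(\<Sum>j<n. dig a j * M j) = (\<Sum>j<n. dig b j * M j)" by simp
  then show "a mod M n = b mod M n" by (simp add: vil_digit_mod)
qed

lemma psi_prod:
  assumes "i < M n"
  shows "\<psi> i x = (\<Prod>k<n. vil_r m k x ^ dig i k)"
  unfolding vil_psi_def by (rule prodinf_finite) (auto simp: dig_eq_0[OF assms])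

lemma psi_block:
  assumes "i < M s"
  shows "\<psi> (c * M s + i) x = \<psi> (c * M s) x * \<psi> i x"
proof -
  let ?n = "c * M s + i"
  have "?n < M ?n" "c * M s < M ?n" "i < M ?n"
    using less_M[of ?n] by linarith+
  then show ?thesis
    by (simp add: psi_prod[of _ ?n] dig_block[OF assms] power_add prod.distrib)
qed

lemma psi_mult_M:
  assumes "c < m s"
  shows "\<psi> (c * M s) x = vil_r m s x ^ c"
proof -
  have "c * M s < M (Suc s)" using assms by (simp add: vil_M_Suc)
  then show ?thesis
    by (simp add: psi_prod[of _ "Suc s"] dig_mult_M[OF assms])
qed

lemma norm_r [simp]: "cmod (vil_r m k x) = 1"
proof -
  have "2 * of_real pi * \<i> * of_nat (x k) / of_nat (m k)
      = \<i> * complex_of_real (2 * pi * real (x k) / real (m k))" by simp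
  then show ?thesis unfolding vil_r_def by (simp only: norm_exp_i_times)
qed

lemma norm_psi [simp]: "cmod (\<psi> i x) = 1"
  using psi_prod[OF less_M, of i x] by (simp add: prod_norm[symmetric] norm_power)

lemma psi_0 [simp]: "\<psi> 0 x = 1"
  using psi_prod[of 0 0 x] by (simp add: vil_M_0)

lemma psi_cong: "i < M n \<Longrightarrow> (\<And>k. k < n \<Longrightarrow> x k = u k) \<Longrightarrow> \<psi> i x = \<psi> i u"
  by (simp add: psi_prod vil_r_def)

text \<open>
  The orthogonality of the characters of a single factor \<open>Z\<^bsub>m s\<^esub>\<close>.
\<close>

lemma sum_powers_r:
  assumes "x s < m s" "u s < m s"
  shows "(\<Sum>c<m s. (vil_r m s x * cnj (vil_r m s u)) ^ c) = (if x s = u s then of_nat (m s) else 0)"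
proof -
  let ?w = "vil_r m s x * cnj (vil_r m s u)"
  have root: "vil_r m s y ^ m s = 1" for y
    unfolding vil_r_def using complex_root_unity[of "m s" "y s"] by simp
  have "?w ^ m s = 1"
    using root[of x] root[of u] by (simp add: power_mult_distrib flip: complex_cnj_power)
  have cu: "vil_r m s u * cnj (vil_r m s u) = 1"
    using complex_norm_square[of "vil_r m s u"] by simp
  have "?w = 1 \<longleftrightarrow> vil_r m s x = vil_r m s u"
    using cu by (metis mult.commute mult.left_neutral mult.assoc)
  also have "\<dots> \<longleftrightarrow> x s = u s"
    unfolding vil_r_def using complex_root_unity_eq[of "m s" "x s" "u s"] assms
    by (simp add: Suc_leI)
  finally show ?thesis
    using geometric_sum[of ?w "m s"] \<open>?w ^ m s = 1\<close> by auto
qed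

text \<open>The Dirichlet kernel of order \<open>k\<close>, as a function of two points rather than of their difference.\<close>

definition ker :: "nat \<Rightarrow> (nat \<Rightarrow> nat) \<Rightarrow> (nat \<Rightarrow> nat) \<Rightarrow> complex" where
  "ker k x u = (\<Sum>i<k. \<psi> i x * cnj (\<psi> i u))"

lemma ker_mult_M: "ker (q * M s) x u = (\<Sum>c<q. \<psi> (c * M s) x * cnj (\<psi> (c * M s) u)) * ker (M s) x u"
  unfolding ker_def sum_over_blocks sum_product
  by (intro sum.cong refl) (simp add: psi_block)

text \<open>
  Splitting the \<open>M (Suc s)\<close> terms into \<open>m s\<close> blocks of length \<open>M s\<close> takes out a full sum over the
  characters of the coordinate \<open>s\<close>, which is \<open>m s\<close> or \<open>0\<close>.
\<close>

lemma ker_M: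
  assumes "\<And>k. x k < m k" "\<And>k. u k < m k"
  shows "ker (M s) x u = (if \<forall>k<s. x k = u k then of_nat (M s) else 0)"
proof (induction s)
  case 0
  then show ?case by (simp add: ker_def vil_M_0)
next
  case (Suc s)
  have "(\<Sum>c<m s. \<psi> (c * M s) x * cnj (\<psi> (c * M s) u))
      = (\<Sum>c<m s. (vil_r m s x * cnj (vil_r m s u)) ^ c)"
    by (intro sum.cong refl) (simp add: psi_mult_M power_mult_distrib)
  then show ?case
    using Suc sum_powers_r[of x s u] assms by (auto simp: vil_M_Suc ker_mult_M less_Suc_eq split: if_splits)
qed

text \<open>
  If \<open>x\<close> and \<open>u\<close> differ in one of the first \<open>t\<close> coordinates, then each full block of \<open>M\<^sub>t\<close>
  consecutive terms of the kernel cancels, so that only the incomplete last block remains.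
\<close>

lemma norm_ker_le:
  assumes "\<And>k. x k < m k" "\<And>k. u k < m k" "\<exists>k<t. x k \<noteq> u k"
  shows "cmod (ker k x u) \<le> real (M t)"
proof -
  let ?q = "k div M t" and ?r = "k mod M t"
  have "ker k x u = ker (?q * M t) x u + (\<Sum>i<?r. \<psi> (?q * M t + i) x * cnj (\<psi> (?q * M t + i) u))"
    using sum_lessThan_add[of "\<lambda>i. \<psi> i x * cnj (\<psi> i u)" "?q * M t" ?r]
    unfolding ker_def div_mult_mod_eq .
  moreover have "ker (?q * M t) x u = 0"
    using assms ker_M[of x u t] by (auto simp: ker_mult_M)
  ultimately have "cmod (ker k x u) \<le> (\<Sum>i<?r. 1)"
    using sum_norm_le[of "{..<?r}" "\<lambda>i. \<psi> (?q * M t + i) x * cnj (\<psi> (?q * M t + i) u)" "\<lambda>_. 1"]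
    by (simp add: norm_mult)
  also have "\<dots> \<le> real (M t)"
    using mod_less_divisor[OF M_pos, of k t] by simp
  finally show ?thesis .
qed

text \<open>
  The characters at the points \<open>dig a\<close>, which represent the cells. Up to level \<open>n\<close> the characters and the
  cells are numbered by the same set, and the pairing is symmetric.
\<close>

abbreviation "chr i a \<equiv> \<psi> i (dig a)"

lemma chr_sym: "i < M n \<Longrightarrow> a < M n \<Longrightarrow> chr i a = chr a i"
  by (simp add: psi_prod vil_r_def exp_of_nat_mult[symmetric] mult_ac)

text \<open>
  By symmetry a sum over points is a sum over characters, that is, a kernel of order \<open>M n\<close>.
\<close>

lemma chr_orthogonal:
  assumes "i < M n" "j < M n"
  shows "(\<Sum>a<M n. chr i a * cnj (chr j a)) = (if i = j then of_nat (M n) else 0)"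
proof -
  have "(\<Sum>a<M n. chr i a * cnj (chr j a)) = ker (M n) (dig i) (dig j)"
    unfolding ker_def by (intro sum.cong refl) (simp add: chr_sym[OF assms(1)] chr_sym[OF assms(2)])
  also have "\<dots> = (if i = j then of_nat (M n) else 0)"
    using assms dig_mod_eq_iff[of i n j] by (simp add: ker_M dig_less)
  finally show ?thesis .
qed

lemma ker_M_dig: "ker (M s) (dig a) (dig b) = (if a mod M s = b mod M s then of_nat (M s) else 0)"
  by (simp add: ker_M dig_less dig_mod_eq_iff)

lemma norm_ker_dig_le: "a mod M t \<noteq> b mod M t \<Longrightarrow> cmod (ker k (dig a) (dig b)) \<le> real (M t)"
  by (rule norm_ker_le) (auto simp: dig_less dig_mod_eq_iff)

end

section \<open>Partial sums of functions of finitely many coordinates\<close>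

text \<open>
  Since \<open>p < 1\<close>, a number in \<open>[0, 1]\<close> is at most its power; this is applied to the two shares of \<open>a + b\<close>.
\<close>

lemma powr_add_le:
  fixes a b p :: real
  assumes "0 \<le> a" "0 \<le> b" "0 < p" "p < 1"
  shows "(a + b) powr p \<le> a powr p + b powr p"
proof (cases "a + b = 0")
  case False
  let ?s = "a + b"
  have s: "0 < ?s" using assms False by linarith
  have *: "c / ?s \<le> (c / ?s) powr p" if "0 \<le> c" "c \<le> ?s" for c
  proof (cases "c = 0")
    case False
    then have "(c / ?s) powr 1 \<le> (c / ?s) powr p"
      using that s assms by (intro powr_mono') auto
    then show ?thesis using that s False by simp
  qed simp
  have "?s powr p = ?s powr p * (a / ?s + b / ?s)"
    using s by (simp flip: add_divide_distrib)
  also have "\<dots> \<le> ?s powr p * ((a / ?s) powr p + (b / ?s) powr p)"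
    using *[of a] *[of b] assms by (intro mult_left_mono add_mono) auto
  also have "\<dots> = a powr p + b powr p"
    using assms s by (simp add: powr_divide distrib_left)
  finally show ?thesis .
qed (use assms in auto)

lemma card_residue_class:
  assumes "r < a"
  shows "card {x. x < a * b \<and> x mod a = r} = b"
proof -
  have "{x. x < a * b \<and> x mod a = r} = (\<lambda>c. c * a + r) ` {..<b}"
  proof (intro equalityI subsetI)
    fix x assume x: "x \<in> {x. x < a * b \<and> x mod a = r}"
    then have "x = (x div a) * a + r" "x div a < b"
      using assms by (auto simp: less_mult_imp_div_less mult.commute)
    then show "x \<in> (\<lambda>c. c * a + r) ` {..<b}" by blast
  next
    fix x assume "x \<in> (\<lambda>c. c * a + r) ` {..<b}"
    then obtain c where c: "c < b" "x = c * a + r" by auto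
    have "Suc c * a \<le> b * a" using c by (intro mult_right_mono) auto
    then show "x \<in> {x. x < a * b \<and> x mod a = r}" using c assms by (simp add: mult.commute)
  qed
  moreover have "inj_on (\<lambda>c. c * a + r) {..<b}"
    using assms by (auto simp: inj_on_def)
  ultimately show ?thesis by (simp add: card_image)
qed

context vilenkin begin

lemma card_residues:
  assumes "s \<le> n"
  shows "real (card {x. x < M n \<and> x mod M s = q mod M s}) * real (M s) = real (M n)"
proof -
  obtain d where d: "M n = M s * d" using M_dvd[OF assms] by (auto elim: dvdE)
  have "card {x. x < M n \<and> x mod M s = q mod M s} = d"
    using card_residue_class[of "q mod M s" "M s" d] by (simp add: d)
  then show ?thesis by (simp add: d)
qed

text \<open>
  A function of the first \<open>n\<close> coordinates is a function on \<open>{..<M n}\<close>; this is its partial sum of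
  order \<open>k\<close>.
\<close>

definition proj :: "nat \<Rightarrow> nat \<Rightarrow> (nat \<Rightarrow> complex) \<Rightarrow> nat \<Rightarrow> complex" where
  "proj n k g x = (\<Sum>u<M n. g u * ker k (dig x) (dig u)) / of_nat (M n)"

lemma proj_expand:
  "proj n k g x = (\<Sum>i<k. (\<Sum>u<M n. g u * cnj (chr i u)) / of_nat (M n) * chr i x)"
  unfolding proj_def ker_def
  by (simp add: sum_distrib_left sum_distrib_right sum_divide_distrib sum.swap[of _ "{..<k}"] mult_ac)

lemma parseval:
  assumes "k \<le> M n"
  shows "(\<Sum>x<M n. (cmod (proj n k g x))\<^sup>2)
    = real (M n) * (\<Sum>i<k. (cmod ((\<Sum>u<M n. g u * cnj (chr i u)) / of_nat (M n)))\<^sup>2)"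
proof -
  define c where "c i = (\<Sum>u<M n. g u * cnj (chr i u)) / of_nat (M n)" for i
  have "complex_of_real (\<Sum>x<M n. (cmod (proj n k g x))\<^sup>2)
      = (\<Sum>x<M n. (\<Sum>i<k. c i * chr i x) * cnj (\<Sum>j<k. c j * chr j x))"
    unfolding proj_expand c_def[symmetric] by (simp only: of_real_sum complex_norm_square)
  also have "\<dots> = (\<Sum>x<M n. \<Sum>i<k. \<Sum>j<k. c i * cnj (c j) * (chr i x * cnj (chr j x)))"
    by (simp add: sum_product mult_ac)
  also have "\<dots> = (\<Sum>i<k. \<Sum>j<k. c i * cnj (c j) * (\<Sum>x<M n. chr i x * cnj (chr j x)))"
    by (simp only: sum.swap[of _ _ "{..<M n}"] sum_distrib_left)
  also have "\<dots> = (\<Sum>i<k. \<Sum>j<k. if i = j then c i * cnj (c j) * of_nat (M n) else 0)"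
    using assms by (intro sum.cong refl) (auto simp: chr_orthogonal)
  also have "\<dots> = complex_of_real (real (M n) * (\<Sum>i<k. (cmod (c i))\<^sup>2))"
    by (simp add: sum.delta sum_distrib_left complex_norm_square mult_ac del: of_real_power)
  finally show ?thesis unfolding of_real_eq_iff c_def .
qed

lemma proj_full:
  assumes "x < M n"
  shows "proj n (M n) g x = g x"
proof -
  have "(\<Sum>u<M n. g u * ker (M n) (dig x) (dig u)) = (\<Sum>u<M n. if u = x then g u * of_nat (M n) else 0)"
    using assms by (intro sum.cong refl) (auto simp: ker_M_dig)
  then show ?thesis using assms by (simp add: proj_def)
qed

text \<open>
  For \<open>k = M n\<close> the projection is the identity, so the right-hand side is the full sum of the squared
  coefficients.
\<close>

lemma bessel:
  assumes "k \<le> M n"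
  shows "(\<Sum>x<M n. (cmod (proj n k g x))\<^sup>2) \<le> (\<Sum>x<M n. (cmod (g x))\<^sup>2)"
proof -
  have "(\<Sum>x<M n. (cmod (proj n k g x))\<^sup>2) \<le> (\<Sum>x<M n. (cmod (proj n (M n) g x))\<^sup>2)"
    unfolding parseval[OF assms] parseval[OF order_refl]
    using assms by (intro mult_left_mono sum_mono2) auto
  then show ?thesis by (simp add: proj_full)
qed

text \<open>
  The points at distance exactly \<open>s\<close> from a cell of level \<open>N\<close>: they share with \<open>q\<close> the first \<open>s\<close>
  coordinates and no more; for \<open>s = N\<close> this is the cell itself.
\<close>

definition annulus :: "nat \<Rightarrow> nat \<Rightarrow> nat \<Rightarrow> nat \<Rightarrow> nat set" where
  "annulus n N q s = {x. x < M n \<and> x mod M s = q mod M s \<and> (s < N \<longrightarrow> x mod M (Suc s) \<noteq> q mod M (Suc s))}"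

lemma finite_annulus [simp]: "finite (annulus n N q s)"
  by (rule finite_subset[of _ "{..<M n}"]) (auto simp: annulus_def)

lemma card_annulus_le:
  assumes "s \<le> n"
  shows "real (card (annulus n N q s)) \<le> real (M n) / real (M s)"
proof -
  have "card (annulus n N q s) \<le> card {x. x < M n \<and> x mod M s = q mod M s}"
    by (intro card_mono) (auto simp: annulus_def)
  then have "real (card (annulus n N q s)) * real (M s)
      \<le> real (card {x. x < M n \<and> x mod M s = q mod M s}) * real (M s)"
    by (intro mult_right_mono) auto
  then show ?thesis unfolding card_residues[OF assms] by (simp add: pos_le_divide_eq)
qed

lemma sum_le_sum_annuli:
  fixes \<phi> :: "nat \<Rightarrow> real"
  assumes "\<And>x. 0 \<le> \<phi> x"
  shows "(\<Sum>x<M n. \<phi> x) \<le> (\<Sum>s\<le>N. \<Sum>x\<in>annulus n N q s. \<phi> x)"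
proof -
  have cover: "\<exists>s\<le>N. x \<in> annulus n N q s" if "x < M n" for x
  proof -
    let ?P = "\<lambda>s. s \<le> N \<and> x mod M s = q mod M s"
    have "?P 0" by (simp add: vil_M_0)
    then have G: "?P (Greatest ?P)" by (rule GreatestI_nat[where b = N]) simp
    moreover have "\<not> ?P (Suc (Greatest ?P))"
      using Greatest_le_nat[of ?P "Suc (Greatest ?P)" N] by (auto simp: not_less_eq_eq)
    ultimately have "x \<in> annulus n N q (Greatest ?P)"
      using that by (simp add: annulus_def)
    with G show ?thesis by blast
  qed
  have "\<phi> x \<le> (\<Sum>s\<le>N. if x \<in> annulus n N q s then \<phi> x else 0)" if x: "x < M n" for x
  proof -
    obtain s where "s \<le> N" "x \<in> annulus n N q s" using cover[OF x] by blast
    then show ?thesis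
      using assms member_le_sum[of s "{..N}" "\<lambda>s. if x \<in> annulus n N q s then \<phi> x else 0"] by simp
  qed
  then have "(\<Sum>x<M n. \<phi> x) \<le> (\<Sum>x<M n. \<Sum>s\<le>N. if x \<in> annulus n N q s then \<phi> x else 0)"
    by (intro sum_mono) simp
  also have "\<dots> = (\<Sum>s\<le>N. \<Sum>x<M n. if x \<in> annulus n N q s then \<phi> x else 0)"
    by (rule sum.swap)
  also have "\<dots> = (\<Sum>s\<le>N. \<Sum>x\<in>annulus n N q s. \<phi> x)"
    by (intro sum.cong refl sum.mono_neutral_cong_right) (auto simp: annulus_def)
  finally show ?thesis .
qed

text \<open>
  On the cell itself this is Bessel's inequality. Outside it, the kernel is at most \<open>M (Suc s)\<close>, and
  the Cauchy-Schwarz inequality over the cell and the size of the annulus give the factor. It is a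
  bound between \<open>L\<^sup>2\<close> norms, so that it can be applied in the two variables one after the other.
\<close>

lemma annulus_bound:
  assumes "N \<le> n" "s \<le> N" "k \<le> M n"
    and supp: "\<And>u. u mod M N \<noteq> q mod M N \<Longrightarrow> g u = 0"
  shows "(\<Sum>x\<in>annulus n N q s. (cmod (proj n k g x))\<^sup>2)
    \<le> (real B)\<^sup>2 * real (M s) / real (M N) * (\<Sum>u<M n. (cmod (g u))\<^sup>2)"
proof (cases "s = N")
  case True
  have B: "1 \<le> (real B)\<^sup>2"
    using m_ge2[of 0] m_le[of 0] by (simp add: one_le_power)
  have "(\<Sum>x\<in>annulus n N q s. (cmod (proj n k g x))\<^sup>2) \<le> (\<Sum>x<M n. (cmod (proj n k g x))\<^sup>2)"
    by (intro sum_mono2) (auto simp: annulus_def)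
  also have "\<dots> \<le> 1 * (\<Sum>u<M n. (cmod (g u))\<^sup>2)"
    using bessel[OF assms(3)] by simp
  also have "\<dots> \<le> (real B)\<^sup>2 * (\<Sum>u<M n. (cmod (g u))\<^sup>2)"
    using B by (intro mult_right_mono sum_nonneg) auto
  finally show ?thesis using True by simp
next
  case False
  with assms have s: "s < N" by simp
  let ?C = "{u. u < M n \<and> u mod M N = q mod M N}"
  let ?S = "\<Sum>u<M n. (cmod (g u))\<^sup>2"
  have sumC: "(\<Sum>u<M n. \<phi> u) = (\<Sum>u\<in>?C. \<phi> u)" if "\<And>u. g u = 0 \<Longrightarrow> \<phi> u = 0" for \<phi> :: "nat \<Rightarrow> real"
  proof (rule sum.mono_neutral_right)
    show "\<forall>u\<in>{..<M n} - ?C. \<phi> u = 0" using that supp by blast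
  qed auto
  have cardC: "real (card ?C) = real (M n) / real (M N)"
    using card_residues[OF assms(1), of q] by (simp add: field_simps)
  have pt: "(cmod (proj n k g x))\<^sup>2 \<le> (real (M (Suc s)))\<^sup>2 / (real (M n) * real (M N)) * ?S"
    if x: "x \<in> annulus n N q s" for x
  proof -
    have ker: "cmod (g u * ker k (dig x) (dig u)) \<le> cmod (g u) * real (M (Suc s))" for u
    proof (cases "u mod M N = q mod M N")
      case True
      then have "u mod M (Suc s) = q mod M (Suc s)"
        using s by (intro mod_M_eq_mono[of "Suc s" N]) simp_all
      moreover have "x mod M (Suc s) \<noteq> q mod M (Suc s)"
        using x s unfolding annulus_def by blast
      ultimately have "x mod M (Suc s) \<noteq> u mod M (Suc s)" by simp
      then show ?thesis
        unfolding norm_mult by (intro mult_left_mono norm_ker_dig_le) auto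
    qed (simp add: supp)
    have "cmod (\<Sum>u<M n. g u * ker k (dig x) (dig u)) \<le> (\<Sum>u<M n. cmod (g u) * real (M (Suc s)))"
      by (intro sum_norm_le ker)
    also have "\<dots> = real (M (Suc s)) * (\<Sum>u\<in>?C. cmod (g u))"
      by (subst sumC) (simp_all add: sum_distrib_left mult_ac)
    finally have "(cmod (\<Sum>u<M n. g u * ker k (dig x) (dig u)))\<^sup>2
        \<le> (real (M (Suc s)) * (\<Sum>u\<in>?C. cmod (g u)))\<^sup>2"
      by (intro power_mono) auto
    also have "\<dots> = (real (M (Suc s)))\<^sup>2 * (\<Sum>u\<in>?C. cmod (g u))\<^sup>2"
      by (simp add: power_mult_distrib)
    also have "\<dots> \<le> (real (M (Suc s)))\<^sup>2 * ((\<Sum>u\<in>?C. (cmod (g u))\<^sup>2) * real (card ?C))"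
      using sum_squared_le_sum_of_squares[of "\<lambda>u. cmod (g u)" ?C] by (intro mult_left_mono) auto
    also have "(\<Sum>u\<in>?C. (cmod (g u))\<^sup>2) = ?S"
      by (subst sumC) auto
    finally show ?thesis
      unfolding proj_def norm_divide power_divide cardC
      by (simp add: field_simps power2_eq_square)
  qed
  have "(\<Sum>x\<in>annulus n N q s. (cmod (proj n k g x))\<^sup>2)
      \<le> real (card (annulus n N q s)) * ((real (M (Suc s)))\<^sup>2 / (real (M n) * real (M N)) * ?S)"
    using sum_bounded_above[OF pt] by simp
  also have "\<dots> \<le> real (M n) / real (M s) * ((real (M (Suc s)))\<^sup>2 / (real (M n) * real (M N)) * ?S)"
    using assms by (intro mult_right_mono card_annulus_le mult_nonneg_nonneg sum_nonneg) auto
  also have "\<dots> = (real (M (Suc s)))\<^sup>2 / (real (M s) * real (M N)) * ?S"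
    by simp
  also have "\<dots> \<le> (real B * real (M s))\<^sup>2 / (real (M s) * real (M N)) * ?S"
    using M_Suc_le[of s]
    by (intro mult_right_mono divide_right_mono power_mono sum_nonneg) (auto simp flip: of_nat_mult)
  also have "\<dots> = (real B)\<^sup>2 * real (M s) / real (M N) * ?S"
    by (simp add: power2_eq_square)
  finally show ?thesis .
qed

definition proj2 :: "nat \<Rightarrow> nat \<Rightarrow> nat \<Rightarrow> (nat \<Rightarrow> nat \<Rightarrow> complex) \<Rightarrow> nat \<Rightarrow> nat \<Rightarrow> complex" where
  "proj2 n k l g x y = proj n k (\<lambda>u. proj n l (g u) y) x"

lemma proj2_expand:
  "proj2 n k l g x y
    = (\<Sum>u<M n. \<Sum>v<M n. g u v * ker k (dig x) (dig u) * ker l (dig y) (dig v)) / (of_nat (M n))\<^sup>2"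
  unfolding proj2_def proj_def
  by (simp add: sum_divide_distrib sum_distrib_left sum_distrib_right power2_eq_square mult_ac)

lemma proj2_sum: "proj2 n k l (\<lambda>u v. \<Sum>i\<in>I. g i u v) x y = (\<Sum>i\<in>I. proj2 n k l (g i) x y)"
  unfolding proj2_expand
  by (simp add: sum_distrib_left sum_distrib_right sum_divide_distrib sum.swap[of _ I])

lemma proj2_cong:
  "(\<And>u v. u < M n \<Longrightarrow> v < M n \<Longrightarrow> g u v = g' u v) \<Longrightarrow> proj2 n k l g x y = proj2 n k l g' x y"
  unfolding proj2_expand by simp

lemma annulus2_bound:
  assumes "N \<le> n" "s \<le> N" "t \<le> N" "k \<le> M n" "l \<le> M n"
    and supp: "\<And>u v. u mod M N \<noteq> q mod M N \<or> v mod M N \<noteq> r mod M N \<Longrightarrow> g u v = 0"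
  shows "(\<Sum>x\<in>annulus n N q s. \<Sum>y\<in>annulus n N r t. (cmod (proj2 n k l g x y))\<^sup>2)
    \<le> (real B)^4 * (real (M s) * real (M t)) / (real (M N))\<^sup>2 * (\<Sum>u<M n. \<Sum>v<M n. (cmod (g u v))\<^sup>2)"
proof -
  let ?c = "\<lambda>s. (real B)\<^sup>2 * real (M s) / real (M N)"
  have c: "0 \<le> ?c s" for s by simp
  have "(\<Sum>x\<in>annulus n N q s. \<Sum>y\<in>annulus n N r t. (cmod (proj2 n k l g x y))\<^sup>2)
      = (\<Sum>y\<in>annulus n N r t. \<Sum>x\<in>annulus n N q s. (cmod (proj n k (\<lambda>u. proj n l (g u) y) x))\<^sup>2)"
    unfolding proj2_def by (rule sum.swap)
  also have "\<dots> \<le> (\<Sum>y\<in>annulus n N r t. ?c s * (\<Sum>u<M n. (cmod (proj n l (g u) y))\<^sup>2))"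
    using assms(1-4) supp by (intro sum_mono annulus_bound) (auto simp: proj_def)
  also have "\<dots> = ?c s * (\<Sum>u<M n. \<Sum>y\<in>annulus n N r t. (cmod (proj n l (g u) y))\<^sup>2)"
    by (simp only: sum_distrib_left sum.swap[of _ "{..<M n}"])
  also have "\<dots> \<le> ?c s * (\<Sum>u<M n. ?c t * (\<Sum>v<M n. (cmod (g u v))\<^sup>2))"
    using assms by (intro mult_left_mono[OF _ c] sum_mono annulus_bound) auto
  also have "\<dots> = (real B)^4 * (real (M s) * real (M t)) / (real (M N))\<^sup>2 * (\<Sum>u<M n. \<Sum>v<M n. (cmod (g u v))\<^sup>2)"
    unfolding sum_distrib_left[symmetric] by (simp add: power2_eq_square power4_eq_xxxx)
  finally show ?thesis .
qed

text \<open>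
  Characters of order less than \<open>M N\<close> are constant on cells of level \<open>N\<close>, so their coefficients are
  multiples of the mean of \<open>g\<close>.
\<close>

lemma proj2_eq_0:
  assumes "k \<le> M N" "l \<le> M N"
    and supp: "\<And>u v. u mod M N \<noteq> q mod M N \<or> v mod M N \<noteq> r mod M N \<Longrightarrow> g u v = 0"
    and mean: "(\<Sum>u<M n. \<Sum>v<M n. g u v) = 0"
  shows "proj2 n k l g x y = 0"
proof -
  have ker: "ker j (dig z) (dig u) = ker j (dig z) (dig w)"
    if "j \<le> M N" "u mod M N = w mod M N" for j z u w
    unfolding ker_def using that
    by (intro sum.cong refl arg_cong2[of _ _ _ _ "(*)"] arg_cong[of _ _ cnj] psi_cong[of _ N])
      (auto simp: dig_mod_eq_iff)
  have pt: "g u v * ker k (dig x) (dig u) * ker l (dig y) (dig v)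
      = ker k (dig x) (dig q) * ker l (dig y) (dig r) * g u v" for u v
  proof (cases "g u v = 0")
    case False
    then have "u mod M N = q mod M N" "v mod M N = r mod M N" using supp by blast+
    then show ?thesis by (simp add: ker[OF assms(1), of u q] ker[OF assms(2), of v r])
  qed simp
  have "(\<Sum>u<M n. \<Sum>v<M n. g u v * ker k (dig x) (dig u) * ker l (dig y) (dig v))
      = ker k (dig x) (dig q) * ker l (dig y) (dig r) * (\<Sum>u<M n. \<Sum>v<M n. g u v)"
    by (simp only: pt sum_distrib_left)
  then show ?thesis
    unfolding proj2_expand mean by simp
qed

end

section \<open>Strong sums of atoms\<close>

text \<open>By the mean value theorem the terms are comparable to the increments of \<open>k \<mapsto> - k powr (p - 1)\<close>.\<close>

lemma sum_powr_tail:
  fixes p L :: real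
  assumes p: "0 < p" "p < 1" and K: "finite K" "\<And>k. k \<in> K \<Longrightarrow> 1 \<le> k \<and> L \<le> real k" and L: "0 < L"
  shows "(\<Sum>k\<in>K. real k powr (p - 2)) \<le> 2 powr (2 - p) / (1 - p) * L powr (p - 1)"
proof -
  let ?T = "2 powr (2 - p) / (1 - p)"
  let ?h = "\<lambda>k. real k powr (p - 1)"
  have T: "0 < ?T" using p by simp
  have step: "real k powr (p - 2) \<le> ?T * (?h k - ?h (Suc k))" if k: "1 \<le> k" for k
  proof -
    have "\<exists>z>real k. z < real (Suc k) \<and>
        real (Suc k) powr (p - 1) - real k powr (p - 1)
        = (real (Suc k) - real k) * ((p - 1) * z powr (p - 2))"
    proof (rule MVT2)
      fix x assume "real k \<le> x" "x \<le> real (Suc k)"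
      then have "0 < x" using k by linarith
      then show "((\<lambda>x. x powr (p - 1)) has_real_derivative (p - 1) * x powr (p - 2)) (at x)"
        by (auto intro!: derivative_eq_intros simp: algebra_simps)
    qed simp
    then obtain z where z: "real k < z" "z < real (Suc k)"
      and eq: "?h k - ?h (Suc k) = (1 - p) * z powr (p - 2)"
      by (auto simp: algebra_simps)
    have "(2 * real k) powr (p - 2) \<le> z powr (p - 2)"
      using z k p by (intro powr_mono2') auto
    then have "2 powr (p - 2) * real k powr (p - 2) \<le> z powr (p - 2)"
      by (simp add: powr_mult)
    then have "2 powr (2 - p) * (2 powr (p - 2) * real k powr (p - 2)) \<le> 2 powr (2 - p) * z powr (p - 2)"
      by (intro mult_left_mono) auto
    also have "2 powr (2 - p) * (2 powr (p - 2) * real k powr (p - 2)) = real k powr (p - 2)"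
      by (simp flip: powr_add mult.assoc)
    finally show ?thesis unfolding eq using p by simp
  qed
  show ?thesis
  proof (cases "K = {}")
    case False
    define a where "a = Min K"
    define b where "b = Suc (Max K)"
    have a: "1 \<le> a" "L \<le> real a" and ab: "K \<subseteq> {a..<b}"
      using K False by (auto simp: a_def b_def less_Suc_eq_le)
    have "a \<le> b"
      using ab False by (metis atLeastLessThan_empty nle_le subset_empty)
    have "(\<Sum>k\<in>K. real k powr (p - 2)) \<le> (\<Sum>k=a..<b. real k powr (p - 2))"
      using ab by (intro sum_mono2) auto
    also have "\<dots> \<le> (\<Sum>k=a..<b. ?T * (?h k - ?h (Suc k)))"
      using a by (intro sum_mono step) auto
    also have "\<dots> = ?T * (?h a - ?h b)"
      unfolding sum_distrib_left[symmetric]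
      using sum_Suc_diff'[OF \<open>a \<le> b\<close>, of "\<lambda>k. - ?h k"] by simp
    also have "\<dots> \<le> ?T * ?h a"
      using T by (intro mult_left_mono) auto
    also have "\<dots> \<le> ?T * L powr (p - 1)"
      using T a L p by (intro mult_left_mono powr_mono2') auto
    finally show ?thesis .
  qed (use p in simp)
qed

text \<open>
  Values up to \<open>\<tau>\<close> are bounded by \<open>\<tau>\<close>, larger ones by \<open>h powr p \<le> \<tau> powr (p - 2) * h\<^sup>2\<close>. For the right \<open>\<tau>\<close>
  this is Hoelder's inequality up to a factor of 2.
\<close>

lemma card_times_powr_le:
  fixes h :: "'a \<Rightarrow> real" and p \<tau> V :: real
  assumes "finite E" "\<And>x. x \<in> E \<Longrightarrow> 0 \<le> h x" "(\<Sum>x\<in>E. (h x)\<^sup>2) \<le> V" "0 < \<tau>" "0 < p" "p < 1"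
  shows "(\<Sum>x\<in>E. h x powr p) \<le> real (card E) * \<tau> powr p + \<tau> powr (p - 2) * V"
proof -
  have pt: "h x powr p \<le> \<tau> powr p + \<tau> powr (p - 2) * (h x)\<^sup>2" if "x \<in> E" for x
  proof (cases "h x \<le> \<tau>")
    case True
    then have "h x powr p \<le> \<tau> powr p" using assms that by (intro powr_mono2) auto
    then show ?thesis by (simp add: add_increasing2)
  next
    case False
    then have hx: "0 < h x" using assms(4) by linarith
    have "h x powr p = h x powr (p - 2) * (h x)\<^sup>2"
      using hx by (simp flip: powr_numeral powr_add)
    also have "\<dots> \<le> \<tau> powr (p - 2) * (h x)\<^sup>2"
      using False assms by (intro mult_right_mono powr_mono2') auto
    finally show ?thesis by (simp add: add_increasing)
  qed
  have "(\<Sum>x\<in>E. h x powr p) \<le> (\<Sum>x\<in>E. \<tau> powr p + \<tau> powr (p - 2) * (h x)\<^sup>2)"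
    by (intro sum_mono pt)
  also have "\<dots> = real (card E) * \<tau> powr p + \<tau> powr (p - 2) * (\<Sum>x\<in>E. (h x)\<^sup>2)"
    by (simp add: sum.distrib sum_distrib_left)
  also have "\<dots> \<le> real (card E) * \<tau> powr p + \<tau> powr (p - 2) * V"
    using assms by (intro add_left_mono mult_left_mono) auto
  finally show ?thesis .
qed

locale vilenkin_p = vilenkin +
  fixes p :: real
  assumes p_pos: "0 < p" and p_less_1: "p < 1"
begin

text \<open>
  The \<open>p\<close>-th moment times \<open>(M n)\<^sup>2\<close>; leaving out the normalization makes sums over squares additive.
\<close>

definition Lp_sum :: "nat \<Rightarrow> (nat \<Rightarrow> nat \<Rightarrow> complex) \<Rightarrow> real" where
  "Lp_sum n g = (\<Sum>x<M n. \<Sum>y<M n. cmod (g x y) powr p)"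

lemma Lp_sum_nonneg: "0 \<le> Lp_sum n g"
  unfolding Lp_sum_def by (intro sum_nonneg) auto

lemma norm_sum_powr_le:
  assumes "finite I"
  shows "cmod (\<Sum>i\<in>I. g i) powr p \<le> (\<Sum>i\<in>I. cmod (g i) powr p)"
  using assms
proof (induction I)
  case (insert j I)
  have "cmod (\<Sum>i\<in>insert j I. g i) powr p \<le> (cmod (g j) + cmod (\<Sum>i\<in>I. g i)) powr p"
    using insert p_pos by (intro powr_mono2) (auto intro: norm_triangle_ineq)
  also have "\<dots> \<le> cmod (g j) powr p + cmod (\<Sum>i\<in>I. g i) powr p"
    using p_pos p_less_1 by (intro powr_add_le) auto
  finally show ?case using insert by simp
qed simp

lemma Lp_sum_sum_le:
  assumes "finite I"
  shows "Lp_sum n (\<lambda>x y. \<Sum>i\<in>I. g i x y) \<le> (\<Sum>i\<in>I. Lp_sum n (g i))"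
proof -
  have "Lp_sum n (\<lambda>x y. \<Sum>i\<in>I. g i x y) \<le> (\<Sum>x<M n. \<Sum>y<M n. \<Sum>i\<in>I. cmod (g i x y) powr p)"
    unfolding Lp_sum_def by (intro sum_mono norm_sum_powr_le assms)
  also have "\<dots> = (\<Sum>i\<in>I. Lp_sum n (g i))"
    unfolding Lp_sum_def by (simp only: sum.swap[of _ _ I])
  finally show ?thesis .
qed

definition geom :: real where
  "geom = 1 / (1 - 2 powr (p - 1))"

text \<open>
  The \<open>M s\<close> grow at least like \<open>2 ^ s\<close> and the exponent is negative.
\<close>

lemma sum_M_powr_le: "(\<Sum>s\<le>N. real (M s) powr (p - 1)) \<le> geom"
proof -
  let ?\<rho> = "2 powr (p - 1)"
  have \<rho>: "0 \<le> ?\<rho>" "?\<rho> < 1" using p_less_1 powr_less_mono[of "p - 1" 0 2] by simp_all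
  have "(\<Sum>s\<le>N. real (M s) powr (p - 1)) \<le> (\<Sum>s\<le>N. ?\<rho> ^ s)"
  proof (intro sum_mono)
    fix s
    have "real (M s) powr (p - 1) \<le> (2 ^ s) powr (p - 1)"
      using vil_M_ge[OF seq, of s] p_less_1 by (intro powr_mono2') (simp_all add: numeral_power_le_of_nat_cancel_iff)
    also have "\<dots> = ?\<rho> ^ s"
      by (simp add: powr_powr mult.commute flip: powr_realpow)
    finally show "real (M s) powr (p - 1) \<le> ?\<rho> ^ s" .
  qed
  also have "\<dots> = (\<Sum>s<Suc N. ?\<rho> ^ s)" by (simp only: lessThan_Suc_atMost)
  also have "\<dots> \<le> (\<Sum>s. ?\<rho> ^ s)"
    using \<rho> by (intro sum_le_suminf summable_geometric) auto
  also have "\<dots> = geom" using \<rho> by (simp add: suminf_geometric geom_def)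
  finally show ?thesis .
qed

text \<open>
  On the product of the annuli \<open>s\<close> and \<open>t\<close>, the second moment bound \<open>annulus2_bound\<close> gives a \<open>p\<close>-th moment
  proportional to \<open>(M s * M t) powr (p - 1)\<close>. The sum over \<open>s\<close> and \<open>t\<close> is a product of two geometric
  series.
\<close>

lemma Lp_sum_proj2_atom:
  assumes N: "N \<le> n" and k: "k \<le> M n" and l: "l \<le> M n" and A: "0 < A"
    and supp: "\<And>u v. u mod M N \<noteq> q mod M N \<or> v mod M N \<noteq> r mod M N \<Longrightarrow> g u v = 0"
    and bd: "\<And>u v. cmod (g u v) \<le> A"
  shows "Lp_sum n (proj2 n k l g)
    \<le> 2 * geom\<^sup>2 * (real B)\<^sup>2 powr p * A powr p * (real (M n))\<^sup>2 * real (M N) powr (- 2 * p)"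
proof -
  let ?X = "annulus n N q" and ?Y = "annulus n N r"
  let ?W = "2 * ((real B)\<^sup>2 * A / (real (M N))\<^sup>2) powr p * (real (M n))\<^sup>2"
  let ?h = "\<lambda>x y. cmod (proj2 n k l g x y)"
  have B: "0 < real B" using m_ge2[of 0] m_le[of 0] by simp
  have L2: "(\<Sum>u<M n. \<Sum>v<M n. (cmod (g u v))\<^sup>2) \<le> A\<^sup>2 * (real (M n) / real (M N))\<^sup>2"
  proof -
    let ?C = "\<lambda>q. {u. u < M n \<and> u mod M N = q mod M N}"
    have "(\<Sum>u<M n. \<Sum>v<M n. (cmod (g u v))\<^sup>2) = (\<Sum>u\<in>?C q. \<Sum>v<M n. (cmod (g u v))\<^sup>2)"
    proof (rule sum.mono_neutral_right)
      show "\<forall>u\<in>{..<M n} - ?C q. (\<Sum>v<M n. (cmod (g u v))\<^sup>2) = 0" using supp by simp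
    qed auto
    also have "\<dots> = (\<Sum>u\<in>?C q. \<Sum>v\<in>?C r. (cmod (g u v))\<^sup>2)"
    proof (rule sum.cong[OF refl], rule sum.mono_neutral_right)
      fix u show "\<forall>v\<in>{..<M n} - ?C r. (cmod (g u v))\<^sup>2 = 0" using supp by simp
    qed auto
    also have "\<dots> \<le> (\<Sum>u\<in>?C q. \<Sum>v\<in>?C r. A\<^sup>2)"
      using bd by (intro sum_mono power_mono) auto
    also have "\<dots> = A\<^sup>2 * (real (M n) / real (M N))\<^sup>2"
    proof -
      have c: "real (card (?C q)) = real (M n) / real (M N)" for q
        using card_residues[OF N, of q] by (simp add: field_simps)
      show ?thesis by (simp only: sum_constant c power2_eq_square) simp
    qed
    finally show ?thesis .
  qed
  have piece: "(\<Sum>x\<in>?X s. \<Sum>y\<in>?Y t. ?h x y powr p)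
      \<le> ?W * (real (M s) powr (p - 1) * real (M t) powr (p - 1))" if st: "s \<le> N" "t \<le> N" for s t
  proof -
    let ?P = "real (M s) * real (M t)"
    let ?E = "?X s \<times> ?Y t"
    let ?\<tau> = "(real B)\<^sup>2 * A / (real (M N))\<^sup>2 * ?P"
    have \<tau>: "0 < ?\<tau>" using A B by simp
    \<comment> \<open>The threshold is the root mean square of \<open>h\<close> that the second moment bound allows on the
      product of the two annuli.\<close>
    have "(\<Sum>z\<in>?E. (?h (fst z) (snd z))\<^sup>2) = (\<Sum>x\<in>?X s. \<Sum>y\<in>?Y t. (?h x y)\<^sup>2)"
      by (simp add: sum.cartesian_product case_prod_beta)
    also have "\<dots> \<le> (real B)^4 * ?P / (real (M N))\<^sup>2 * (\<Sum>u<M n. \<Sum>v<M n. (cmod (g u v))\<^sup>2)"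
      using N st k l supp by (rule annulus2_bound)
    also have "\<dots> \<le> (real B)^4 * ?P / (real (M N))\<^sup>2 * (A\<^sup>2 * (real (M n) / real (M N))\<^sup>2)"
      by (intro mult_left_mono L2) auto
    also have "\<dots> = ?\<tau>\<^sup>2 * ((real (M n))\<^sup>2 / ?P)"
      by (simp add: power2_eq_square power4_eq_xxxx mult_ac)
    finally have V: "(\<Sum>z\<in>?E. (?h (fst z) (snd z))\<^sup>2) \<le> ?\<tau>\<^sup>2 * ((real (M n))\<^sup>2 / ?P)" .
    have "(\<Sum>x\<in>?X s. \<Sum>y\<in>?Y t. ?h x y powr p) = (\<Sum>z\<in>?E. ?h (fst z) (snd z) powr p)"
      by (simp add: sum.cartesian_product case_prod_beta)
    also have "\<dots> \<le> real (card ?E) * ?\<tau> powr p + ?\<tau> powr (p - 2) * (?\<tau>\<^sup>2 * ((real (M n))\<^sup>2 / ?P))"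
      using V \<tau> p_pos p_less_1 by (intro card_times_powr_le) auto
    also have "?\<tau> powr (p - 2) * (?\<tau>\<^sup>2 * ((real (M n))\<^sup>2 / ?P)) = ((real (M n))\<^sup>2 / ?P) * ?\<tau> powr p"
    proof -
      have "a powr (p - 2) * a\<^sup>2 = a powr p" if "0 < a" for a
        using that by (simp flip: powr_numeral powr_add)
      moreover have "a * (b * c) = c * d" if "a * b = d" for a b c d :: real
        using that by (simp flip: mult.assoc)
      ultimately show ?thesis using \<tau> by blast
    qed
    also have "real (card ?E) * ?\<tau> powr p \<le> ((real (M n))\<^sup>2 / ?P) * ?\<tau> powr p"
    proof (rule mult_right_mono)
      have "real (card ?E) \<le> (real (M n) / real (M s)) * (real (M n) / real (M t))"
        unfolding card_cartesian_product of_nat_mult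
        using st N by (intro mult_mono card_annulus_le) auto
      then show "real (card ?E) \<le> (real (M n))\<^sup>2 / ?P" by (simp add: power2_eq_square)
    qed simp
    finally have "(\<Sum>x\<in>?X s. \<Sum>y\<in>?Y t. ?h x y powr p) \<le> 2 * (((real (M n))\<^sup>2 / ?P) * ?\<tau> powr p)" by simp
    also have "?\<tau> powr p = ((real B)\<^sup>2 * A / (real (M N))\<^sup>2) powr p * (?P * ?P powr (p - 1))"
      using A B by (simp add: powr_mult powr_divide powr_diff)
    finally show ?thesis by (simp add: powr_mult mult_ac)
  qed
  have "Lp_sum n (proj2 n k l g) \<le> (\<Sum>s\<le>N. \<Sum>x\<in>?X s. \<Sum>y<M n. ?h x y powr p)"
    unfolding Lp_sum_def by (intro sum_le_sum_annuli sum_nonneg) auto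
  also have "\<dots> \<le> (\<Sum>s\<le>N. \<Sum>x\<in>?X s. \<Sum>t\<le>N. \<Sum>y\<in>?Y t. ?h x y powr p)"
    by (intro sum_mono sum_le_sum_annuli) auto
  also have "\<dots> = (\<Sum>s\<le>N. \<Sum>t\<le>N. \<Sum>x\<in>?X s. \<Sum>y\<in>?Y t. ?h x y powr p)"
    by (intro sum.cong refl sum.swap)
  also have "\<dots> \<le> (\<Sum>s\<le>N. \<Sum>t\<le>N. ?W * (real (M s) powr (p - 1) * real (M t) powr (p - 1)))"
    by (intro sum_mono piece) auto
  also have "\<dots> = ?W * (\<Sum>s\<le>N. real (M s) powr (p - 1))\<^sup>2"
    by (simp only: sum_distrib_left[symmetric] power2_eq_square sum_product)
  also have "\<dots> \<le> ?W * geom\<^sup>2"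
    by (intro mult_left_mono power_mono sum_M_powr_le sum_nonneg) auto
  also have "?W = 2 * (real B)\<^sup>2 powr p * A powr p * (real (M n))\<^sup>2 * real (M N) powr (- 2 * p)"
  proof -
    have "((real B)\<^sup>2 * A / (real (M N))\<^sup>2) powr p = (real B)\<^sup>2 powr p * A powr p / (real (M N))\<^sup>2 powr p"
      using A B by (simp add: powr_mult powr_divide)
    also have "(real (M N))\<^sup>2 powr p = real (M N) powr (2 * p)"
      using M_pos[of N] by (simp add: powr_powr flip: powr_numeral)
    finally show ?thesis by (simp add: powr_minus_divide)
  qed
  finally show ?thesis by (simp add: mult_ac)
qed

definition strong_sum :: "nat \<Rightarrow> (nat \<times> nat) set \<Rightarrow> (nat \<Rightarrow> nat \<Rightarrow> complex) \<Rightarrow> real" where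
  "strong_sum n J g = (\<Sum>(k, l)\<in>J. Lp_sum n (proj2 n k l g) * (real k * real l) powr (p - 2))"

lemma strong_sum_sum_le:
  assumes "finite I"
  shows "strong_sum n J (\<lambda>u v. \<Sum>i\<in>I. g i u v) \<le> (\<Sum>i\<in>I. strong_sum n J (g i))"
proof -
  have "Lp_sum n (proj2 n k l (\<lambda>u v. \<Sum>i\<in>I. g i u v)) \<le> (\<Sum>i\<in>I. Lp_sum n (proj2 n k l (g i)))" for k l
    using Lp_sum_sum_le[OF assms, of n "\<lambda>i. proj2 n k l (g i)"]
    by (simp add: proj2_sum Lp_sum_def)
  then have "strong_sum n J (\<lambda>u v. \<Sum>i\<in>I. g i u v)
      \<le> (\<Sum>(k, l)\<in>J. (\<Sum>i\<in>I. Lp_sum n (proj2 n k l (g i))) * (real k * real l) powr (p - 2))"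
    unfolding strong_sum_def by (intro sum_mono) (auto intro!: mult_right_mono)
  also have "\<dots> = (\<Sum>i\<in>I. strong_sum n J (g i))"
    unfolding strong_sum_def case_prod_beta sum_distrib_right by (rule sum.swap)
  finally show ?thesis .
qed

lemma strong_sum_cong:
  assumes "\<And>u v. u < M n \<Longrightarrow> v < M n \<Longrightarrow> g u v = g' u v"
  shows "strong_sum n J g = strong_sum n J g'"
  unfolding strong_sum_def Lp_sum_def using proj2_cong[OF assms] by simp

text \<open>
  The constant of \<open>Lp_sum_proj2_atom\<close> times the square of the constant of \<open>sum_powr_tail\<close> with
  \<open>L = 2 powr (- \<alpha>) * M N\<close>: in the cone one index is at least \<open>2 powr (- \<alpha>)\<close> times the other.
\<close>

definition atom_const :: "real \<Rightarrow> real" where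
  "atom_const \<alpha> = 2 * geom\<^sup>2 * (real B)\<^sup>2 powr p * (2 powr (2 - p) / (1 - p) * (2 powr (- \<alpha>)) powr (p - 1))\<^sup>2"

lemma atom_const_nonneg: "0 \<le> atom_const \<alpha>"
  unfolding atom_const_def by simp

text \<open>
  If \<open>k\<close> or \<open>l\<close> lies below \<open>2 powr (- \<alpha>) * M N\<close>, then both are at most \<open>M N\<close> and the partial sum
  vanishes. For the remaining pairs the decay of the weights balances the growth of the moments. An
  atom of level \<open>0\<close> may have any mean, because \<open>k\<close> and \<open>l\<close> are never below \<open>2 powr (- \<alpha>)\<close>.
\<close>

lemma strong_sum_atom:
  assumes N: "N \<le> n" and A: "0 < A"
    and J: "finite J" "J \<subseteq> ratio_cone \<alpha>" "\<And>k l. (k, l) \<in> J \<Longrightarrow> k \<le> M n \<and> l \<le> M n"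
    and \<alpha>: "0 \<le> \<alpha>"
    and supp: "\<And>u v. u mod M N \<noteq> q mod M N \<or> v mod M N \<noteq> r mod M N \<Longrightarrow> g u v = 0"
    and bd: "\<And>u v. cmod (g u v) \<le> A"
    and mean: "N = 0 \<or> (\<Sum>u<M n. \<Sum>v<M n. g u v) = 0"
  shows "strong_sum n J g \<le> atom_const \<alpha> * A powr p * (real (M n) / real (M N))\<^sup>2"
proof -
  let ?L = "2 powr (- \<alpha>) * real (M N)"
  let ?D = "2 * geom\<^sup>2 * (real B)\<^sup>2 powr p * A powr p * (real (M n))\<^sup>2 * real (M N) powr (- 2 * p)"
  let ?T = "2 powr (2 - p) / (1 - p)"
  let ?w = "\<lambda>k. real k powr (p - 2)"
  define K where "K = {k \<in> fst ` J \<union> snd ` J. 1 \<le> k \<and> ?L \<le> real k}"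
  have finK: "finite K" using J(1) by (simp add: K_def)
  have D: "0 \<le> ?D" by simp
  have L: "0 < ?L" by simp
  have a1: "2 powr (- \<alpha>) \<le> (1::real)" using powr_mono[of "- \<alpha>" 0 2] \<alpha> by simp
  have summand: "Lp_sum n (proj2 n k l g) * (real k * real l) powr (p - 2)
      \<le> (if (k, l) \<in> K \<times> K then ?D * (?w k * ?w l) else 0)" if kl: "(k, l) \<in> J" for k l
  proof (cases "k \<in> K \<and> l \<in> K")
    case True
    have "Lp_sum n (proj2 n k l g) \<le> ?D"
      using J(3)[OF kl] N A supp bd by (intro Lp_sum_proj2_atom) auto
    then have "Lp_sum n (proj2 n k l g) * (real k * real l) powr (p - 2) \<le> ?D * (real k * real l) powr (p - 2)"
      by (rule mult_right_mono) simp
    then show ?thesis using True by (simp add: powr_mult)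
  next
    case False
    have cone: "1 \<le> k" "1 \<le> l" "2 powr (- \<alpha>) * real l \<le> real k" "real k \<le> 2 powr \<alpha> * real l"
      using J(2) kl by (auto simp: ratio_cone_def field_simps)
    have "2 powr (- \<alpha>) * real k \<le> 2 powr (- \<alpha>) * (2 powr \<alpha> * real l)"
      using cone by (intro mult_left_mono) auto
    also have "\<dots> = real l" by (simp flip: powr_add mult.assoc)
    finally have cone': "2 powr (- \<alpha>) * real k \<le> real l" .
    have notL: "\<not> (?L \<le> real k \<and> ?L \<le> real l)"
      using False kl cone by (force simp: K_def)
    have small: "k \<le> M N \<and> l \<le> M N"
    proof (rule ccontr)
      assume "\<not> (k \<le> M N \<and> l \<le> M N)"
      then have "real (M N) \<le> real k \<or> real (M N) \<le> real l" by auto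
      then show False
      proof
        assume *: "real (M N) \<le> real k"
        then have "?L \<le> 2 powr (- \<alpha>) * real k"
          by (intro mult_left_mono) auto
        moreover have "2 powr (- \<alpha>) * real k \<le> 1 * real k"
          by (intro mult_right_mono a1) auto
        ultimately show False using notL cone' by linarith
      next
        assume *: "real (M N) \<le> real l"
        then have "?L \<le> 2 powr (- \<alpha>) * real l"
          by (intro mult_left_mono) auto
        moreover have "2 powr (- \<alpha>) * real l \<le> 1 * real l"
          by (intro mult_right_mono a1) auto
        ultimately show False using notL cone by linarith
      qed
    qed
    moreover have "N \<noteq> 0"
    proof
      assume "N = 0"
      then have "?L = 2 powr (- \<alpha>)" by (simp add: vil_M_0)
      moreover have "1 \<le> real k" "1 \<le> real l" using cone by auto
      ultimately show False using notL a1 by linarith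
    qed
    ultimately have "proj2 n k l g x y = 0" for x y
      using mean supp by (intro proj2_eq_0[of k N l q r]) auto
    then show ?thesis using False p_pos by (simp add: Lp_sum_def)
  qed
  have "strong_sum n J g \<le> (\<Sum>z\<in>J. if z \<in> K \<times> K then ?D * (?w (fst z) * ?w (snd z)) else 0)"
    unfolding strong_sum_def case_prod_beta
    by (rule sum_mono) (use summand in \<open>simp add: mem_Times_iff\<close>)
  also have "\<dots> = (\<Sum>z\<in>J \<inter> K \<times> K. ?D * (?w (fst z) * ?w (snd z)))"
    by (rule sum.inter_restrict[OF J(1), symmetric])
  also have "\<dots> \<le> (\<Sum>z\<in>K \<times> K. ?D * (?w (fst z) * ?w (snd z)))"
    using finK D by (intro sum_mono2) auto
  also have "\<dots> = ?D * (\<Sum>z\<in>K \<times> K. ?w (fst z) * ?w (snd z))"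
    by (simp only: sum_distrib_left)
  also have "(\<Sum>z\<in>K \<times> K. ?w (fst z) * ?w (snd z)) = (\<Sum>k\<in>K. ?w k)\<^sup>2"
    by (simp add: power2_eq_square sum_product sum.cartesian_product case_prod_unfold)
  also have "?D * (\<Sum>k\<in>K. ?w k)\<^sup>2 \<le> ?D * (?T * ?L powr (p - 1))\<^sup>2"
    using finK L p_pos p_less_1
    by (intro mult_left_mono[OF _ D] power_mono sum_powr_tail sum_nonneg) (auto simp: K_def)
  also have "\<dots> = atom_const \<alpha> * A powr p * ((real (M n))\<^sup>2 * (real (M N) powr (- 2 * p) * (real (M N) powr (p - 1))\<^sup>2))"
  proof -
    have "?T * ?L powr (p - 1) = (?T * (2 powr (- \<alpha>)) powr (p - 1)) * real (M N) powr (p - 1)"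
      by (simp add: powr_mult)
    then show ?thesis unfolding atom_const_def by (simp only: power_mult_distrib mult_ac)
  qed
  also have "real (M N) powr (- 2 * p) * (real (M N) powr (p - 1))\<^sup>2 = 1 / (real (M N))\<^sup>2"
  proof -
    have "real (M N) powr (- 2 * p) * (real (M N) powr (p - 1))\<^sup>2 = real (M N) powr (- 2 * p + (p - 1) + (p - 1))"
      by (simp only: power2_eq_square powr_add mult.assoc)
    also have "\<dots> = real (M N) powr (- 2)" by simp
    also have "\<dots> = 1 / (real (M N))\<^sup>2"
      using M_pos[of N] by (simp add: powr_minus_divide powr_numeral)
    finally show ?thesis .
  qed
  finally show ?thesis by (simp add: power_divide)
qed

text \<open>
  The \<open>1\<close> stands for the martingale stopped at the smallest level. In the other summand, the
  differences of stopped martingales are bounded by four times the lower of their two levels, the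
  squares are larger than their parts above that level by a factor of at most \<open>B\<^sup>2\<close>, and the last
  factor is that of \<open>sum_dyadic_le\<close>.
\<close>

definition decomp_const :: "real \<Rightarrow> real" where
  "decomp_const \<alpha> = atom_const \<alpha> * (1 + 4 powr p * (real B)\<^sup>2 * (2 powr p / (2 powr p - 1)))"

lemma decomp_const_nonneg: "0 \<le> decomp_const \<alpha>"
proof -
  have "1 \<le> 2 powr p" using p_pos by (simp add: ge_one_powr_ge_zero)
  then show ?thesis unfolding decomp_const_def
    by (intro mult_nonneg_nonneg add_nonneg_nonneg atom_const_nonneg divide_nonneg_nonneg) auto
qed

end

section \<open>Decomposition of a martingale into atoms\<close>

text \<open>
  The sum is \<open>f\<close> at the first index where \<open>P\<close> holds. One step earlier \<open>P\<close> fails, and this bounds \<open>f\<close>.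
\<close>

lemma stopped_sum_bounded:
  fixes f :: "nat \<Rightarrow> complex"
  assumes mono: "\<And>i j. i \<le> j \<Longrightarrow> P i \<Longrightarrow> P j"
    and bd: "cmod (f 0) \<le> t" "\<And>i. i < n \<Longrightarrow> \<not> P i \<Longrightarrow> cmod (f (Suc i)) \<le> t"
  shows "cmod (f 0 + (\<Sum>i<n. if P i then 0 else f (Suc i) - f i)) \<le> t"
proof -
  let ?s = "\<lambda>n. f 0 + (\<Sum>i<n. if P i then 0 else f (Suc i) - f i)"
  have "((\<forall>i<n. \<not> P i) \<longrightarrow> ?s n = f n) \<and> cmod (?s n) \<le> t"
    using bd
  proof (induction n)
    case (Suc n)
    then have IH: "(\<forall>i<n. \<not> P i) \<longrightarrow> ?s n = f n" "cmod (?s n) \<le> t" by auto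
    show ?case
    proof (cases "P n")
      case False
      then have "\<forall>i<n. \<not> P i" using mono less_imp_le by blast
      then have *: "?s (Suc n) = f (Suc n)" using IH(1) False by (simp add: algebra_simps)
      show ?thesis unfolding * using Suc.prems(2)[of n] False by simp
    qed (use IH in \<open>auto simp: less_Suc_eq\<close>)
  qed simp
  then show ?thesis by simp
qed

text \<open>
  A geometric sum is controlled by its largest term, which is less than \<open>y powr p\<close>.
\<close>

lemma sum_dyadic_le:
  fixes t0 y p :: real
  assumes "0 < t0" "0 \<le> y" "0 < p"
  shows "(\<Sum>k<K. if t0 * 2 ^ k < y then (t0 * 2 ^ k) powr p else 0) \<le> 2 powr p / (2 powr p - 1) * y powr p"
proof -
  let ?c = "1 / (2 powr p - 1)"
  have c: "0 < 2 powr p - 1" using assms by simp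
  have c0: "0 \<le> ?c" by (rule divide_nonneg_pos) (use c in auto)
  have full: "(\<Sum>k<K. (t0 * 2 ^ k) powr p) \<le> ?c * (t0 * 2 ^ K) powr p" for K
  proof (induction K)
    case (Suc K)
    have "(\<Sum>k<Suc K. (t0 * 2 ^ k) powr p) \<le> ?c * (t0 * 2 ^ K) powr p + (t0 * 2 ^ K) powr p"
      using Suc by simp
    also have "\<dots> = ?c * (2 powr p * (t0 * 2 ^ K) powr p)"
    proof -
      have "a / (d - 1) + a = d * a / (d - 1)" if "0 < d - 1" for a d :: real
        using that by (simp add: field_simps)
      from this[OF c] show ?thesis by simp
    qed
    also have "2 powr p * (t0 * 2 ^ K) powr p = (t0 * 2 ^ Suc K) powr p"
      using assms by (simp add: powr_mult)
    finally show ?case .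
  qed (use c in simp)
  show ?thesis
  proof (induction K)
    case (Suc K)
    show ?case
    proof (cases "t0 * 2 ^ K < y")
      case True
      have "(\<Sum>k<Suc K. if t0 * 2 ^ k < y then (t0 * 2 ^ k) powr p else 0) \<le> (\<Sum>k<Suc K. (t0 * 2 ^ k) powr p)"
        by (intro sum_mono) auto
      also have "\<dots> \<le> ?c * (t0 * 2 ^ Suc K) powr p" by (rule full)
      also have "\<dots> \<le> ?c * (2 * y) powr p"
        using True assms by (intro mult_left_mono[OF _ c0] powr_mono2) auto
      also have "\<dots> = 2 powr p / (2 powr p - 1) * y powr p"
        using assms by (simp add: powr_mult)
      finally show ?thesis .
    qed (use Suc in simp)
  qed (use c in simp)
qed

text \<open>
  A martingale up to time \<open>n\<close>, with \<open>F i u v\<close> the value of its \<open>i\<close>-th member on the cell of level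
  \<open>i\<close> that contains \<open>(u, v)\<close>.
\<close>

locale finite_martingale = vilenkin_p +
  fixes n :: nat and F :: "nat \<Rightarrow> nat \<Rightarrow> nat \<Rightarrow> complex"
  assumes F_cell: "\<lbrakk>i \<le> n; u mod M i = u' mod M i; v mod M i = v' mod M i\<rbrakk> \<Longrightarrow> F i u v = F i u' v'"
    and F_mean: "i < n \<Longrightarrow>
      (\<Sum>(u, v)\<in>{(u, v). u < M n \<and> v < M n \<and> u mod M i = a mod M i \<and> v mod M i = b mod M i}.
        F (Suc i) u v - F i u v) = 0"
begin

definition cell :: "nat \<Rightarrow> nat \<Rightarrow> nat \<Rightarrow> (nat \<times> nat) set" where
  "cell i a b = {(u, v). u < M n \<and> v < M n \<and> u mod M i = a mod M i \<and> v mod M i = b mod M i}"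

definition maxF :: "nat \<Rightarrow> nat \<Rightarrow> real" where
  "maxF u v = Max ((\<lambda>i. cmod (F i u v)) ` {..n})"

text \<open>
  Stopping is decided one step ahead: a cell is bad if the next step exceeds \<open>t\<close> somewhere in it.
  This keeps the stopped martingale below \<open>t\<close>, and as a cell has at most \<open>B\<^sup>2\<close> children, the bad cells
  are not much larger than the set where the maximal function exceeds \<open>t\<close>.
\<close>

definition bad :: "real \<Rightarrow> nat \<Rightarrow> nat \<Rightarrow> nat \<Rightarrow> bool" where
  "bad t i a b \<longleftrightarrow> (\<exists>j\<le>i. \<exists>(u, v)\<in>cell j a b. t < cmod (F (Suc j) u v))"

definition first_bad :: "real \<Rightarrow> nat \<Rightarrow> nat \<Rightarrow> nat \<Rightarrow> bool" where
  "first_bad t i a b \<longleftrightarrow> bad t i a b \<and> (\<forall>j<i. \<not> bad t j a b)"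

definition stopped :: "real \<Rightarrow> nat \<Rightarrow> nat \<Rightarrow> complex" where
  "stopped t a b = F 0 a b + (\<Sum>i<n. if bad t i a b then 0 else F (Suc i) a b - F i a b)"

lemma finite_cell [simp]: "finite (cell i a b)"
  by (rule finite_subset[of _ "{..<M n} \<times> {..<M n}"]) (auto simp: cell_def)

lemma F_mean_cell: "i < n \<Longrightarrow> (\<Sum>(u, v)\<in>cell i a b. F (Suc i) u v - F i u v) = 0"
  unfolding cell_def by (rule F_mean)

lemma cell_cong: "a mod M i = a' mod M i \<Longrightarrow> b mod M i = b' mod M i \<Longrightarrow> cell i a b = cell i a' b'"
  by (simp add: cell_def)

lemma cell_mono: "j \<le> i \<Longrightarrow> cell i a b \<subseteq> cell j a b"
  unfolding cell_def using mod_M_eq_mono by blast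

lemma card_cell: "i \<le> n \<Longrightarrow> real (card (cell i a b)) = (real (M n) / real (M i))\<^sup>2"
proof -
  assume i: "i \<le> n"
  let ?C = "\<lambda>a. {u. u < M n \<and> u mod M i = a mod M i}"
  have "cell i a b = ?C a \<times> ?C b" by (auto simp: cell_def)
  moreover have "real (card (?C a)) = real (M n) / real (M i)" for a
    using card_residues[OF i, of a] by (simp add: field_simps)
  ultimately show ?thesis by (simp add: card_cartesian_product power2_eq_square)
qed

lemma bad_mono: "i \<le> j \<Longrightarrow> bad t i a b \<Longrightarrow> bad t j a b"
  unfolding bad_def using le_trans by blast

lemma bad_antimono:
  assumes "t \<le> t'" "bad t' i a b"
  shows "bad t i a b"
proof -
  obtain j u v where j: "j \<le> i" "(u, v) \<in> cell j a b" and "t' < cmod (F (Suc j) u v)"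
    using assms(2) unfolding bad_def by blast
  then have "t < cmod (F (Suc j) u v)" using assms(1) by linarith
  with j show ?thesis unfolding bad_def by blast
qed

lemma bad_cong:
  assumes "a mod M i = a' mod M i" "b mod M i = b' mod M i"
  shows "bad t i a b = bad t i a' b'"
proof -
  have "cell j a b = cell j a' b'" if "j \<le> i" for j
    using assms that by (intro cell_cong mod_M_eq_mono[OF that])
  then show ?thesis unfolding bad_def by auto
qed

lemma first_bad_cong:
  assumes "a mod M i = a' mod M i" "b mod M i = b' mod M i"
  shows "first_bad t i a b = first_bad t i a' b'"
proof -
  have "bad t j a b = bad t j a' b'" if "j \<le> i" for j
    using assms that by (intro bad_cong mod_M_eq_mono[OF that])
  then show ?thesis unfolding first_bad_def by auto
qed

lemma not_badD:
  assumes "\<not> bad t i a b" "a < M n" "b < M n"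
  shows "cmod (F (Suc i) a b) \<le> t"
proof -
  have "(a, b) \<in> cell i a b" using assms by (simp add: cell_def)
  then show ?thesis using assms(1) unfolding bad_def by force
qed

lemma norm_F_le_maxF: "i \<le> n \<Longrightarrow> cmod (F i u v) \<le> maxF u v"
  unfolding maxF_def by (intro Max_ge) auto

lemma maxF_nonneg: "0 \<le> maxF u v"
  using norm_F_le_maxF[of 0 u v] norm_ge_zero[of "F 0 u v"] by linarith

lemma norm_stopped_le:
  assumes "a < M n" "b < M n" "cmod (F 0 a b) \<le> t"
  shows "cmod (stopped t a b) \<le> t"
  unfolding stopped_def
  by (rule stopped_sum_bounded[where f = "\<lambda>i. F i a b"]) (use assms bad_mono not_badD in auto)

lemma stopped_eq_F: "(\<And>i. i < n \<Longrightarrow> \<not> bad t i a b) \<Longrightarrow> stopped t a b = F n a b"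
  using sum_lessThan_telescope[of "\<lambda>i. F i a b" n] by (simp add: stopped_def)

lemma stopped_diff:
  assumes "t \<le> t'"
  shows "stopped t' a b - stopped t a b
    = (\<Sum>i<n. if bad t i a b \<and> \<not> bad t' i a b then F (Suc i) a b - F i a b else 0)"
  unfolding stopped_def using bad_antimono[OF assms]
  by (simp flip: sum_subtractf) (intro sum.cong, auto)

lemma sum_cell_refine:
  assumes "j \<le> i"
    and zero: "\<And>a b. (\<Sum>(u, v)\<in>cell i a b. f u v) = (0::complex)"
  shows "(\<Sum>(u, v)\<in>cell j a b. f u v) = 0"
proof -
  let ?\<pi> = "\<lambda>(u, v). (u mod M i, v mod M i)"
  have "(\<Sum>(u, v)\<in>cell j a b. f u v)
      = (\<Sum>w\<in>?\<pi> ` cell j a b. \<Sum>(u, v)\<in>{z \<in> cell j a b. ?\<pi> z = w}. f u v)"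
    by (rule sum.image_gen) simp
  also have "\<dots> = 0"
  proof (rule sum.neutral, rule ballI)
    fix w assume "w \<in> ?\<pi> ` cell j a b"
    then obtain u v where uv: "(u, v) \<in> cell j a b" "w = (u mod M i, v mod M i)" by auto
    have "cell i u v \<subseteq> cell j u v" by (rule cell_mono[OF assms(1)])
    also have "cell j u v = cell j a b" using uv by (intro cell_cong) (auto simp: cell_def)
    finally have "{z \<in> cell j a b. ?\<pi> z = w} = cell i u v"
      using uv by (auto simp: cell_def)
    then show "(\<Sum>(u, v)\<in>{z \<in> cell j a b. ?\<pi> z = w}. f u v) = 0"
      using zero[of u v] by simp
  qed
  finally show ?thesis .
qed

text \<open>
  The cell is not bad before level \<open>N\<close>, so only increments from level \<open>N\<close> on contribute. Whether they are
  counted is decided by a cell of the same level, over which the increment has mean zero.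
\<close>

lemma sum_stopped_diff_first_bad:
  assumes "t \<le> t'" "first_bad t N a b" "N < n"
  shows "(\<Sum>(u, v)\<in>cell N a b. stopped t' u v - stopped t u v) = 0"
proof -
  let ?f = "\<lambda>i u v. if bad t i u v \<and> \<not> bad t' i u v then F (Suc i) u v - F i u v else 0"
  have "(\<Sum>(u, v)\<in>cell N a b. ?f i u v) = 0" if "i < n" for i
  proof (cases "N \<le> i")
    case True
    show ?thesis
    proof (rule sum_cell_refine[OF True])
      fix c d
      have "bad t i u v = bad t i c d \<and> bad t' i u v = bad t' i c d" if "(u, v) \<in> cell i c d" for u v
        using that bad_cong[of u i c v d] unfolding cell_def by blast
      then have "(\<Sum>(u, v)\<in>cell i c d. ?f i u v)
          = (\<Sum>(u, v)\<in>cell i c d. if bad t i c d \<and> \<not> bad t' i c d then F (Suc i) u v - F i u v else 0)"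
        by (intro sum.cong refl) (simp add: case_prod_beta)
      also have "\<dots> = 0"
        using F_mean_cell[OF \<open>i < n\<close>, of c d] by (cases "bad t i c d \<and> \<not> bad t' i c d") auto
      finally show "(\<Sum>(u, v)\<in>cell i c d. ?f i u v) = 0" .
    qed
  next
    case False
    have "\<not> bad t i u v" if "(u, v) \<in> cell N a b" for u v
      using that assms(2) False first_bad_cong[of u N a v b t] by (simp add: cell_def first_bad_def)
    then show ?thesis by (intro sum.neutral) auto
  qed
  then show ?thesis
    unfolding stopped_diff[OF assms(1)] case_prod_beta by (subst sum.swap) simp
qed

text \<open>
  A cell that is bad for the first time has a child on which the next member exceeds \<open>t\<close>, and the child
  makes up at least the fraction \<open>1 / B\<^sup>2\<close> of the cell.
\<close>

lemma card_first_bad_le: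
  assumes "first_bad t N a b" "N < n"
  shows "(real (M n) / real (M N))\<^sup>2 \<le> (real B)\<^sup>2 * real (card {(u, v)\<in>cell N a b. t < maxF u v})"
proof -
  obtain j u v where j: "j \<le> N" "(u, v) \<in> cell j a b" "t < cmod (F (Suc j) u v)"
    using assms(1) unfolding first_bad_def bad_def by blast
  then have "bad t j a b" unfolding bad_def by blast
  then have "j = N" using assms(1) j(1) unfolding first_bad_def by (metis le_neq_implies_less)
  note j = j[unfolded this]
  have "cell (Suc N) u v \<subseteq> {(u, v)\<in>cell N a b. t < maxF u v}"
  proof
    fix z assume z: "z \<in> cell (Suc N) u v"
    obtain u' v' where z': "z = (u', v')" by (cases z)
    have "F (Suc N) u' v' = F (Suc N) u v"
      using z assms(2) by (intro F_cell) (auto simp: z' cell_def)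
    then have "t < maxF u' v'"
      using j(3) norm_F_le_maxF[of "Suc N" u' v'] assms(2) by simp
    moreover have "z \<in> cell N a b"
      using z cell_mono[of N "Suc N" u v] cell_cong[of u N a v b] j(2) by (auto simp: cell_def)
    ultimately show "z \<in> {(u, v)\<in>cell N a b. t < maxF u v}" by (simp add: z')
  qed
  then have "card (cell (Suc N) u v) \<le> card {(u, v)\<in>cell N a b. t < maxF u v}"
    by (intro card_mono) (auto intro: finite_subset[OF _ finite_cell])
  then have "(real (M n) / real (M (Suc N)))\<^sup>2 \<le> real (card {(u, v)\<in>cell N a b. t < maxF u v})"
    using card_cell[of "Suc N" u v] assms(2) by simp
  then have "(real B)\<^sup>2 * (real (M n) / real (M (Suc N)))\<^sup>2 \<le> (real B)\<^sup>2 * real (card {(u, v)\<in>cell N a b. t < maxF u v})"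
    by (rule mult_left_mono) simp
  moreover have "(real (M n) / real (M N))\<^sup>2 \<le> (real B * (real (M n) / real (M (Suc N))))\<^sup>2"
  proof (rule power_mono)
    show "real (M n) / real (M N) \<le> real B * (real (M n) / real (M (Suc N)))"
      using M_Suc_le[of N] by (simp add: field_simps flip: of_nat_mult)
  qed simp
  ultimately show ?thesis
    unfolding power_mult_distrib by linarith
qed

definition stop_cells :: "real \<Rightarrow> (nat \<times> nat \<times> nat) set" where
  "stop_cells t = {(i, q, r). i < n \<and> q < M i \<and> r < M i \<and> first_bad t i q r}"

lemma finite_stop_cells [simp]: "finite (stop_cells t)"
proof (rule finite_subset)
  show "stop_cells t \<subseteq> {..<n} \<times> {..<M n} \<times> {..<M n}"
    unfolding stop_cells_def using M_mono[OF less_imp_le] by (auto intro: less_le_trans)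
qed auto

lemma stop_cells_unique:
  assumes "(i, q, r) \<in> stop_cells t" "(i', q', r') \<in> stop_cells t"
    "u mod M i = q" "v mod M i = r" "u mod M i' = q'" "v mod M i' = r'"
  shows "(i, q, r) = (i', q', r')"
proof -
  have "first_bad t i u v" "first_bad t i' u v"
    using assms first_bad_cong[of u i q v r t] first_bad_cong[of u i' q' v r' t] by (auto simp: stop_cells_def)
  then have "i = i'" unfolding first_bad_def by (metis linorder_neqE_nat)
  then show ?thesis using assms by simp
qed

lemma sum_card_stop_cells_le:
  "(\<Sum>z\<in>stop_cells t. (real (M n) / real (M (fst z)))\<^sup>2)
    \<le> (real B)\<^sup>2 * real (card {(u, v). u < M n \<and> v < M n \<and> t < maxF u v})"
proof -
  let ?G = "\<lambda>z. {(u, v)\<in>cell (fst z) (fst (snd z)) (snd (snd z)). t < maxF u v}"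
  have fin: "finite (?G z)" for z by (rule finite_subset[OF _ finite_cell]) auto
  have "(\<Sum>z\<in>stop_cells t. (real (M n) / real (M (fst z)))\<^sup>2) \<le> (\<Sum>z\<in>stop_cells t. (real B)\<^sup>2 * real (card (?G z)))"
    by (intro sum_mono) (auto simp: stop_cells_def intro!: card_first_bad_le)
  also have "\<dots> = (real B)\<^sup>2 * real (\<Sum>z\<in>stop_cells t. card (?G z))"
    by (simp add: sum_distrib_left)
  also have "(\<Sum>z\<in>stop_cells t. card (?G z)) = card (\<Union>z\<in>stop_cells t. ?G z)"
  proof (rule card_UN_disjoint[symmetric])
    show "\<forall>z\<in>stop_cells t. \<forall>z'\<in>stop_cells t. z \<noteq> z' \<longrightarrow> ?G z \<inter> ?G z' = {}"
    proof (intro ballI impI)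
      fix z z' assume z: "z \<in> stop_cells t" "z' \<in> stop_cells t" "z \<noteq> z'"
      obtain i q r where [simp]: "z = (i, q, r)" by (cases z)
      obtain i' q' r' where [simp]: "z' = (i', q', r')" by (cases z')
      have "q < M i" "r < M i" "q' < M i'" "r' < M i'" using z by (auto simp: stop_cells_def)
      then show "?G z \<inter> ?G z' = {}"
        using stop_cells_unique[of i q r t i' q' r'] z by (auto simp: cell_def)
    qed
  qed (use fin in auto)
  also have "\<dots> \<le> card {(u, v). u < M n \<and> v < M n \<and> t < maxF u v}"
    by (rule card_mono) (auto simp: cell_def intro: finite_subset[of _ "{..<M n} \<times> {..<M n}"])
  finally show ?thesis by (simp add: mult_left_mono)
qed

text \<open>
  The atoms: the part of a difference of stopped martingales that lives on one maximal bad cell.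
\<close>

definition piece :: "real \<Rightarrow> real \<Rightarrow> nat \<times> nat \<times> nat \<Rightarrow> nat \<Rightarrow> nat \<Rightarrow> complex" where
  "piece t t' = (\<lambda>(i, q, r) u v. if u < M n \<and> v < M n \<and> u mod M i = q \<and> v mod M i = r
      then stopped t' u v - stopped t u v else 0)"

lemma sum_pieces:
  assumes "t \<le> t'" "u < M n" "v < M n"
  shows "stopped t' u v - stopped t u v = (\<Sum>z\<in>stop_cells t. piece t t' z u v)"
proof (cases "\<exists>i<n. bad t i u v")
  case True
  define i where "i = (LEAST i. bad t i u v)"
  obtain i' where "i' < n" "bad t i' u v" using True by blast
  then have "i < n" "bad t i u v"
    unfolding i_def by (auto intro: LeastI Least_le order.strict_trans1)
  moreover have "\<not> bad t j u v" if "j < i" for j using that not_less_Least unfolding i_def by blast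
  ultimately have "first_bad t i u v" by (simp add: first_bad_def)
  then have "first_bad t i (u mod M i) (v mod M i)" using first_bad_cong[of u i "u mod M i" v "v mod M i"] by simp
  then have mem: "(i, u mod M i, v mod M i) \<in> stop_cells t"
    using \<open>i < n\<close> by (simp add: stop_cells_def)
  have "(\<Sum>z\<in>stop_cells t. piece t t' z u v) = (\<Sum>z\<in>{(i, u mod M i, v mod M i)}. piece t t' z u v)"
  proof (rule sum.mono_neutral_right)
    show "\<forall>z\<in>stop_cells t - {(i, u mod M i, v mod M i)}. piece t t' z u v = 0"
    proof
      fix z assume z: "z \<in> stop_cells t - {(i, u mod M i, v mod M i)}"
      obtain i' q' r' where z': "z = (i', q', r')" by (cases z)
      have "\<not> (u mod M i' = q' \<and> v mod M i' = r')"
        using stop_cells_unique[OF mem, of i' q' r' u v] z unfolding z' by blast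
      then show "piece t t' z u v = 0" unfolding z' piece_def by auto
    qed
  qed (use mem in auto)
  then show ?thesis using assms by (simp add: piece_def)
next
  case False
  then have "stopped t' u v - stopped t u v = 0"
    unfolding stopped_diff[OF assms(1)] by (intro sum.neutral) auto
  moreover have "piece t t' z u v = 0" if "stopped t' u v - stopped t u v = 0" for z
    using that by (cases z) (auto simp: piece_def)
  ultimately show ?thesis by simp
qed

text \<open>
  The martingale is the sum of the part stopped at level \<open>t0\<close>, which is an atom of level \<open>0\<close>, and of
  the pieces for the levels \<open>t0 * 2 ^ k\<close>. Summing the atomic estimates, the level sets of \<open>maxF\<close> reassemble to
  the \<open>p\<close>-th moment of \<open>maxF\<close> by \<open>sum_dyadic_le\<close>.
\<close>

proposition strong_sum_le_maxF:
  assumes J: "finite J" "J \<subseteq> ratio_cone \<alpha>" "\<And>k l. (k, l) \<in> J \<Longrightarrow> k \<le> M n \<and> l \<le> M n" and \<alpha>: "0 \<le> \<alpha>"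
  shows "strong_sum n J (F n) \<le> decomp_const \<alpha> * (\<Sum>u<M n. \<Sum>v<M n. maxF u v powr p)"
proof -
  let ?X = "\<Sum>u<M n. \<Sum>v<M n. maxF u v powr p"
  let ?G = "\<lambda>t. {(u, v). u < M n \<and> v < M n \<and> t < maxF u v}"
  have X: "0 \<le> ?X" by (intro sum_nonneg) auto
  have finG: "finite (?G t)" for t
    by (rule finite_subset[of _ "{..<M n} \<times> {..<M n}"]) auto
  show ?thesis
  proof (cases "?X = 0")
    case True
    have "F n u v = 0" if "u < M n" "v < M n" for u v
    proof -
      have "(\<Sum>v<M n. maxF u v powr p) = 0"
        using True that by (subst (asm) sum_nonneg_eq_0_iff) (auto intro!: sum_nonneg)
      then have "maxF u v = 0"
        using that by (subst (asm) sum_nonneg_eq_0_iff) auto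
      then show ?thesis using norm_F_le_maxF[of n u v] by simp
    qed
    then have "strong_sum n J (F n) = strong_sum n J (\<lambda>u v. 0)"
      by (intro strong_sum_cong) auto
    also have "\<dots> = 0"
      using p_pos by (simp add: strong_sum_def proj2_expand Lp_sum_def)
    finally show ?thesis using True by simp
  next
    case False
    then have Xpos: "0 < ?X" using X by simp
    \<comment> \<open>The smallest threshold is the \<open>L\<^sub>p\<close> norm of the maximal function.\<close>
    define t0 where "t0 = (?X / (real (M n))\<^sup>2) powr (1 / p)"
    have t0: "0 < t0" using Xpos by (simp add: t0_def)
    have t0p: "t0 powr p * (real (M n))\<^sup>2 = ?X"
      using Xpos p_pos by (simp add: t0_def powr_powr)
    define t where "t k = t0 * 2 ^ k" for k :: nat
    have t_pos: "0 < t k" and t_Suc: "t (Suc k) = 2 * t k" and t_ge: "t0 \<le> t k" for k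
      using t0 by (simp_all add: t_def)
    have F0: "cmod (F 0 a b) \<le> t0" for a b
    proof -
      have "F 0 u v = F 0 a b" for u v
        by (rule F_cell) (simp_all add: vil_M_0)
      then have "(\<Sum>u<M n. \<Sum>v<M n. cmod (F 0 u v) powr p) = (\<Sum>u<M n. \<Sum>v<M n. cmod (F 0 a b) powr p)"
        by (intro sum.cong refl) (rule arg_cong)
      then have "cmod (F 0 a b) powr p * (real (M n))\<^sup>2 = (\<Sum>u<M n. \<Sum>v<M n. cmod (F 0 u v) powr p)"
        by (simp add: power2_eq_square)
      also have "\<dots> \<le> ?X"
        using p_pos by (intro sum_mono powr_mono2 norm_F_le_maxF) auto
      finally have "cmod (F 0 a b) powr p \<le> t0 powr p"
        unfolding t0p[symmetric] by simp
      then show ?thesis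
        using p_pos t0 powr_less_mono2[of p t0 "cmod (F 0 a b)"] by force
    qed
    \<comment> \<open>A level above all values of the martingale, at which nothing is stopped.\<close>
    define K where "K = nat \<lceil>log 2 ((\<Sum>i\<le>n. \<Sum>u<M n. \<Sum>v<M n. cmod (F i u v)) / t0 + 1)\<rceil>"
    have not_bad_K: "\<not> bad (t K) i a b" if "i < n" for i a b
    proof
      let ?S = "\<Sum>i\<le>n. \<Sum>u<M n. \<Sum>v<M n. cmod (F i u v)"
      assume "bad (t K) i a b"
      then obtain j u v where j: "j \<le> i" "u < M n" "v < M n" "t K < cmod (F (Suc j) u v)"
        unfolding bad_def cell_def by blast
      have S: "0 \<le> ?S" by (intro sum_nonneg) auto
      have "cmod (F (Suc j) u v) \<le> (\<Sum>v<M n. cmod (F (Suc j) u v))"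
        using j by (intro member_le_sum[of v]) auto
      also have "\<dots> \<le> (\<Sum>u<M n. \<Sum>v<M n. cmod (F (Suc j) u v))"
        using j by (intro member_le_sum[of u "{..<M n}" "\<lambda>u. \<Sum>v<M n. cmod (F (Suc j) u v)"] sum_nonneg) auto
      also have "\<dots> \<le> ?S"
        using j that
        by (intro member_le_sum[of "Suc j" "{..n}" "\<lambda>i. \<Sum>u<M n. \<Sum>v<M n. cmod (F i u v)"] sum_nonneg) auto
      finally have "t K < ?S" using j by linarith
      moreover have "?S / t0 + 1 \<le> 2 ^ K"
      proof -
        have "0 < ?S / t0 + 1" using S t0 by (simp add: add_nonneg_pos)
        then have "?S / t0 + 1 = 2 powr (log 2 (?S / t0 + 1))" by simp
        also have "\<dots> \<le> 2 powr real K"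
          unfolding K_def by (intro powr_mono) linarith+
        finally show ?thesis by (simp add: powr_realpow)
      qed
      then have "?S + t0 \<le> t K" using t0 by (simp add: t_def field_simps)
      ultimately show False using t0 by linarith
    qed
    define h where "h k a b = stopped (t k) a b" for k a b
    have norm_h: "cmod (h k a b) \<le> t k" if "a < M n" "b < M n" for k a b
      unfolding h_def using norm_stopped_le[OF that] F0[of a b] t_ge[of k] by simp
    define g0 where "g0 a b = (if a < M n \<and> b < M n then h 0 a b else 0)" for a b
    define I where "I = (SIGMA k:{..<K}. stop_cells (t k))"
    define g where "g = (\<lambda>(k, z). piece (t k) (t (Suc k)) z)"
    have finI: "finite I" by (simp add: I_def)
    have decomp: "F n u v = (\<Sum>i\<in>insert None (Some ` I). (case i of None \<Rightarrow> g0 | Some kz \<Rightarrow> g kz) u v)"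
      if uv: "u < M n" "v < M n" for u v
    proof -
      have "F n u v = h K u v"
        unfolding h_def by (rule stopped_eq_F[symmetric]) (rule not_bad_K)
      also have "\<dots> = h 0 u v + (\<Sum>k<K. h (Suc k) u v - h k u v)"
        using sum_lessThan_telescope[of "\<lambda>k. h k u v" K] by simp
      also have "(\<Sum>k<K. h (Suc k) u v - h k u v) = (\<Sum>k<K. \<Sum>z\<in>stop_cells (t k). piece (t k) (t (Suc k)) z u v)"
        using t_pos uv unfolding h_def
        by (intro sum.cong refl sum_pieces) (simp_all add: t_Suc less_imp_le)
      also have "\<dots> = (\<Sum>kz\<in>I. g kz u v)"
        by (simp add: I_def g_def sum.Sigma case_prod_unfold)
      finally show ?thesis
        using finI uv by (simp add: sum.reindex g0_def)
    qed
    have "strong_sum n J (F n)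
        = strong_sum n J (\<lambda>u v. \<Sum>i\<in>insert None (Some ` I). (case i of None \<Rightarrow> g0 | Some kz \<Rightarrow> g kz) u v)"
      by (intro strong_sum_cong decomp)
    also have "\<dots> \<le> (\<Sum>i\<in>insert None (Some ` I). strong_sum n J (case i of None \<Rightarrow> g0 | Some kz \<Rightarrow> g kz))"
      using finI by (intro strong_sum_sum_le) auto
    also have "\<dots> = strong_sum n J g0 + (\<Sum>k<K. \<Sum>z\<in>stop_cells (t k). strong_sum n J (piece (t k) (t (Suc k)) z))"
      using finI by (simp add: sum.reindex) (simp add: I_def g_def sum.Sigma case_prod_unfold)
    also have "\<dots> \<le> atom_const \<alpha> * ?X
        + (\<Sum>k<K. atom_const \<alpha> * (4 powr p * (real B)\<^sup>2) * (t k powr p * real (card (?G (t k)))))"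
    proof (intro add_mono sum_mono)
      have "strong_sum n J g0 \<le> atom_const \<alpha> * t0 powr p * (real (M n) / real (M 0))\<^sup>2"
        using t0 norm_h[of _ _ 0] J \<alpha>
        by (intro strong_sum_atom[where q = 0 and r = 0]) (auto simp: g0_def t_def vil_M_0)
      then show "strong_sum n J g0 \<le> atom_const \<alpha> * ?X"
        using t0p by (simp add: vil_M_0 mult.assoc)
    next
      fix k
      have le: "t k \<le> t (Suc k)" using t_pos[of k] by (simp add: t_Suc)
      have "strong_sum n J (piece (t k) (t (Suc k)) z)
          \<le> atom_const \<alpha> * (4 * t k) powr p * (real (M n) / real (M (fst z)))\<^sup>2"
        if z: "z \<in> stop_cells (t k)" for z
      proof -
        obtain N q r where zq: "z = (N, q, r)" by (cases z)
        have N: "N < n" "q < M N" "r < M N" "first_bad (t k) N q r"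
          using z by (auto simp: zq stop_cells_def)
        have "strong_sum n J (piece (t k) (t (Suc k)) (N, q, r))
            \<le> atom_const \<alpha> * (4 * t k) powr p * (real (M n) / real (M N))\<^sup>2"
        proof (rule strong_sum_atom[where q = q and r = r])
          fix u v
          show "piece (t k) (t (Suc k)) (N, q, r) u v = 0" if "u mod M N \<noteq> q mod M N \<or> v mod M N \<noteq> r mod M N"
            using that N by (auto simp: piece_def)
          show "cmod (piece (t k) (t (Suc k)) (N, q, r) u v) \<le> 4 * t k"
          proof (cases "u < M n \<and> v < M n")
            case True
            then have "cmod (h (Suc k) u v - h k u v) \<le> t (Suc k) + t k"
              using norm_h[of u v "Suc k"] norm_h[of u v k]
              by (intro order_trans[OF norm_triangle_ineq4] add_mono) auto
            then show ?thesis using t_pos[of k] by (auto simp: piece_def h_def t_Suc)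
          qed (use t_pos[of k] in \<open>auto simp: piece_def\<close>)
          have "(\<Sum>u<M n. \<Sum>v<M n. piece (t k) (t (Suc k)) (N, q, r) u v)
              = (\<Sum>(u, v)\<in>cell N q r. stopped (t (Suc k)) u v - stopped (t k) u v)"
            unfolding sum.cartesian_product using N
            by (intro sum.mono_neutral_cong_right) (auto simp: piece_def cell_def split: if_splits)
          also have "\<dots> = 0" using N by (intro sum_stopped_diff_first_bad[OF le]) auto
          finally show "N = 0 \<or> (\<Sum>u<M n. \<Sum>v<M n. piece (t k) (t (Suc k)) (N, q, r) u v) = 0" by simp
        qed (use N J \<alpha> t_pos[of k] in auto)
        then show ?thesis by (simp add: zq)
      qed
      then have "(\<Sum>z\<in>stop_cells (t k). strong_sum n J (piece (t k) (t (Suc k)) z))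
          \<le> atom_const \<alpha> * (4 * t k) powr p * (\<Sum>z\<in>stop_cells (t k). (real (M n) / real (M (fst z)))\<^sup>2)"
        unfolding sum_distrib_left by (intro sum_mono)
      also have "\<dots> \<le> atom_const \<alpha> * (4 * t k) powr p * ((real B)\<^sup>2 * real (card (?G (t k))))"
        by (intro mult_left_mono sum_card_stop_cells_le mult_nonneg_nonneg atom_const_nonneg) auto
      finally show "(\<Sum>z\<in>stop_cells (t k). strong_sum n J (piece (t k) (t (Suc k)) z))
          \<le> atom_const \<alpha> * (4 powr p * (real B)\<^sup>2) * (t k powr p * real (card (?G (t k))))"
        using t_pos[of k] by (simp add: powr_mult mult_ac)
    qed
    also have "\<dots> = atom_const \<alpha> * ?X
        + atom_const \<alpha> * (4 powr p * (real B)\<^sup>2) * (\<Sum>k<K. t k powr p * real (card (?G (t k))))"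
      by (simp only: sum_distrib_left)
    also have "\<dots> \<le> atom_const \<alpha> * ?X
        + atom_const \<alpha> * (4 powr p * (real B)\<^sup>2) * (2 powr p / (2 powr p - 1) * ?X)"
    proof -
      have "(\<Sum>k<K. t k powr p * real (card (?G (t k))))
          = (\<Sum>u<M n. \<Sum>v<M n. \<Sum>k<K. if t k < maxF u v then t k powr p else 0)"
      proof -
        have "t k powr p * real (card (?G (t k))) = (\<Sum>u<M n. \<Sum>v<M n. if t k < maxF u v then t k powr p else 0)" for k
        proof -
          have "(\<Sum>u<M n. \<Sum>v<M n. if t k < maxF u v then t k powr p else 0) = (\<Sum>z\<in>?G (t k). t k powr p)"
            unfolding sum.cartesian_product by (intro sum.mono_neutral_cong_right) (auto split: if_splits)
          then show ?thesis by simp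
        qed
        then show ?thesis by (simp only: sum.swap[of _ "{..<K}"])
      qed
      also have "\<dots> \<le> (\<Sum>u<M n. \<Sum>v<M n. 2 powr p / (2 powr p - 1) * maxF u v powr p)"
        unfolding t_def by (intro sum_mono sum_dyadic_le t0 maxF_nonneg p_pos)
      also have "\<dots> = 2 powr p / (2 powr p - 1) * ?X"
        by (simp only: sum_distrib_left)
      finally show ?thesis
        by (intro add_left_mono mult_left_mono mult_nonneg_nonneg atom_const_nonneg) auto
    qed
    also have "\<dots> = decomp_const \<alpha> * ?X"
      by (simp add: decomp_const_def algebra_simps)
    finally show ?thesis .
  qed
qed

end

section \<open>Integrals of functions of finitely many coordinates\<close>

context vilenkin begin

abbreviation "G \<equiv> vil_group m"
abbreviation "\<mu>2 \<equiv> vil_measure2 m"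

text \<open>
  The number of the cell of level \<open>n\<close> that contains \<open>x\<close>; the point \<open>dig a\<close> represents the cell \<open>a\<close>.
\<close>

definition code :: "nat \<Rightarrow> (nat \<Rightarrow> nat) \<Rightarrow> nat" where
  "code n x = (\<Sum>j<n. x j * M j)"

lemma M_neq_0 [simp]: "M n \<noteq> 0"
  using M_pos[of n] by linarith

lemma mem_G_iff: "x \<in> G \<longleftrightarrow> (\<forall>k. x k < m k)"
  by (auto simp: vil_group_eq PiE_UNIV_domain Pi_iff)

lemma dig_in_G [simp]: "dig a \<in> G"
  by (simp add: mem_G_iff dig_less)

lemma dig_code: "x \<in> G \<Longrightarrow> k < n \<Longrightarrow> dig (code n x) k = x k"
  unfolding code_def by (rule vil_digit_unique[OF seq]) (auto simp: mem_G_iff)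

lemma code_dig: "code n (dig a) = a mod M n"
  by (simp add: code_def vil_digit_mod)

lemma code_mod: "x \<in> G \<Longrightarrow> i \<le> n \<Longrightarrow> code n x mod M i = code i x"
  using vil_digit_mod[of m "code n x" i] by (simp add: code_def[of i] dig_code)

lemma code_less: "x \<in> G \<Longrightarrow> code n x < M n"
  using code_mod[of x n n] mod_less_divisor[OF M_pos, of "code n x" n] by simp

lemma code_eq_iff: "x \<in> G \<Longrightarrow> y \<in> G \<Longrightarrow> code n x = code n y \<longleftrightarrow> (\<forall>k<n. x k = y k)"
  using dig_code by (metis (no_types, lifting) code_def lessThan_iff sum.cong)

lemma code_dig_code: "x \<in> G \<Longrightarrow> i \<le> n \<Longrightarrow> code i (dig (code n x)) = code i x"
  by (simp add: code_dig code_mod)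

lemma vil_I_eq_code: "x \<in> G \<Longrightarrow> vil_I m n x = {y \<in> G. code n y = code n x}"
  by (auto simp: vil_I_def code_eq_iff)

lemma emeasure_vil_I:
  assumes "x \<in> G"
  shows "emeasure (vil_measure m) (vil_I m n x) = ennreal (1 / real (M n))"
proof -
  let ?U = "\<lambda>k. uniform_count_measure {0..<m k}"
  have "prob_space (?U k)" for k
    using m_pos[of k] by (intro prob_space_uniform_count_measure) auto
  then interpret product_prob_space ?U UNIV by (intro product_prob_spaceI)
  have I: "vil_I m n x = prod_emb UNIV ?U {..<n} (Pi\<^sub>E {..<n} (\<lambda>i. {x i}))"
    using assms by (subst prod_emb_PiE)
      (auto simp: vil_I_def space_uniform_count_measure mem_G_iff PiE_iff if_split_mem2, metis)
  have "emeasure (vil_measure m) (vil_I m n x) = (\<Prod>i<n. emeasure (?U i) {x i})"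
    unfolding I vil_measure_def using assms
    by (intro emeasure_PiM_emb) (auto simp: sets_uniform_count_measure mem_G_iff)
  also have "\<dots> = (\<Prod>i<n. ennreal (1 / real (m i)))"
    using assms by (intro prod.cong refl, subst emeasure_uniform_count_measure) (auto simp: mem_G_iff)
  also have "\<dots> = ennreal (\<Prod>i<n. 1 / real (m i))"
    by (rule prod_ennreal) simp
  finally show ?thesis by (simp add: vil_M_def prod_dividef)
qed

definition square :: "nat \<Rightarrow> nat \<Rightarrow> nat \<Rightarrow> ((nat \<Rightarrow> nat) \<times> (nat \<Rightarrow> nat)) set" where
  "square n a b = vil_I m n (dig a) \<times> vil_I m n (dig b)"

lemma mem_square:
  "a < M n \<Longrightarrow> b < M n \<Longrightarrow> z \<in> square n a b \<longleftrightarrow> z \<in> G \<times> G \<and> code n (fst z) = a \<and> code n (snd z) = b"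
  by (auto simp: square_def vil_I_eq_code code_dig)

lemma space_\<mu>2: "space \<mu>2 = G \<times> G"
  by (simp add: vil_measure2_def space_pair_measure)

lemma square_in_F: "square n a b \<in> sets (vil_F m n)"
  unfolding vil_F_def square_def
proof (rule in_measure_of)
  show "{vil_I m n x \<times> vil_I m n y |x y. x \<in> G \<and> y \<in> G} \<subseteq> Pow (G \<times> G)"
    by (auto simp: vil_I_def)
qed (use dig_in_G in blast)

lemma square_sets [measurable]: "square n a b \<in> sets \<mu>2"
  using square_in_F[of n a b] vil_F_subalgebra[of m n] unfolding subalgebra_def by blast

lemma emeasure_square: "emeasure \<mu>2 (square n a b) = ennreal (1 / (real (M n))\<^sup>2)"
proof -
  interpret prob_space "vil_measure m" by (rule vil_measure_prob[OF seq])
  show ?thesis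
    unfolding vil_measure2_def square_def
    by (simp add: emeasure_pair_measure_Times vil_I_sets emeasure_vil_I power2_eq_square flip: ennreal_mult)
qed

lemma measure_square: "measure \<mu>2 (square n a b) = 1 / (real (M n))\<^sup>2"
  by (simp add: measure_def emeasure_square)

lemma sum_over_squares:
  assumes "z \<in> G \<times> G"
  shows "(\<Sum>a<M n. \<Sum>b<M n. if z \<in> square n a b then f a b else 0) = f (code n (fst z)) (code n (snd z))"
proof -
  have "(\<Sum>a<M n. \<Sum>b<M n. if z \<in> square n a b then f a b else 0)
      = (\<Sum>a<M n. if a = code n (fst z) then \<Sum>b<M n. if b = code n (snd z) then f a b else 0 else 0)"
    using assms by (intro sum.cong refl) (auto simp: mem_square)
  then show ?thesis using assms by (auto simp: code_less)
qed

lemma nn_integral_level: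
  assumes "\<And>z. z \<in> G \<times> G \<Longrightarrow> h z = ennreal (H (code n (fst z)) (code n (snd z)))"
    and "\<And>a b. 0 \<le> H a b"
  shows "(\<integral>\<^sup>+z. h z \<partial>\<mu>2) = ennreal ((\<Sum>a<M n. \<Sum>b<M n. H a b) / (real (M n))\<^sup>2)"
proof -
  have "(\<integral>\<^sup>+z. h z \<partial>\<mu>2) = (\<integral>\<^sup>+z. (\<Sum>a<M n. \<Sum>b<M n. ennreal (H a b) * indicator (square n a b) z) \<partial>\<mu>2)"
  proof (rule nn_integral_cong)
    fix z assume "z \<in> space \<mu>2"
    then have z: "z \<in> G \<times> G" by (simp add: space_\<mu>2)
    have "(\<Sum>a<M n. \<Sum>b<M n. ennreal (H a b) * indicator (square n a b) z)
        = (\<Sum>a<M n. \<Sum>b<M n. if z \<in> square n a b then ennreal (H a b) else 0)"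
      by (intro sum.cong refl) (simp add: indicator_def)
    then show "h z = (\<Sum>a<M n. \<Sum>b<M n. ennreal (H a b) * indicator (square n a b) z)"
      unfolding sum_over_squares[OF z] assms(1)[OF z] by (rule sym)
  qed
  also have "\<dots> = (\<Sum>a<M n. \<Sum>b<M n. ennreal (H a b) * ennreal (1 / (real (M n))\<^sup>2))"
    by (simp add: nn_integral_sum nn_integral_cmult_indicator emeasure_square del: sum_mult_indicator)
  also have "\<dots> = ennreal (\<Sum>a<M n. \<Sum>b<M n. H a b * (1 / (real (M n))\<^sup>2))"
  proof -
    have "(\<Sum>a<M n. \<Sum>b<M n. ennreal (H a b) * ennreal (1 / (real (M n))\<^sup>2))
        = (\<Sum>a<M n. \<Sum>b<M n. ennreal (H a b * (1 / (real (M n))\<^sup>2)))"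
      using assms(2) by (intro sum.cong refl ennreal_mult'[symmetric])
    also have "\<dots> = ennreal (\<Sum>a<M n. \<Sum>b<M n. H a b * (1 / (real (M n))\<^sup>2))"
      using assms(2) by (simp add: sum_ennreal sum_nonneg)
    finally show ?thesis .
  qed
  finally show ?thesis by (simp add: sum_divide_distrib)
qed

lemma has_integral_level:
  fixes H :: "nat \<Rightarrow> nat \<Rightarrow> complex"
  assumes "\<And>z. z \<in> G \<times> G \<Longrightarrow> h z = H (code n (fst z)) (code n (snd z))"
  shows "has_bochner_integral \<mu>2 h ((\<Sum>a<M n. \<Sum>b<M n. H a b) / (of_nat (M n))\<^sup>2)"
proof -
  have "has_bochner_integral \<mu>2 (\<lambda>z. \<Sum>a<M n. \<Sum>b<M n. indicator (square n a b) z *\<^sub>R H a b)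
      (\<Sum>a<M n. \<Sum>b<M n. measure \<mu>2 (square n a b) *\<^sub>R H a b)"
    by (intro has_bochner_integral_sum has_bochner_integral_scaleR_left has_bochner_integral_real_indicator
        square_sets) (simp add: emeasure_square)
  also have "(\<Sum>a<M n. \<Sum>b<M n. measure \<mu>2 (square n a b) *\<^sub>R H a b) = (\<Sum>a<M n. \<Sum>b<M n. H a b) / (of_nat (M n))\<^sup>2"
    by (simp add: measure_square scaleR_conv_of_real sum_divide_distrib)
  finally show ?thesis
  proof (subst (asm) has_bochner_integral_cong[OF refl _ refl])
    fix z assume "z \<in> space \<mu>2"
    then have z: "z \<in> G \<times> G" by (simp add: space_\<mu>2)
    have "(\<Sum>a<M n. \<Sum>b<M n. indicator (square n a b) z *\<^sub>R H a b)
        = (\<Sum>a<M n. \<Sum>b<M n. if z \<in> square n a b then H a b else 0)"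
      by (intro sum.cong refl) (simp add: indicator_def)
    then show "(\<Sum>a<M n. \<Sum>b<M n. indicator (square n a b) z *\<^sub>R H a b) = h z"
      unfolding sum_over_squares[OF z] assms[OF z] .
  qed
qed

lemma integral_level:
  fixes H :: "nat \<Rightarrow> nat \<Rightarrow> complex"
  assumes "\<And>z. z \<in> G \<times> G \<Longrightarrow> h z = H (code n (fst z)) (code n (snd z))"
  shows "integrable \<mu>2 h" "integral\<^sup>L \<mu>2 h = (\<Sum>a<M n. \<Sum>b<M n. H a b) / (of_nat (M n))\<^sup>2"
  using has_integral_level[of h H n] assms by (auto simp: has_bochner_integral_iff)

lemma sets_vil_F_eq:
  "sets (vil_F m n) = sigma_sets (G \<times> G) {vil_I m n x \<times> vil_I m n y |x y. x \<in> G \<and> y \<in> G}"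
  unfolding vil_F_def by (rule sets_measure_of) (auto simp: vil_I_def)

lemma space_vil_F: "space (vil_F m n) = G \<times> G"
  unfolding vil_F_def by (rule space_measure_of) (auto simp: vil_I_def)

text \<open>
  Every set of the \<open>\<sigma>\<close>-algebra is a union of the generating squares.
\<close>

lemma mem_vil_F_cong:
  assumes "A \<in> sets (vil_F m n)" "z \<in> G \<times> G" "z' \<in> G \<times> G"
    "code n (fst z) = code n (fst z')" "code n (snd z) = code n (snd z')"
  shows "z \<in> A \<longleftrightarrow> z' \<in> A"
  using assms(1) unfolding sets_vil_F_eq
proof induction
  case (Basic A)
  then show ?case using assms(2-) by (auto simp: vil_I_eq_code)
qed (use assms(2,3) in auto)

lemma vil_F_measurable_cong:
  fixes f :: "_ \<Rightarrow> complex"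
  assumes "f \<in> borel_measurable (vil_F m n)" "z \<in> G \<times> G" "z' \<in> G \<times> G"
    "code n (fst z) = code n (fst z')" "code n (snd z) = code n (snd z')"
  shows "f z = f z'"
proof -
  have "f -` {f z} \<inter> space (vil_F m n) \<in> sets (vil_F m n)"
    by (rule measurable_sets[OF assms(1)]) simp
  from mem_vil_F_cong[OF this assms(2-)] show ?thesis
    using assms by (simp add: space_vil_F)
qed

lemma measurable_vil_FI:
  fixes H :: "nat \<Rightarrow> nat \<Rightarrow> complex"
  assumes "\<And>z. z \<in> G \<times> G \<Longrightarrow> h z = H (code n (fst z)) (code n (snd z))"
  shows "h \<in> borel_measurable (vil_F m n)"
proof -
  have [measurable]: "square n a b \<in> sets (vil_F m n)" for a b by (rule square_in_F)
  have "(\<lambda>z. \<Sum>a<M n. \<Sum>b<M n. indicator (square n a b) z *\<^sub>R H a b) \<in> borel_measurable (vil_F m n)"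
    by measurable
  then show ?thesis
  proof (subst (asm) measurable_cong)
    fix z assume "z \<in> space (vil_F m n)"
    then have z: "z \<in> G \<times> G" by (simp add: space_vil_F)
    have "(\<Sum>a<M n. \<Sum>b<M n. indicator (square n a b) z *\<^sub>R H a b)
        = (\<Sum>a<M n. \<Sum>b<M n. if z \<in> square n a b then H a b else 0)"
      by (intro sum.cong refl) (simp add: indicator_def)
    then show "(\<Sum>a<M n. \<Sum>b<M n. indicator (square n a b) z *\<^sub>R H a b) = h z"
      unfolding sum_over_squares[OF z] assms[OF z] .
  qed
qed

lemma sigma_finite_vil_F: "sigma_finite_subalgebra \<mu>2 (vil_F m n)"
proof (rule finite_measure_subalgebra_is_sigma_finite)
  interpret prob_space \<mu>2 by (rule vil_measure2_prob[OF seq])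
  show "finite_measure_subalgebra \<mu>2 (vil_F m n)"
    by standard (rule vil_F_subalgebra)
qed

lemma martingale_integral_eq:
  assumes f: "complex_martingale \<mu>2 (vil_F m) f" and ik: "i \<le> k" and A: "A \<in> sets (vil_F m i)"
  shows "(\<integral>z. indicator A z *\<^sub>R f k z \<partial>\<mu>2) = (\<integral>z. indicator A z *\<^sub>R f i z \<partial>\<mu>2)"
proof -
  interpret sigma_finite_subalgebra \<mu>2 "vil_F m i" by (rule sigma_finite_vil_F)
  have A2 [measurable]: "A \<in> sets \<mu>2" using A vil_F_subalgebra[of m i] by (auto simp: subalgebra_def)
  have int: "integrable \<mu>2 (f k)" "integrable \<mu>2 (f i)"
    and AE: "AE x in \<mu>2. complex_cond_exp \<mu>2 (vil_F m i) (f k) x = f i x"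
    using f ik by (auto simp: complex_martingale_def)
  have int': "integrable \<mu>2 (\<lambda>z. indicator A z *\<^sub>R f j z)" if "integrable \<mu>2 (f j)" for j
    using that by (intro integrable_mult_indicator A2)
  have part: "(\<integral>z. indicator A z * g (f k z) \<partial>\<mu>2) = (\<integral>z. indicator A z * g (f i z) \<partial>\<mu>2)"
    if g: "integrable \<mu>2 (\<lambda>z. g (f k z))" "integrable \<mu>2 (\<lambda>z. g (f i z))"
      "AE x in \<mu>2. real_cond_exp \<mu>2 (vil_F m i) (\<lambda>z. g (f k z)) x = g (f i x)" for g :: "complex \<Rightarrow> real"
  proof -
    have [measurable]: "(\<lambda>z. g (f i z)) \<in> borel_measurable \<mu>2" using g by auto
    have "(\<integral>z\<in>A. g (f k z) \<partial>\<mu>2) = (\<integral>z\<in>A. real_cond_exp \<mu>2 (vil_F m i) (\<lambda>z. g (f k z)) z \<partial>\<mu>2)"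
      by (rule real_cond_exp_intA[OF g(1) A])
    also have "\<dots> = (\<integral>z\<in>A. g (f i z) \<partial>\<mu>2)"
      unfolding set_lebesgue_integral_def using g(3) by (intro integral_cong_AE) auto
    finally show ?thesis by (simp add: set_lebesgue_integral_def)
  qed
  have "(\<integral>z. indicator A z * Re (f k z) \<partial>\<mu>2) = (\<integral>z. indicator A z * Re (f i z) \<partial>\<mu>2)"
    using AE int by (intro part) (auto simp: complex_cond_exp_def complex_eq_iff)
  moreover have "(\<integral>z. indicator A z * Im (f k z) \<partial>\<mu>2) = (\<integral>z. indicator A z * Im (f i z) \<partial>\<mu>2)"
    using AE int by (intro part) (auto simp: complex_cond_exp_def complex_eq_iff)
  ultimately show ?thesis
    using int'[OF int(1)] int'[OF int(2)]
    by (intro complex_eqI) (simp_all flip: integral_Re integral_Im)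
qed

text \<open>
  A member \<open>f i\<close> of a martingale is determined by its values at the points that represent the squares.
\<close>

definition disc :: "(nat \<Rightarrow> (nat \<Rightarrow> nat) \<times> (nat \<Rightarrow> nat) \<Rightarrow> complex) \<Rightarrow> nat \<Rightarrow> nat \<Rightarrow> nat \<Rightarrow> complex" where
  "disc f i u v = f i (dig u, dig v)"

lemma martingale_eq_disc:
  assumes f: "complex_martingale \<mu>2 (vil_F m) f" and z: "z \<in> G \<times> G" and "i \<le> n"
  shows "f i z = disc f i (code n (fst z)) (code n (snd z))"
  unfolding disc_def using assms
  by (intro vil_F_measurable_cong[where n = i]) (auto simp: complex_martingale_def code_dig_code)

lemma square_eq_code:
  assumes "z \<in> G \<times> G" "i \<le> n" "a < M i" "b < M i"
  shows "z \<in> square i a b \<longleftrightarrow> code n (fst z) mod M i = a \<and> code n (snd z) mod M i = b"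
  using assms by (auto simp: mem_square code_mod)

lemma disc_mean:
  assumes f: "complex_martingale \<mu>2 (vil_F m) f" and "i < n"
  shows "(\<Sum>(u, v)\<in>{(u, v). u < M n \<and> v < M n \<and> u mod M i = a mod M i \<and> v mod M i = b mod M i}.
    disc f (Suc i) u v - disc f i u v) = 0"
proof -
  let ?C = "{(u, v). u < M n \<and> v < M n \<and> u mod M i = a mod M i \<and> v mod M i = b mod M i}"
  let ?A = "square i (a mod M i) (b mod M i)"
  have *: "(\<integral>z. indicator ?A z *\<^sub>R f j z \<partial>\<mu>2) = (\<Sum>(u, v)\<in>?C. disc f j u v) / (of_nat (M n))\<^sup>2" if "j \<le> n" for j
  proof -
    have "(\<integral>z. indicator ?A z *\<^sub>R f j z \<partial>\<mu>2)
        = (\<Sum>u<M n. \<Sum>v<M n. if u mod M i = a mod M i \<and> v mod M i = b mod M i then disc f j u v else 0) / (of_nat (M n))\<^sup>2"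
      using assms that square_eq_code[of _ i n] martingale_eq_disc[OF f _ that]
      by (intro integral_level(2)) (auto simp: indicator_def)
    also have "(\<Sum>u<M n. \<Sum>v<M n. if u mod M i = a mod M i \<and> v mod M i = b mod M i then disc f j u v else 0)
        = (\<Sum>(u, v)\<in>?C. disc f j u v)"
      unfolding sum.cartesian_product by (intro sum.mono_neutral_cong_right) (auto split: if_splits)
    finally show ?thesis .
  qed
  have "(\<integral>z. indicator ?A z *\<^sub>R f (Suc i) z \<partial>\<mu>2) = (\<integral>z. indicator ?A z *\<^sub>R f i z \<partial>\<mu>2)"
    by (intro martingale_integral_eq[OF f] square_in_F) simp
  then have "(\<Sum>(u, v)\<in>?C. disc f (Suc i) u v) = (\<Sum>(u, v)\<in>?C. disc f i u v)"
    using *[of "Suc i"] *[of i] assms(2) by simp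
  moreover have "(\<Sum>(u, v)\<in>?C. disc f (Suc i) u v - disc f i u v)
      = (\<Sum>(u, v)\<in>?C. disc f (Suc i) u v) - (\<Sum>(u, v)\<in>?C. disc f i u v)"
    unfolding sum_subtractf[symmetric] by (intro sum.cong refl) auto
  ultimately show ?thesis by (simp only: diff_self)
qed

lemma psi_code: "x \<in> G \<Longrightarrow> i < M n \<Longrightarrow> \<psi> i x = chr i (code n x)"
  by (intro psi_cong dig_code[symmetric])

text \<open>
  The product of characters is constant on the squares of level \<open>n\<close>, and the integral of \<open>f k\<close> over such
  a square is the same for all \<open>k \<ge> n\<close>. So the sequence that defines the coefficient is constant from \<open>n\<close>
  on.
\<close>

lemma vil_coeff_eq:
  assumes f: "complex_martingale \<mu>2 (vil_F m) f" and ij: "i < M n" "j < M n"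
  shows "vil_coeff m f i j
    = (\<Sum>u<M n. \<Sum>v<M n. disc f n u v * cnj (chr i u) * cnj (chr j v)) / (of_nat (M n))\<^sup>2"
proof -
  let ?\<phi> = "\<lambda>k z. f k z * cnj (\<psi> i (fst z)) * cnj (\<psi> j (snd z))"
  let ?c = "\<lambda>a b. cnj (chr i a) * cnj (chr j b)"
  have int: "integrable \<mu>2 (f k)" for k using f by (simp add: complex_martingale_def)
  have split: "(\<integral>z. ?\<phi> k z \<partial>\<mu>2)
      = (\<Sum>a<M n. \<Sum>b<M n. ?c a b * (\<integral>z. indicator (square n a b) z *\<^sub>R f k z \<partial>\<mu>2))" for k
  proof -
    have "(\<integral>z. ?\<phi> k z \<partial>\<mu>2)
        = (\<integral>z. (\<Sum>a<M n. \<Sum>b<M n. ?c a b * (indicator (square n a b) z *\<^sub>R f k z)) \<partial>\<mu>2)"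
    proof (rule Bochner_Integration.integral_cong[OF refl])
      fix z assume "z \<in> space \<mu>2"
      then have z: "z \<in> G \<times> G" by (simp add: space_\<mu>2)
      have "(\<Sum>a<M n. \<Sum>b<M n. ?c a b * (indicator (square n a b) z *\<^sub>R f k z))
          = (\<Sum>a<M n. \<Sum>b<M n. if z \<in> square n a b then ?c a b * f k z else 0)"
        by (intro sum.cong refl) (simp add: indicator_def)
      also have "\<dots> = ?\<phi> k z"
        using z ij psi_code[of "fst z" i n] psi_code[of "snd z" j n]
        by (subst sum_over_squares[OF z]) (simp add: mem_Times_iff)
      finally show "?\<phi> k z = (\<Sum>a<M n. \<Sum>b<M n. ?c a b * (indicator (square n a b) z *\<^sub>R f k z))" by simp
    qed
    also have "\<dots> = (\<Sum>a<M n. \<Sum>b<M n. ?c a b * (\<integral>z. indicator (square n a b) z *\<^sub>R f k z \<partial>\<mu>2))"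
      using int[of k]
      by (subst Bochner_Integration.integral_sum Bochner_Integration.integral_sum integral_mult_right_zero
          | intro Bochner_Integration.integrable_sum integrable_mult_right integrable_mult_indicator square_sets
            sum.cong refl | assumption)+
    finally show ?thesis .
  qed
  have "(\<integral>z. ?\<phi> k z \<partial>\<mu>2) = (\<integral>z. ?\<phi> n z \<partial>\<mu>2)" if "n \<le> k" for k
    unfolding split using martingale_integral_eq[OF f that square_in_F] by simp
  then have "\<forall>\<^sub>F k in sequentially. (\<integral>z. ?\<phi> k z \<partial>\<mu>2) = (\<integral>z. ?\<phi> n z \<partial>\<mu>2)"
    unfolding eventually_sequentially by blast
  then have "vil_coeff m f i j = (\<integral>z. ?\<phi> n z \<partial>\<mu>2)"
    unfolding vil_coeff_def by (intro limI) (rule tendsto_eventually)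
  also have "\<dots> = (\<Sum>u<M n. \<Sum>v<M n. disc f n u v * cnj (chr i u) * cnj (chr j v)) / (of_nat (M n))\<^sup>2"
  proof (rule integral_level(2))
    fix z assume z: "z \<in> G \<times> G"
    then have "fst z \<in> G" "snd z \<in> G" by auto
    note psi_code[OF this(1) ij(1)] psi_code[OF this(2) ij(2)] martingale_eq_disc[OF f z order_refl]
    then show "?\<phi> n z = disc f n (code n (fst z)) (code n (snd z))
        * cnj (chr i (code n (fst z))) * cnj (chr j (code n (snd z)))"
      by (metis (no_types))
  qed
  finally show ?thesis .
qed

lemma vil_S_level:
  assumes "z \<in> G \<times> G" "k \<le> M n" "l \<le> M n"
  shows "vil_S m f k l z = vil_S m f k l (dig (code n (fst z)), dig (code n (snd z)))"
  unfolding vil_S_def using assms psi_code[of "fst z" _ n] psi_code[of "snd z" _ n]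
  by (intro sum.cong refl) (simp add: mem_Times_iff)

lemma vil_S_eq_proj2:
  assumes f: "complex_martingale \<mu>2 (vil_F m) f" and kl: "k \<le> M n" "l \<le> M n"
  shows "vil_S m f k l (dig x, dig y) = proj2 n k l (disc f n) x y"
proof -
  have "proj2 n k l (disc f n) x y
      = (\<Sum>i<k. \<Sum>j<l. (\<Sum>u<M n. \<Sum>v<M n. disc f n u v * cnj (chr i u) * cnj (chr j v)) / (of_nat (M n))\<^sup>2 * chr i x * chr j y)"
    (is "_ = (\<Sum>i<k. ?R i)")
    unfolding proj2_def proj_expand
  proof (rule sum.cong[OF refl])
    fix i
    let ?d = "\<lambda>u j. (\<Sum>v<M n. disc f n u v * cnj (chr j v)) / of_nat (M n)"
    have "(\<Sum>u<M n. (\<Sum>j<l. ?d u j * chr j y) * cnj (chr i u)) / of_nat (M n) * chr i x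
        = (\<Sum>u<M n. \<Sum>j<l. ?d u j * chr j y * cnj (chr i u) / of_nat (M n) * chr i x)"
      by (simp only: sum_distrib_right sum_divide_distrib)
    also have "\<dots> = (\<Sum>j<l. \<Sum>u<M n. ?d u j * chr j y * cnj (chr i u) / of_nat (M n) * chr i x)"
      by (rule sum.swap)
    also have "\<dots> = (\<Sum>j<l. \<Sum>u<M n. (\<Sum>v<M n. disc f n u v * cnj (chr i u) * cnj (chr j v))
        / (of_nat (M n))\<^sup>2 * chr i x * chr j y)"
    proof (intro sum.cong refl)
      fix j u
      have "(\<Sum>v<M n. disc f n u v * cnj (chr i u) * cnj (chr j v))
          = (\<Sum>v<M n. disc f n u v * cnj (chr j v)) * cnj (chr i u)"
        by (simp add: sum_distrib_left mult_ac)
      then show "?d u j * chr j y * cnj (chr i u) / of_nat (M n) * chr i x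
          = (\<Sum>v<M n. disc f n u v * cnj (chr i u) * cnj (chr j v)) / (of_nat (M n))\<^sup>2 * chr i x * chr j y"
        by (simp add: power2_eq_square)
    qed
    also have "\<dots> = ?R i"
      by (simp only: sum_distrib_right sum_divide_distrib)
    finally show "(\<Sum>u<M n. (\<Sum>j<l. ?d u j * chr j y) * cnj (chr i u)) / of_nat (M n) * chr i x = ?R i" .
  qed
  also have "\<dots> = vil_S m f k l (dig x, dig y)"
    unfolding vil_S_def using kl vil_coeff_eq[OF f, of _ n] by (intro sum.cong refl) simp
  finally show ?thesis by simp
qed

end

lemma epowr_Lp_norm:
  assumes "0 < p"
  shows "epowr (Lp_norm N p g) p = (\<integral>\<^sup>+ x. epowr (g x) p \<partial>N)"
proof -
  have "epowr (epowr X (1 / p)) p = X" for X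
  proof (cases X)
    case (real r)
    then show ?thesis using assms by (simp add: epowr_def powr_powr)
  qed (use assms in \<open>simp add: epowr_def\<close>)
  then show ?thesis by (simp add: Lp_norm_def)
qed

lemma epowr_mono:
  assumes "0 < p" "a \<le> b"
  shows "epowr a p \<le> epowr b p"
  using assms unfolding epowr_def
  by (auto simp: top.extremum_unique less_top[symmetric] intro!: ennreal_leI powr_mono2 enn2real_mono)

context vilenkin_p begin

lemma epowr_ennreal: "0 \<le> r \<Longrightarrow> epowr (ennreal r) p = ennreal (r powr p)"
  by (simp add: epowr_def)

lemma Lp_norm_vil_S:
  assumes f: "complex_martingale \<mu>2 (vil_F m) f" and kl: "k \<le> M n" "l \<le> M n"
  shows "epowr (Lp_norm \<mu>2 p (\<lambda>z. ennreal (cmod (vil_S m f k l z)))) p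
    = ennreal (Lp_sum n (proj2 n k l (disc f n)) / (real (M n))\<^sup>2)"
  unfolding epowr_Lp_norm[OF p_pos] Lp_sum_def
proof (rule nn_integral_level)
  fix z assume z: "z \<in> G \<times> G"
  have "vil_S m f k l z = proj2 n k l (disc f n) (code n (fst z)) (code n (snd z))"
    using vil_S_level[OF z kl] vil_S_eq_proj2[OF f kl] by (rule trans)
  then show "epowr (ennreal (cmod (vil_S m f k l z))) p
      = ennreal (cmod (proj2 n k l (disc f n) (code n (fst z)) (code n (snd z))) powr p)"
    by (simp add: epowr_ennreal)
qed simp

lemma finite_martingale_disc:
  assumes f: "complex_martingale \<mu>2 (vil_F m) f"
  shows "finite_martingale m B p n (disc f)"
proof unfold_locales
  fix i u u' v v' assume "i \<le> n" "u mod M i = u' mod M i" "v mod M i = v' mod M i"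
  then show "disc f i u v = disc f i u' v'"
    unfolding disc_def using f
    by (intro vil_F_measurable_cong[where n = i]) (auto simp: complex_martingale_def code_dig)
qed (rule disc_mean[OF f])

text \<open>
  A finite part of the sum involves only orders up to some \<open>M n\<close>, and up to time \<open>n\<close> the maximal
  function is at most the full one. The constant is increased by \<open>1\<close> to make it positive.
\<close>

proposition strong_sum_le_H_norm:
  assumes f: "f \<in> H_square m p" and \<alpha>: "0 \<le> \<alpha>"
  shows "(\<Sum>\<^sub>\<infinity>(k, l)\<in>ratio_cone \<alpha>.
            epowr (Lp_norm \<mu>2 p (\<lambda>z. ennreal (cmod (vil_S m f k l z)))) p
            / ennreal ((real k * real l) powr (2 - p)))
        \<le> ennreal (decomp_const \<alpha> + 1) * epowr (H_norm m p f) p"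
proof (rule infsum_le_finite_sums)
  have mart: "complex_martingale \<mu>2 (vil_F m) f" using f by (simp add: H_square_def)
  fix J assume J: "finite J" "J \<subseteq> ratio_cone \<alpha>"
  define n where "n = (\<Sum>(k, l)\<in>J. k + l)"
  have n: "k \<le> M n \<and> l \<le> M n" if "(k, l) \<in> J" for k l
  proof -
    have "k + l \<le> n"
      unfolding n_def using that J(1) member_le_sum[of "(k, l)" J "\<lambda>(k, l). k + l"] by auto
    then show ?thesis using less_M[of n] by linarith
  qed
  interpret finite_martingale m B p n "disc f" by (rule finite_martingale_disc[OF mart])
  let ?X = "\<Sum>u<M n. \<Sum>v<M n. maxF u v powr p"
  have H: "ennreal (?X / (real (M n))\<^sup>2) \<le> epowr (H_norm m p f) p"
  proof -
    have "ennreal (?X / (real (M n))\<^sup>2)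
        = (\<integral>\<^sup>+z. ennreal (maxF (code n (fst z)) (code n (snd z)) powr p) \<partial>\<mu>2)"
      by (intro nn_integral_level[symmetric]) auto
    also have "\<dots> \<le> (\<integral>\<^sup>+z. epowr (maximal_fun f z) p \<partial>\<mu>2)"
    proof (rule nn_integral_mono)
      fix z assume "z \<in> space \<mu>2"
      then have z: "z \<in> G \<times> G" by (simp add: space_\<mu>2)
      let ?m = "maxF (code n (fst z)) (code n (snd z))"
      have "?m \<in> (\<lambda>i. cmod (disc f i (code n (fst z)) (code n (snd z)))) ` {..n}"
        unfolding maxF_def by (intro Max_in) auto
      then obtain i where "i \<le> n" "?m = cmod (f i z)"
        using martingale_eq_disc[OF mart z] by auto
      then have "ennreal ?m \<le> maximal_fun f z"
        unfolding maximal_fun_def by (auto intro: SUP_upper)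
      from epowr_mono[OF p_pos this] show "ennreal (?m powr p) \<le> epowr (maximal_fun f z) p"
        by (simp add: epowr_ennreal maxF_nonneg)
    qed
    finally show ?thesis unfolding H_norm_def epowr_Lp_norm[OF p_pos] .
  qed
  have "(\<Sum>(k, l)\<in>J. epowr (Lp_norm \<mu>2 p (\<lambda>z. ennreal (cmod (vil_S m f k l z)))) p
            / ennreal ((real k * real l) powr (2 - p)))
      = (\<Sum>(k, l)\<in>J. ennreal (Lp_sum n (proj2 n k l (disc f n)) * (real k * real l) powr (p - 2) / (real (M n))\<^sup>2))"
  proof (intro sum.cong refl, clarify)
    fix k l assume kl: "(k, l) \<in> J"
    then have "k \<noteq> 0" "l \<noteq> 0" using J(2) by (auto simp: ratio_cone_def)
    then show "epowr (Lp_norm \<mu>2 p (\<lambda>z. ennreal (cmod (vil_S m f k l z)))) p / ennreal ((real k * real l) powr (2 - p))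
        = ennreal (Lp_sum n (proj2 n k l (disc f n)) * (real k * real l) powr (p - 2) / (real (M n))\<^sup>2)"
      using n[OF kl] Lp_sum_nonneg[of n "proj2 n k l (disc f n)"]
        powr_minus_divide[of "real k * real l" "2 - p"]
      by (subst Lp_norm_vil_S[OF mart, of k n l]) (simp_all add: divide_ennreal)
  qed
  also have "\<dots> = ennreal (strong_sum n J (disc f n) / (real (M n))\<^sup>2)"
    unfolding strong_sum_def sum_divide_distrib case_prod_unfold
    by (intro sum_ennreal divide_nonneg_nonneg mult_nonneg_nonneg Lp_sum_nonneg) auto
  also have "\<dots> \<le> ennreal ((decomp_const \<alpha> + 1) * (?X / (real (M n))\<^sup>2))"
  proof (rule ennreal_leI)
    have "0 \<le> ?X" by (intro sum_nonneg) auto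
    then have "strong_sum n J (disc f n) \<le> (decomp_const \<alpha> + 1) * ?X"
      using strong_sum_le_maxF[OF J n \<alpha>] by (simp add: algebra_simps)
    then show "strong_sum n J (disc f n) / (real (M n))\<^sup>2 \<le> (decomp_const \<alpha> + 1) * (?X / (real (M n))\<^sup>2)"
      using divide_right_mono[of _ _ "(real (M n))\<^sup>2"] by simp
  qed
  also have "\<dots> = ennreal (decomp_const \<alpha> + 1) * ennreal (?X / (real (M n))\<^sup>2)"
    using decomp_const_nonneg[of \<alpha>] by (intro ennreal_mult) (auto intro!: sum_nonneg divide_nonneg_nonneg)
  also have "\<dots> \<le> ennreal (decomp_const \<alpha> + 1) * epowr (H_norm m p f) p"
    by (intro mult_left_mono H) simp
  finally show "(\<Sum>(k, l)\<in>J. epowr (Lp_norm \<mu>2 p (\<lambda>z. ennreal (cmod (vil_S m f k l z)))) p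
            / ennreal ((real k * real l) powr (2 - p)))
      \<le> ennreal (decomp_const \<alpha> + 1) * epowr (H_norm m p f) p" .
qed (rule nonneg_summable_on_complete, simp)

end

section \<open>A lacunary martingale\<close>

text \<open>
  The supremum may be infinite, so the bound is first passed through the \<open>p\<close>-th root.
\<close>

lemma epowr_SUP_le:
  assumes p: "0 < p" and a: "\<And>n. 0 \<le> a n" and le: "\<And>n. ennreal (a n powr p) \<le> s"
  shows "epowr (SUP n. ennreal (a n)) p \<le> s"
proof (cases s)
  case (real r)
  have "a n \<le> r powr (1 / p)" for n
  proof -
    have "a n powr p \<le> r" using le[of n] real by simp
    then have "(a n powr p) powr (1 / p) \<le> r powr (1 / p)" using p by (intro powr_mono2) auto
    then show ?thesis using p a[of n] by (simp add: powr_powr)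
  qed
  then have "(SUP n. ennreal (a n)) \<le> ennreal (r powr (1 / p))"
    by (intro SUP_least ennreal_leI)
  then have "epowr (SUP n. ennreal (a n)) p \<le> epowr (ennreal (r powr (1 / p))) p"
    by (rule epowr_mono[OF p])
  also have "\<dots> = s" using p real by (simp add: epowr_def powr_powr)
  finally show ?thesis .
qed simp

lemma sum_le_infsum_ennreal:
  fixes f :: "'a \<Rightarrow> ennreal"
  assumes "finite J" "J \<subseteq> A"
  shows "sum f J \<le> infsum f A"
proof -
  have "infsum f A = (SUP J\<in>{J. finite J \<and> J \<subseteq> A}. sum f J)" by (rule nonneg_infsum_complete) simp
  then show ?thesis using assms by (auto intro: SUP_upper)
qed

context vilenkin begin

lemma complex_martingaleI:
  assumes meas: "\<And>n. f n \<in> borel_measurable (vil_F m n)" and int: "\<And>n. integrable \<mu>2 (f n)"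
    and eq: "\<And>i k A. i \<le> k \<Longrightarrow> A \<in> sets (vil_F m i) \<Longrightarrow>
      (\<integral>z. indicator A z *\<^sub>R f k z \<partial>\<mu>2) = (\<integral>z. indicator A z *\<^sub>R f i z \<partial>\<mu>2)"
  shows "complex_martingale \<mu>2 (vil_F m) f"
  unfolding complex_martingale_def
proof (intro conjI allI impI meas int)
  fix i k :: nat assume ik: "i \<le> k"
  interpret sigma_finite_subalgebra \<mu>2 "vil_F m i" by (rule sigma_finite_vil_F)
  have [measurable]: "f i \<in> borel_measurable (vil_F m i)" by (rule meas)
  have int': "integrable \<mu>2 (\<lambda>z. indicator A z *\<^sub>R f j z)" if "A \<in> sets (vil_F m i)" for j A
    using that int vil_F_subalgebra[of m i] by (intro integrable_mult_indicator) (auto simp: subalgebra_def)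
  have "AE x in \<mu>2. real_cond_exp \<mu>2 (vil_F m i) (\<lambda>z. Re (f k z)) x = Re (f i x)"
  proof (rule real_cond_exp_charact)
    fix A assume A: "A \<in> sets (vil_F m i)"
    have "(\<integral>z. Re (indicator A z *\<^sub>R f k z) \<partial>\<mu>2) = (\<integral>z. Re (indicator A z *\<^sub>R f i z) \<partial>\<mu>2)"
      unfolding integral_Re[OF int'[OF A]] eq[OF ik A] ..
    then show "(\<integral>z\<in>A. Re (f k z) \<partial>\<mu>2) = (\<integral>z\<in>A. Re (f i z) \<partial>\<mu>2)"
      by (simp add: set_lebesgue_integral_def)
  qed (use int in auto)
  moreover have "AE x in \<mu>2. real_cond_exp \<mu>2 (vil_F m i) (\<lambda>z. Im (f k z)) x = Im (f i x)"
  proof (rule real_cond_exp_charact)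
    fix A assume A: "A \<in> sets (vil_F m i)"
    have "(\<integral>z. Im (indicator A z *\<^sub>R f k z) \<partial>\<mu>2) = (\<integral>z. Im (indicator A z *\<^sub>R f i z) \<partial>\<mu>2)"
      unfolding integral_Im[OF int'[OF A]] eq[OF ik A] ..
    then show "(\<integral>z\<in>A. Im (f k z) \<partial>\<mu>2) = (\<integral>z\<in>A. Im (f i z) \<partial>\<mu>2)"
      by (simp add: set_lebesgue_integral_def)
  qed (use int in auto)
  ultimately show "AE x in \<mu>2. complex_cond_exp \<mu>2 (vil_F m i) (f k) x = f i x"
    by eventually_elim (simp add: complex_cond_exp_def complex_eq_iff)
qed

text \<open>
  Up to a unimodular factor this is the kernel of order \<open>M N\<close>: it is supported on a single cell of
  level \<open>N\<close> and has mean zero there.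
\<close>

definition block :: "nat \<Rightarrow> (nat \<Rightarrow> nat) \<Rightarrow> complex" where
  "block N x = (\<Sum>i<M N. \<psi> (M N + i) x)"

lemma block_index_less: "N < n \<Longrightarrow> i < M N \<Longrightarrow> M N + i < M n"
proof -
  assume "N < n" "i < M N"
  moreover have "2 * M N \<le> M (Suc N)" using m_ge2[of N] by (simp add: vil_M_Suc)
  ultimately show ?thesis using M_mono[of "Suc N" n] by linarith
qed

lemma psi_at_0: "\<psi> i (\<lambda>_. 0) = 1"
  by (simp add: psi_prod[OF less_M] vil_r_def)

lemma sum_psi: "(\<Sum>i<k. \<psi> i x) = ker k x (\<lambda>_. 0)"
  by (simp add: ker_def psi_at_0)

lemma psi_M_add: "i < M N \<Longrightarrow> \<psi> (M N + i) x = vil_r m N x * \<psi> i x"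
  using psi_block[of i N 1 x] psi_mult_M[of 1 N x] m_ge2[of N] by simp

lemma block_eq: "x \<in> G \<Longrightarrow> block N x = vil_r m N x * (if \<forall>k<N. x k = 0 then of_nat (M N) else 0)"
  unfolding block_def by (simp add: psi_M_add sum_psi mem_G_iff ker_M flip: sum_distrib_left)

lemma norm_block: "x \<in> G \<Longrightarrow> cmod (block N x) = (if \<forall>k<N. x k = 0 then real (M N) else 0)"
  by (simp add: block_eq norm_mult)

lemma block_code: "x \<in> G \<Longrightarrow> N < n \<Longrightarrow> block N x = block N (dig (code n x))"
  unfolding block_def by (intro sum.cong refl psi_code block_index_less) auto

lemma proj_block:
  assumes "N < n" "k \<le> M n"
  shows "proj n k (\<lambda>u. block N (dig u)) x = (\<Sum>i\<in>{M N..<min k (2 * M N)}. chr i x)"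
proof -
  have "(\<Sum>u<M n. block N (dig u) * cnj (chr i u)) / of_nat (M n) = (if i \<in> {M N..<2 * M N} then 1 else 0)"
    if "i < k" for i
  proof -
    have "(\<Sum>u<M n. block N (dig u) * cnj (chr i u)) = (\<Sum>j<M N. \<Sum>u<M n. chr (M N + j) u * cnj (chr i u))"
      unfolding block_def sum_distrib_right by (rule sum.swap)
    also have "\<dots> = (\<Sum>j<M N. if M N + j = i then of_nat (M n) else 0)"
      using assms that by (intro sum.cong refl chr_orthogonal block_index_less) auto
    also have "\<dots> = (\<Sum>j<M N. if j = i - M N then (if M N \<le> i then of_nat (M n) else 0) else 0)"
      by (intro sum.cong refl) auto
    also have "\<dots> = (if i \<in> {M N..<2 * M N} then of_nat (M n) else 0)"
      by auto
    finally show ?thesis by simp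
  qed
  then have "proj n k (\<lambda>u. block N (dig u)) x = (\<Sum>i<k. if i \<in> {M N..<2 * M N} then chr i x else 0)"
    unfolding proj_expand by (intro sum.cong refl) simp
  also have "\<dots> = (\<Sum>i\<in>{M N..<min k (2 * M N)}. chr i x)"
    by (intro sum.mono_neutral_cong_right) auto
  finally show ?thesis .
qed

text \<open>
  The block enters the partial sum completely, and it vanishes outside the cell of \<open>0\<close>.
\<close>

lemma proj_block_eq_0:
  assumes "0 < N" "N < n" "2 * M N \<le> k" "k \<le> M n" "dig x 0 \<noteq> 0"
  shows "proj n k (\<lambda>u. block N (dig u)) x = 0"
proof -
  have "{M N..<min k (2 * M N)} = {M N..<M N + M N}" using assms(3) by auto
  then have "proj n k (\<lambda>u. block N (dig u)) x = (\<Sum>i\<in>{M N..<M N + M N}. chr i x)"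
    by (simp only: proj_block[OF assms(2,4)])
  also have "\<dots> = block N (dig x)"
    unfolding block_def by (simp add: sum.atLeastLessThan_shift_0 atLeast0LessThan add.commute)
  also have "\<dots> = 0" using assms by (auto simp: block_eq)
  finally show ?thesis .
qed

text \<open>
  If \<open>x\<close> has a nonzero first coordinate, then the terms of the kernel cancel in groups of \<open>m 0\<close>;
  for these orders exactly one term survives.
\<close>

lemma norm_proj_block:
  assumes "N < n" "q * M 1 < M N" "dig x 0 \<noteq> 0"
  shows "cmod (proj n (M N + Suc (q * M 1)) (\<lambda>u. block N (dig u)) x) = 1"
proof -
  let ?k = "M N + Suc (q * M 1)"
  have k: "?k \<le> M n" using block_index_less[OF assms(1,2)] by simp
  have "{M N..<min ?k (2 * M N)} = {M N..<M N + Suc (q * M 1)}" using assms(2) by auto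
  then have "proj n ?k (\<lambda>u. block N (dig u)) x = (\<Sum>i<Suc (q * M 1). \<psi> (M N + i) (dig x))"
    unfolding proj_block[OF assms(1) k]
    by (simp add: sum.atLeastLessThan_shift_0 atLeast0LessThan add.commute del: sum.lessThan_Suc)
  also have "\<dots> = vil_r m N (dig x) * (\<Sum>i<Suc (q * M 1). \<psi> i (dig x))"
    using assms(2) by (simp add: psi_M_add sum_distrib_left less_Suc_eq_le del: sum.lessThan_Suc)
  also have "(\<Sum>i<Suc (q * M 1). \<psi> i (dig x)) = ker (q * M 1) (dig x) (\<lambda>_. 0) + chr (q * M 1) x"
    by (simp only: sum_psi[symmetric] sum.lessThan_Suc)
  also have "ker (q * M 1) (dig x) (\<lambda>_. 0) = 0"
  proof -
    have "ker (M 1) (dig x) (\<lambda>_. 0) = 0"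
      by (subst ker_M) (use assms(3) in \<open>auto simp: dig_less\<close>)
    then show ?thesis by (simp only: ker_mult_M mult_zero_right)
  qed
  finally show ?thesis by (simp add: norm_mult)
qed

text \<open>
  A function of the first \<open>N\<close> coordinates is a combination of characters of order less than \<open>M N\<close>, and
  these are orthogonal to the block.
\<close>

lemma sum_level_times_block:
  assumes "N < n" and g: "\<And>a b. a mod M N = b mod M N \<Longrightarrow> g a = g b"
  shows "(\<Sum>a<M n. g a * block N (dig a)) = 0"
proof -
  let ?h = "\<lambda>a. cnj (g a)"
  have h: "?h a = proj n (M N) ?h a" if "a < M n" for a
  proof -
    have N: "N \<le> n" using assms by simp
    have "(\<Sum>u<M n. ?h u * ker (M N) (dig a) (dig u))
        = (\<Sum>u\<in>{u. u < M n \<and> u mod M N = a mod M N}. ?h a * of_nat (M N))"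
      by (intro sum.mono_neutral_cong_right) (auto simp: ker_M_dig intro: g split: if_splits)
    also have "\<dots> = of_real (real (card {u. u < M n \<and> u mod M N = a mod M N}) * real (M N)) * ?h a"
      by simp
    also have "\<dots> = of_nat (M n) * ?h a"
      unfolding card_residues[OF N] by simp
    finally show ?thesis by (simp add: proj_def)
  qed
  define c where "c i = (\<Sum>u<M n. ?h u * cnj (chr i u)) / of_nat (M n)" for i
  have ga: "g a = (\<Sum>i<M N. cnj (c i) * cnj (chr i a))" if "a < M n" for a
    using arg_cong[OF h[OF that], of cnj] by (simp add: proj_expand c_def)
  have "(\<Sum>a<M n. g a * block N (dig a))
      = (\<Sum>a<M n. \<Sum>i<M N. \<Sum>j<M N. cnj (c i) * (cnj (chr i a) * chr (M N + j) a))"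
    by (intro sum.cong refl) (simp add: ga block_def sum_product mult.assoc)
  also have "\<dots> = (\<Sum>i<M N. \<Sum>j<M N. cnj (c i) * (\<Sum>a<M n. cnj (chr i a) * chr (M N + j) a))"
    by (simp only: sum.swap[of _ _ "{..<M n}"] sum_distrib_left)
  also have "\<dots> = 0"
    using assms(1) block_index_less[OF assms(1)] M_mono[of N n]
    by (intro sum.neutral ballI) (simp add: chr_orthogonal mult.commute[of "cnj _"])
  finally show ?thesis .
qed

lemma sum2_level_times_blocks:
  assumes N: "N < n" and g: "\<And>a a' b. a mod M N = a' mod M N \<Longrightarrow> g a b = g a' b"
  shows "(\<Sum>a<M n. \<Sum>b<M n. g a b * (block N (dig a) * block N (dig b))) = 0"
proof -
  have zero: "(\<Sum>a<M n. g a b * block N (dig a)) = 0" for b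
    by (rule sum_level_times_block[OF N]) (rule g)
  have "(\<Sum>a<M n. \<Sum>b<M n. g a b * (block N (dig a) * block N (dig b)))
      = (\<Sum>b<M n. \<Sum>a<M n. g a b * (block N (dig a) * block N (dig b)))"
    by (rule sum.swap)
  also have "\<dots> = (\<Sum>b<M n. (\<Sum>a<M n. g a b * block N (dig a)) * block N (dig b))"
    by (simp only: sum_distrib_right mult.assoc)
  also have "\<dots> = 0" by (simp only: zero mult_zero_left sum.neutral_const)
  finally show ?thesis .
qed

lemma proj_cmult: "proj n k (\<lambda>u. a * g u) x = a * proj n k g x"
  unfolding proj_def by (simp only: mult.assoc sum_distrib_left[symmetric] times_divide_eq_right)

lemma proj2_tensor: "proj2 n k l (\<lambda>u v. \<gamma> * g u * h v) x y = \<gamma> * proj n k g x * proj n l h y"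
proof -
  have "(\<lambda>u. \<gamma> * g u * proj n l h y) = (\<lambda>u. (\<gamma> * proj n l h y) * g u)"
    by (simp add: fun_eq_iff mult_ac)
  then show ?thesis unfolding proj2_def proj_cmult by (simp only: proj_cmult) (simp add: mult_ac)
qed

end

text \<open>
  A martingale whose Fourier coefficients are \<open>c j\<close> for both indices in \<open>{M (N j)..<2 * M (N j)}\<close>, and
  zero elsewhere.
\<close>

locale lacunary = vilenkin_p +
  fixes N :: "nat \<Rightarrow> nat" and c :: "nat \<Rightarrow> real"
  assumes N_mono: "strict_mono N" and N_pos: "0 < N j" and c_pos: "0 < c j"
begin

definition lac :: "nat \<Rightarrow> (nat \<Rightarrow> nat) \<times> (nat \<Rightarrow> nat) \<Rightarrow> complex" where
  "lac n z = (\<Sum>j | N j < n. of_real (c j) * block (N j) (fst z) * block (N j) (snd z))"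

lemma finite_N_less [simp]: "finite {j. N j < n}"
  by (rule finite_subset[of _ "{..<n}"])
    (use strict_mono_imp_increasing[OF N_mono] in \<open>auto intro: le_less_trans\<close>)

lemma N_less_Suc: "{j. N j < Suc (N i)} = {..i}"
  using N_mono by (auto simp: less_Suc_eq_le strict_mono_less_eq)

lemma lac_level:
  assumes "z \<in> G \<times> G" "i \<le> n"
  shows "lac i z = lac i (dig (code n (fst z)), dig (code n (snd z)))"
proof -
  have "block (N j) (fst z) = block (N j) (dig (code n (fst z)))"
    "block (N j) (snd z) = block (N j) (dig (code n (snd z)))" if "N j < i" for j
    using assms that by (auto intro!: block_code)
  then show ?thesis unfolding lac_def by (intro sum.cong refl) simp
qed

text \<open>
  A member of the lacunary series differs from an earlier one, at time \<open>i\<close>, by blocks that start at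
  level \<open>i\<close> or later; these integrate to zero over every set that is decided by the first \<open>i\<close>
  coordinates.
\<close>

lemma lac_martingale: "complex_martingale \<mu>2 (vil_F m) lac"
proof (rule complex_martingaleI)
  fix n
  show "lac n \<in> borel_measurable (vil_F m n)"
    by (rule measurable_vil_FI) (rule lac_level[OF _ order_refl])
  show "integrable \<mu>2 (lac n)"
    by (rule integral_level(1)) (rule lac_level[OF _ order_refl])
next
  fix i k A assume ik: "i \<le> k" and A: "A \<in> sets (vil_F m i)"
  let ?I = "\<lambda>a b. indicator A (dig a, dig b) :: real"
  have ind: "indicator A z = (indicator A (dig (code k (fst z)), dig (code k (snd z))) :: real)"
    if "z \<in> G \<times> G" for z
    using mem_vil_F_cong[OF A that, of "(dig (code k (fst z)), dig (code k (snd z)))"] that ik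
    by (auto simp: indicator_def code_dig_code)
  have int: "(\<integral>z. indicator A z *\<^sub>R lac j z \<partial>\<mu>2)
      = (\<Sum>a<M k. \<Sum>b<M k. ?I a b *\<^sub>R lac j (dig a, dig b)) / (of_nat (M k))\<^sup>2" if "j \<le> k" for j
  proof (rule integral_level(2))
    fix z assume z: "z \<in> G \<times> G"
    show "indicator A z *\<^sub>R lac j z = ?I (code k (fst z)) (code k (snd z)) *\<^sub>R
        lac j (dig (code k (fst z)), dig (code k (snd z)))"
      unfolding ind[OF z] lac_level[OF z that, symmetric] ..
  qed
  have diff: "lac k z - lac i z = (\<Sum>j | N j < k \<and> i \<le> N j. of_real (c j) * block (N j) (fst z) * block (N j) (snd z))" for z
  proof -
    have eq: "{j. N j < k \<and> i \<le> N j} = {j. N j < k} - {j. N j < i}" by auto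
    have sub: "{j. N j < i} \<subseteq> {j. N j < k}" using ik by auto
    show ?thesis unfolding lac_def eq by (rule sum_diff[OF finite_N_less sub, symmetric])
  qed
  have "(\<Sum>a<M k. \<Sum>b<M k. ?I a b *\<^sub>R lac k (dig a, dig b)) - (\<Sum>a<M k. \<Sum>b<M k. ?I a b *\<^sub>R lac i (dig a, dig b))
      = (\<Sum>a<M k. \<Sum>b<M k. ?I a b *\<^sub>R (lac k (dig a, dig b) - lac i (dig a, dig b)))"
    by (simp only: sum_subtractf scaleR_diff_right)
  also have "\<dots> = (\<Sum>a<M k. \<Sum>b<M k. \<Sum>j | N j < k \<and> i \<le> N j.
      of_real (c j * ?I a b) * (block (N j) (dig a) * block (N j) (dig b)))"
    by (simp add: diff scaleR_conv_of_real sum_distrib_left mult_ac)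
  also have "\<dots> = (\<Sum>j | N j < k \<and> i \<le> N j. \<Sum>a<M k. \<Sum>b<M k.
      of_real (c j * ?I a b) * (block (N j) (dig a) * block (N j) (dig b)))"
    by (simp only: sum.swap[of _ _ "{j. N j < k \<and> i \<le> N j}"])
  also have "\<dots> = 0"
  proof (rule sum.neutral, rule ballI, rule sum2_level_times_blocks)
    fix j a a' b assume j: "j \<in> {j. N j < k \<and> i \<le> N j}" and "a mod M (N j) = a' mod M (N j)"
    then have "a mod M i = a' mod M i" using mod_M_eq_mono[of i "N j" a a'] by simp
    then have "(dig a, dig b) \<in> A \<longleftrightarrow> (dig a', dig b) \<in> A"
      by (intro mem_vil_F_cong[OF A]) (simp_all add: code_dig)
    then show "complex_of_real (c j * ?I a b) = complex_of_real (c j * ?I a' b)"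
      by (simp add: indicator_def)
  qed simp
  finally show "(\<integral>z. indicator A z *\<^sub>R lac k z \<partial>\<mu>2) = (\<integral>z. indicator A z *\<^sub>R lac i z \<partial>\<mu>2)"
    using int[OF order_refl] int[OF ik] by simp
qed

text \<open>
  By subadditivity of \<open>p\<close>-th powers, the \<open>p\<close>-th power of the maximal function is at most the sum of those
  of the individual blocks.
\<close>

lemma lac_in_H_square:
  assumes "summable (\<lambda>j. c j powr p * real (M (N j)) powr (2 * p - 2))"
  shows "lac \<in> H_square m p"
proof -
  let ?t = "\<lambda>j z. (c j * cmod (block (N j) (fst z)) * cmod (block (N j) (snd z))) powr p"
  have int: "(\<integral>\<^sup>+z. ennreal (?t j z) \<partial>\<mu>2) = ennreal (c j powr p * real (M (N j)) powr (2 * p - 2))" for j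
  proof -
    let ?n = "Suc (N j)"
    let ?K = "\<lambda>a. if a mod M (N j) = 0 then real (M (N j)) powr p else 0"
    have b: "cmod (block (N j) (dig a)) powr p = ?K a" for a
      using p_pos dig_mod_eq_iff[of a "N j" 0] by (simp add: norm_block vil_digit_def)
    have "(\<integral>\<^sup>+z. ennreal (?t j z) \<partial>\<mu>2) = ennreal ((\<Sum>a<M ?n. \<Sum>b<M ?n. c j powr p * (?K a * ?K b)) / (real (M ?n))\<^sup>2)"
    proof (rule nn_integral_level)
      fix z assume "z \<in> G \<times> G"
      then have z: "fst z \<in> G" "snd z \<in> G" by auto
      show "ennreal (?t j z) = ennreal (c j powr p * (?K (code ?n (fst z)) * ?K (code ?n (snd z))))"
        unfolding b[symmetric] block_code[OF z(1) lessI, symmetric] block_code[OF z(2) lessI, symmetric]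
        using c_pos[of j] by (simp add: powr_mult mult_ac)
    qed (use c_pos in simp)
    also have "(\<Sum>a<M ?n. \<Sum>b<M ?n. c j powr p * (?K a * ?K b)) = c j powr p * ((\<Sum>a<M ?n. ?K a) * (\<Sum>b<M ?n. ?K b))"
      unfolding sum_distrib_left[symmetric] sum_distrib_right[symmetric] ..
    also have "(\<Sum>a<M ?n. ?K a) = real (card {a. a < M ?n \<and> a mod M (N j) = 0 mod M (N j)}) * real (M (N j)) * real (M (N j)) powr (p - 1)"
    proof -
      have "(\<Sum>a<M ?n. ?K a) = (\<Sum>a\<in>{a. a < M ?n \<and> a mod M (N j) = 0 mod M (N j)}. real (M (N j)) powr p)"
        by (intro sum.mono_neutral_cong_right) (auto split: if_splits)
      then show ?thesis by (simp add: powr_diff)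
    qed
    also have "\<dots> = real (M ?n) * real (M (N j)) powr (p - 1)"
      by (subst card_residues) auto
    also have "c j powr p * (real (M ?n) * real (M (N j)) powr (p - 1) * (real (M ?n) * real (M (N j)) powr (p - 1))) / (real (M ?n))\<^sup>2
        = c j powr p * (real (M (N j)) powr (p - 1) * real (M (N j)) powr (p - 1))"
      by (simp add: power2_eq_square)
    also have "real (M (N j)) powr (p - 1) * real (M (N j)) powr (p - 1) = real (M (N j)) powr (2 * p - 2)"
      by (simp flip: powr_add)
    finally show ?thesis .
  qed
  have meas: "(\<lambda>z. ennreal (?t j z)) \<in> borel_measurable \<mu>2" for j
  proof -
    have *: "(\<lambda>z. block (N j) (fst z) * block (N j) (snd z)) \<in> borel_measurable \<mu>2"
    proof (rule borel_measurable_integrable, rule integral_level(1)[where n = "Suc (N j)"])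
      fix z assume "z \<in> G \<times> G"
      then have "fst z \<in> G" "snd z \<in> G" by auto
      then show "block (N j) (fst z) * block (N j) (snd z)
          = block (N j) (dig (code (Suc (N j)) (fst z))) * block (N j) (dig (code (Suc (N j)) (snd z)))"
        by (intro arg_cong2[of _ _ _ _ "(*)"] block_code) auto
    qed
    have "(\<lambda>z. ennreal ((c j * cmod (block (N j) (fst z) * block (N j) (snd z))) powr p)) \<in> borel_measurable \<mu>2"
      using * by measurable
    then show ?thesis by (simp add: norm_mult mult.assoc)
  qed
  have "epowr (H_norm m p lac) p = (\<integral>\<^sup>+z. epowr (maximal_fun lac z) p \<partial>\<mu>2)"
    unfolding H_norm_def by (rule epowr_Lp_norm[OF p_pos])
  also have "\<dots> \<le> (\<integral>\<^sup>+z. (\<Sum>j. ennreal (?t j z)) \<partial>\<mu>2)"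
  proof (rule nn_integral_mono)
    fix z
    show "epowr (maximal_fun lac z) p \<le> (\<Sum>j. ennreal (?t j z))"
      unfolding maximal_fun_def
    proof (rule epowr_SUP_le[OF p_pos])
      fix n
      have "cmod (lac n z) powr p \<le> (\<Sum>j | N j < n. ?t j z)"
        unfolding lac_def using norm_sum_powr_le[OF finite_N_less,
          of "\<lambda>j. of_real (c j) * block (N j) (fst z) * block (N j) (snd z)" n] c_pos
        by (simp add: norm_mult less_imp_le)
      then have "ennreal (cmod (lac n z) powr p) \<le> (\<Sum>j | N j < n. ennreal (?t j z))"
        by (simp add: ennreal_leI)
      also have "\<dots> \<le> (\<Sum>j. ennreal (?t j z))"
        by (rule sum_le_suminf) auto
      finally show "ennreal (cmod (lac n z) powr p) \<le> (\<Sum>j. ennreal (?t j z))" .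
    qed simp
  qed
  also have "\<dots> = (\<Sum>j. ennreal (c j powr p * real (M (N j)) powr (2 * p - 2)))"
    by (simp add: nn_integral_suminf[OF meas] int)
  also have "\<dots> < \<infinity>"
    using assms by (subst suminf_ennreal2) auto
  finally have "epowr (H_norm m p lac) p < \<infinity>" .
  then have "H_norm m p lac < \<infinity>"
    by (cases "H_norm m p lac = \<infinity>") (auto simp: epowr_def less_top)
  then show ?thesis using lac_martingale by (simp add: H_square_def)
qed

text \<open>
  Where both first coordinates are nonzero, all earlier blocks vanish and the modulus of the partial sum
  is \<open>c i\<close>. The first coordinates are both nonzero on a set of measure at least \<open>1 / 4\<close>.
\<close>

lemma Lp_norm_vil_S_lac_ge:
  assumes "s * M 1 < M (N i)" "t * M 1 < M (N i)"
  shows "ennreal (c i powr p / 4)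
    \<le> epowr (Lp_norm \<mu>2 p (\<lambda>z. ennreal (cmod (vil_S m lac (M (N i) + Suc (s * M 1)) (M (N i) + Suc (t * M 1)) z)))) p"
proof -
  let ?k = "M (N i) + Suc (s * M 1)" and ?l = "M (N i) + Suc (t * M 1)"
  let ?n = "Suc (N i)"
  let ?E = "{x. x < M ?n \<and> dig x 0 \<noteq> 0}"
  have kl: "?k \<le> M ?n" "?l \<le> M ?n"
    using block_index_less[of "N i" ?n] assms by (simp_all add: Suc_leI)
  have val: "cmod (proj2 ?n ?k ?l (disc lac ?n) x y) = c i" if xy: "x \<in> ?E" "y \<in> ?E" for x y
  proof -
    have "proj2 ?n ?k ?l (disc lac ?n) x y
        = (\<Sum>j\<le>i. proj2 ?n ?k ?l (\<lambda>u v. of_real (c j) * block (N j) (dig u) * block (N j) (dig v)) x y)"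
      unfolding disc_def lac_def N_less_Suc fst_conv snd_conv by (rule proj2_sum)
    also have "\<dots> = (\<Sum>j\<le>i. of_real (c j) * proj ?n ?k (\<lambda>u. block (N j) (dig u)) x * proj ?n ?l (\<lambda>u. block (N j) (dig u)) y)"
      unfolding proj2_tensor ..
    also have "\<dots> = (\<Sum>j\<in>{i}. of_real (c j) * proj ?n ?k (\<lambda>u. block (N j) (dig u)) x * proj ?n ?l (\<lambda>u. block (N j) (dig u)) y)"
    proof (rule sum.mono_neutral_right)
      show "\<forall>j\<in>{..i} - {i}. of_real (c j) * proj ?n ?k (\<lambda>u. block (N j) (dig u)) x * proj ?n ?l (\<lambda>u. block (N j) (dig u)) y = 0"
      proof
        fix j assume "j \<in> {..i} - {i}"
        then have "N j < N i" using N_mono by (simp add: strict_mono_less)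
        have "2 * M (N j) \<le> m (N j) * M (N j)"
          using m_ge2 by (intro mult_right_mono) auto
        also have "\<dots> = M (Suc (N j))" by (simp add: vil_M_Suc)
        also have "\<dots> \<le> M (N i)" using \<open>N j < N i\<close> by (intro M_mono) simp
        finally have "2 * M (N j) \<le> ?k" by simp
        then have "proj ?n ?k (\<lambda>u. block (N j) (dig u)) x = 0"
          using N_pos \<open>N j < N i\<close> kl xy by (intro proj_block_eq_0) auto
        then show "of_real (c j) * proj ?n ?k (\<lambda>u. block (N j) (dig u)) x * proj ?n ?l (\<lambda>u. block (N j) (dig u)) y = 0"
          by simp
      qed
    qed auto
    finally have "cmod (proj2 ?n ?k ?l (disc lac ?n) x y)
        = c i * cmod (proj ?n ?k (\<lambda>u. block (N i) (dig u)) x) * cmod (proj ?n ?l (\<lambda>u. block (N i) (dig u)) y)"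
      using c_pos[of i] by (simp add: norm_mult)
    then show ?thesis
      using norm_proj_block[OF lessI assms(1)] norm_proj_block[OF lessI assms(2)] xy by simp
  qed
  have card: "real (M ?n) \<le> 2 * real (card ?E)"
  proof -
    let ?Z = "{x. x < M ?n \<and> x mod M 1 = 0 mod M 1}"
    have "real (card ?Z) * real (m 0) = real (M ?n)"
      using card_residues[of 1 ?n 0] by (simp add: vil_M_Suc vil_M_0)
    moreover have "real (card ?Z) * 2 \<le> real (card ?Z) * real (m 0)"
      using m_ge2[of 0] by (intro mult_left_mono) auto
    moreover have "{..<M ?n} = ?Z \<union> ?E" "?Z \<inter> ?E = {}"
      using dig_mod_eq_iff[of _ 1 0] by (auto simp: vil_digit_def vil_M_0)
    then have "M ?n = card ?Z + card ?E"
      by (metis (no_types, lifting) card_Un_disjoint card_lessThan finite_Un finite_lessThan)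
    ultimately show ?thesis by linarith
  qed
  have "(real (M ?n))\<^sup>2 * c i powr p \<le> (2 * real (card ?E))\<^sup>2 * c i powr p"
    using card by (intro mult_right_mono power_mono) auto
  also have "\<dots> = 4 * (\<Sum>x\<in>?E. \<Sum>y\<in>?E. cmod (proj2 ?n ?k ?l (disc lac ?n) x y) powr p)"
    using val by (simp add: power2_eq_square)
  also have "(\<Sum>x\<in>?E. \<Sum>y\<in>?E. cmod (proj2 ?n ?k ?l (disc lac ?n) x y) powr p) \<le> Lp_sum ?n (proj2 ?n ?k ?l (disc lac ?n))"
    unfolding Lp_sum_def by (intro order_trans[OF sum_mono sum_mono2] sum_mono2 sum_nonneg) auto
  finally have "c i powr p / 4 \<le> Lp_sum ?n (proj2 ?n ?k ?l (disc lac ?n)) / (real (M ?n))\<^sup>2"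
    by (simp add: field_simps)
  then show ?thesis
    unfolding Lp_norm_vil_S[OF lac_martingale kl] by (rule ennreal_leI)
qed

end

context vilenkin_p begin

text \<open>
  By monotonicity \<open>\<Phi>\<close> exceeds \<open>4 ^ j\<close> from some point on. This beats the weight \<open>1 / 2 ^ j\<close> of the \<open>j\<close>-th
  block, so that each block alone contributes at least a fixed multiple of \<open>2 ^ j\<close>.
\<close>

proposition exists_lacunary_divergent:
  assumes \<alpha>: "0 < \<alpha>" and ge1: "\<And>i j. 1 \<le> \<Phi> i j"
    and mono: "\<And>i i' j j'. i \<le> i' \<Longrightarrow> j \<le> j' \<Longrightarrow> \<Phi> i j \<le> \<Phi> i' j'"
    and unbounded: "Limsup (sequentially \<times>\<^sub>F sequentially) (\<lambda>(i, j). ereal (\<Phi> i j)) = \<infinity>"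
  shows "\<exists>f\<in>H_square m p.
      (\<Sum>\<^sub>\<infinity>(k, l)\<in>ratio_cone \<alpha>.
          epowr (Lp_norm \<mu>2 p (\<lambda>z. ennreal (cmod (vil_S m f k l z)))) p
          * ennreal (\<Phi> k l) / ennreal ((real k * real l) powr (2 - p))) = \<infinity>"
proof -
  have large: "\<exists>i j. C < \<Phi> i j" for C
  proof (rule ccontr)
    assume "\<not> ?thesis"
    then have "\<forall>z. (case z of (i, j) \<Rightarrow> ereal (\<Phi> i j)) \<le> ereal C" by (auto simp: not_less)
    then have "Limsup (sequentially \<times>\<^sub>F sequentially) (\<lambda>(i, j). ereal (\<Phi> i j)) \<le> ereal C"
      by (intro Limsup_bounded always_eventually)
    then show False using unbounded by simp
  qed
  \<comment> \<open>Orders between \<open>M (N j)\<close> and \<open>(1 + \<delta>) * M (N j)\<close> form pairs in the cone and stay within the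
    \<open>j\<close>-th block of characters.\<close>
  define \<delta> where "\<delta> = min 1 (2 powr \<alpha> - 1)"
  have \<delta>: "0 < \<delta>" "\<delta> \<le> 1" "1 + \<delta> \<le> 2 powr \<alpha>"
    using \<alpha> powr_less_mono[of 0 \<alpha> 2] by (auto simp: \<delta>_def)
  have "\<exists>K. \<forall>n\<ge>K. 0 < n \<and> real (m 0) \<le> \<delta> * real (M n) \<and> 4 ^ j \<le> \<Phi> (M n) (M n)" for j :: nat
  proof -
    obtain i i' where i: "4 ^ j < \<Phi> i i'" using large by blast
    obtain r :: nat where r: "real (m 0) / \<delta> \<le> real r" using real_arch_simple by blast
    show ?thesis
    proof (intro exI allI impI)
      fix n assume n: "Suc (i + i' + r) \<le> n"
      then have M: "i \<le> M n" "i' \<le> M n" "r \<le> M n" using less_M[of n] by linarith+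
      have "real (m 0) / \<delta> \<le> real (M n)" using r M(3) by linarith
      then show "0 < n \<and> real (m 0) \<le> \<delta> * real (M n) \<and> 4 ^ j \<le> \<Phi> (M n) (M n)"
        using n i mono[OF M(1,2)] \<delta>(1) by (auto simp: field_simps)
    qed
  qed
  then obtain K where K: "\<And>j n. K j \<le> n \<Longrightarrow> 0 < n \<and> real (m 0) \<le> \<delta> * real (M n) \<and> 4 ^ j \<le> \<Phi> (M n) (M n)"
    by metis
  \<comment> \<open>Partial sums make the sequence of levels strictly increasing.\<close>
  define N where "N j = (\<Sum>i\<le>j. Suc (K i))" for j
  have N_ge: "K j \<le> N j" for j
    unfolding N_def using member_le_sum[of j "{..j}" "\<lambda>i. Suc (K i)"] by simp
  note N = K[OF N_ge]
  define c where "c j = (1 / 2 ^ j) powr (1 / p) * real (M (N j)) powr (2 / p - 2)" for j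
  have cp: "c j powr p = 1 / 2 ^ j * real (M (N j)) powr (2 - 2 * p)" for j
  proof -
    have "(2 / p - 2) * p = 2 - 2 * p" using p_pos by (simp add: field_simps)
    then show ?thesis using p_pos by (simp add: c_def powr_mult powr_powr)
  qed
  interpret lacunary m B p N c
  proof unfold_locales
    show "strict_mono N" by (rule strict_monoI_Suc) (simp add: N_def)
    show "0 < N j" for j using N by blast
    show "0 < c j" for j by (simp add: c_def)
  qed
  have "(\<lambda>j. c j powr p * real (M (N j)) powr (2 * p - 2)) = (\<lambda>j. (1 / 2) ^ j)"
    by (simp add: cp power_one_over mult.assoc flip: powr_add)
  then have H: "lac \<in> H_square m p"
    by (intro lac_in_H_square) (simp add: summable_geometric)
  let ?f = "\<lambda>(k, l). epowr (Lp_norm \<mu>2 p (\<lambda>z. ennreal (cmod (vil_S m lac k l z)))) p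
          * ennreal (\<Phi> k l) / ennreal ((real k * real l) powr (2 - p))"
  have block_sum: "ennreal (2 ^ j * (\<delta>\<^sup>2 / (256 * (real (m 0))\<^sup>2))) \<le> infsum ?f (ratio_cone \<alpha>)" for j
  proof -
    let ?M = "M (N j)"
    have Mpos: "0 < real ?M" by simp
    \<comment> \<open>The number of admissible orders in each variable; at least half of \<open>\<delta> * M (N j) / m 0\<close>, since the
      latter is at least \<open>1\<close>.\<close>
    define T where "T = nat \<lfloor>\<delta> * real ?M / real (m 0)\<rfloor>"
    have m0: "0 < real (m 0)" by simp
    have "1 \<le> \<delta> * real ?M / real (m 0)" using N[of j] m0 by (simp add: field_simps)
    then have T: "real T \<le> \<delta> * real ?M / real (m 0)" "\<delta> * real ?M / real (m 0) \<le> 2 * real T"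
    proof -
      have "real (nat \<lfloor>x\<rfloor>) \<le> x \<and> x \<le> 2 * real (nat \<lfloor>x\<rfloor>)" if "1 \<le> x" for x :: real
      proof -
        have "1 \<le> \<lfloor>x\<rfloor>" using that by simp
        then show ?thesis by linarith
      qed
      then show "real T \<le> \<delta> * real ?M / real (m 0)" "\<delta> * real ?M / real (m 0) \<le> 2 * real T"
        using \<open>1 \<le> \<delta> * real ?M / real (m 0)\<close> unfolding T_def by blast+
    qed
    have index: "real (Suc (s * M 1)) \<le> \<delta> * real ?M" if "s < T" for s
    proof -
      have "real (Suc (s * M 1)) \<le> real (Suc s * m 0)"
        using m_ge2[of 0] unfolding of_nat_le_iff by (simp add: vil_M_Suc vil_M_0)
      also have "\<dots> \<le> real T * real (m 0)"
        unfolding of_nat_mult using that by (intro mult_right_mono) auto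
      also have "\<dots> \<le> \<delta> * real ?M" using T(1) m0 by (simp add: field_simps)
      finally show ?thesis .
    qed
    have index': "s * M 1 < ?M" if "s < T" for s
    proof -
      have "\<delta> * real ?M \<le> 1 * real ?M" using \<delta>(2) by (rule mult_right_mono) simp
      with index[OF that] have "real (Suc (s * M 1)) \<le> real ?M" by linarith
      then show ?thesis by (simp only: of_nat_le_iff Suc_le_eq)
    qed
    define g where "g = (\<lambda>(s, t). (?M + Suc (s * M 1), ?M + Suc (t * M 1)))"
    have inj: "inj_on g ({..<T} \<times> {..<T})" by (auto simp: inj_on_def g_def)
    have pos: "0 < real (?M + Suc x)" for x unfolding of_nat_0_less_iff by simp
    have ratio: "real (?M + Suc (s * M 1)) / real (?M + Suc (t * M 1)) \<le> 2 powr \<alpha>" if "s < T" for s t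
    proof -
      have "real (?M + Suc (s * M 1)) \<le> (1 + \<delta>) * real ?M"
        using index[OF that] by (simp add: algebra_simps)
      also have "\<dots> \<le> 2 powr \<alpha> * real (?M + Suc (t * M 1))"
        using \<delta>(3) by (intro mult_mono) auto
      finally show ?thesis by (simp only: pos_divide_le_eq[OF pos])
    qed
    have cone: "g ` ({..<T} \<times> {..<T}) \<subseteq> ratio_cone \<alpha>"
    proof
      fix z assume "z \<in> g ` ({..<T} \<times> {..<T})"
      then obtain s t where st: "s < T" "t < T" and z: "z = (?M + Suc (s * M 1), ?M + Suc (t * M 1))"
        by (auto simp: g_def)
      have inv: "2 powr (- \<alpha>) \<le> x / y" if "0 < x" "0 < y" "y / x \<le> 2 powr \<alpha>" for x y :: real
        using that by (simp add: powr_minus_divide field_simps)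
      have "2 powr (- \<alpha>) \<le> real (?M + Suc (s * M 1)) / real (?M + Suc (t * M 1))"
        by (rule inv[OF pos pos ratio[OF st(2)]])
      then show "z \<in> ratio_cone \<alpha>"
        using ratio[OF st(1), of t] by (simp add: z ratio_cone_def del: of_nat_add of_nat_Suc of_nat_mult)
    qed
    have val: "ennreal (2 ^ j / (64 * (real ?M)\<^sup>2)) \<le> ?f (g st)" if st: "st \<in> {..<T} \<times> {..<T}" for st
    proof -
      obtain s t where [simp]: "st = (s, t)" and "s < T" "t < T" using st by auto
      define k l where "k = ?M + Suc (s * M 1)" and "l = ?M + Suc (t * M 1)"
      have "k \<le> 2 * ?M" "l \<le> 2 * ?M"
        using index'[OF \<open>s < T\<close>] index'[OF \<open>t < T\<close>] by (simp_all add: k_def l_def)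
      then have kl: "real k \<le> 2 * real ?M" "real l \<le> 2 * real ?M"
        by (metis of_nat_le_iff of_nat_mult of_nat_numeral)+
      have Mkl: "?M \<le> k" "?M \<le> l" by (simp_all add: k_def l_def)
      have klpos: "0 < real k" "0 < real l" unfolding k_def l_def by (rule pos)+
      have \<Phi>: "4 ^ j \<le> \<Phi> k l"
        using N[of j] mono[OF Mkl] by linarith
      have "(real k * real l) powr (2 - p) \<le> (2 * real ?M * (2 * real ?M)) powr (2 - p)"
        using kl p_less_1 by (intro powr_mono2 mult_mono) auto
      also have "\<dots> = 4 powr (2 - p) * (real ?M) powr (2 * (2 - p))"
        by (simp add: powr_mult mult_ac flip: powr_add)
      also have "\<dots> \<le> 4 powr 2 * (real ?M) powr (4 - 2 * p)"
        using p_pos M_pos[of "N j"] by (intro mult_mono powr_mono) (auto simp: Suc_le_eq simp del: M_pos)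
      finally have den: "(real k * real l) powr (2 - p) \<le> 16 * (real ?M) powr (4 - 2 * p)" by simp
      have denpos: "0 < (real k * real l) powr (2 - p)"
        using klpos by simp
      have "2 ^ j / (64 * (real ?M)\<^sup>2) = c j powr p / 4 * 4 ^ j / (16 * (real ?M) powr (4 - 2 * p))"
      proof -
        have "(real ?M) powr (4 - 2 * p) = (real ?M) powr (2 - 2 * p) * (real ?M)\<^sup>2"
          using Mpos by (simp flip: powr_numeral powr_add)
        moreover have "(4::real) ^ j = 2 ^ j * 2 ^ j" by (simp flip: power_mult_distrib)
        ultimately show ?thesis using Mpos by (simp add: cp)
      qed
      also have "\<dots> \<le> c j powr p / 4 * \<Phi> k l / (real k * real l) powr (2 - p)"
        using den denpos \<Phi> by (intro frac_le mult_left_mono mult_nonneg_nonneg) (auto intro: order_trans[OF _ \<Phi>])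
      finally have "ennreal (2 ^ j / (64 * (real ?M)\<^sup>2))
          \<le> ennreal (c j powr p / 4 * \<Phi> k l / (real k * real l) powr (2 - p))"
        by (rule ennreal_leI)
      also have "\<dots> = ennreal (c j powr p / 4) * ennreal (\<Phi> k l) / ennreal ((real k * real l) powr (2 - p))"
        using denpos ge1[of k l] by (simp add: divide_ennreal flip: ennreal_mult)
      also have "\<dots> \<le> ?f (k, l)"
        unfolding prod.case k_def l_def
        by (intro divide_right_mono_ennreal mult_right_mono Lp_norm_vil_S_lac_ge index' \<open>s < T\<close> \<open>t < T\<close>) simp
      finally show ?thesis by (simp add: g_def k_def l_def)
    qed
    have "2 ^ j * (\<delta>\<^sup>2 / (256 * (real (m 0))\<^sup>2)) = 2 ^ j / (64 * (real ?M)\<^sup>2) * (\<delta> * real ?M / real (m 0) / 2)\<^sup>2"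
      using Mpos by (simp add: power_mult_distrib power_divide)
    also have "\<dots> \<le> 2 ^ j / (64 * (real ?M)\<^sup>2) * (real T)\<^sup>2"
      using T(2) \<delta>(1) by (intro mult_left_mono power_mono) auto
    finally have "ennreal (2 ^ j * (\<delta>\<^sup>2 / (256 * (real (m 0))\<^sup>2))) \<le> ennreal (2 ^ j / (64 * (real ?M)\<^sup>2) * (real T)\<^sup>2)"
      by (rule ennreal_leI)
    also have "\<dots> = (\<Sum>st\<in>{..<T} \<times> {..<T}. ennreal (2 ^ j / (64 * (real ?M)\<^sup>2)))"
      by (subst sum_ennreal) (simp_all add: power2_eq_square mult_ac)
    also have "\<dots> \<le> (\<Sum>st\<in>{..<T} \<times> {..<T}. ?f (g st))"
      by (rule sum_mono) (rule val)
    also have "\<dots> = sum ?f (g ` ({..<T} \<times> {..<T}))"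
      by (simp only: sum.reindex[OF inj] o_def)
    also have "\<dots> \<le> infsum ?f (ratio_cone \<alpha>)"
      by (rule sum_le_infsum_ennreal) (use cone in auto)
    finally show ?thesis .
  qed
  have "infsum ?f (ratio_cone \<alpha>) = \<infinity>"
  proof (cases "infsum ?f (ratio_cone \<alpha>)")
    case (real r)
    let ?b = "\<delta>\<^sup>2 / (256 * (real (m 0))\<^sup>2)"
    have b: "0 < ?b" using \<delta>(1) by simp
    obtain j where "r / ?b < 2 ^ j" using real_arch_pow[of 2 "r / ?b"] by auto
    then have "r < 2 ^ j * ?b" by (simp only: pos_divide_less_eq[OF b])
    moreover have "2 ^ j * ?b \<le> r"
      using block_sum[of j] ennreal_le_iff[OF real(1)] unfolding real(2) by blast
    ultimately show ?thesis by linarith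
  qed simp
  then show ?thesis using H by blast
qed

end

section \<open>Strong convergence and its sharpness\<close>

theorem theorem4:
  fixes m :: "nat \<Rightarrow> nat" and p :: real
  assumes "vil_seq m" and "0 < p" and "p < 1"
  shows
    "(\<forall>\<alpha>\<ge>0. \<exists>c::real. 0 < c \<and> (\<forall>f\<in>H_square m p.
        (\<Sum>\<^sub>\<infinity>(k, l)\<in>ratio_cone \<alpha>.
            epowr (Lp_norm (vil_measure2 m) p (\<lambda>z. ennreal (cmod (vil_S m f k l z)))) p
            / ennreal ((real k * real l) powr (2 - p)))
        \<le> ennreal c * epowr (H_norm m p f) p)) \<and>
     (\<forall>\<alpha>>0. \<forall>\<Phi> :: nat \<Rightarrow> nat \<Rightarrow> real.
        (\<forall>i j. 1 \<le> \<Phi> i j) \<longrightarrow>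
        (\<forall>i i' j j'. i \<le> i' \<longrightarrow> j \<le> j' \<longrightarrow> \<Phi> i j \<le> \<Phi> i' j') \<longrightarrow>
        Limsup (sequentially \<times>\<^sub>F sequentially) (\<lambda>(i, j). ereal (\<Phi> i j)) = \<infinity> \<longrightarrow>
        (\<exists>f\<in>H_square m p.
          (\<Sum>\<^sub>\<infinity>(k, l)\<in>ratio_cone \<alpha>.
              epowr (Lp_norm (vil_measure2 m) p (\<lambda>z. ennreal (cmod (vil_S m f k l z)))) p
              * ennreal (\<Phi> k l) / ennreal ((real k * real l) powr (2 - p))) = \<infinity>))"
proof -
  obtain B where "\<forall>k. m k \<le> B" using assms(1) by (auto simp: vil_seq_def)
  then interpret vilenkin_p m B p
    using assms by unfold_locales (auto simp: vil_seq_def)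
  show ?thesis
  proof (intro conjI allI impI)
    fix \<alpha> :: real assume \<alpha>: "0 \<le> \<alpha>"
    show "\<exists>c::real. 0 < c \<and> (\<forall>f\<in>H_square m p.
        (\<Sum>\<^sub>\<infinity>(k, l)\<in>ratio_cone \<alpha>.
            epowr (Lp_norm (vil_measure2 m) p (\<lambda>z. ennreal (cmod (vil_S m f k l z)))) p
            / ennreal ((real k * real l) powr (2 - p)))
        \<le> ennreal c * epowr (H_norm m p f) p)"
    proof (intro exI conjI ballI)
      show "0 < decomp_const \<alpha> + 1" using decomp_const_nonneg[of \<alpha>] by linarith
    qed (rule strong_sum_le_H_norm[OF _ \<alpha>])
  qed (rule exists_lacunary_divergent; blast)
qed

end
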